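(* For any $\varepsilon\in(0,\tfrac12)$, there is a $(1+\varepsilon)$-approximation algorithm for the Generalized Binary $\ell_0$-Rank-$k$ problem that runs in time $(1/\varepsilon)^{2^{O(k)}/\varepsilon^{2}}\cdot n d^{1+o(1)}$ and succeeds with constant probability, where the $o(1)$ in the exponent stands for a factor $(\log\log d)^{1.1}/\log d$.
   Context: Generalized Binary $\ell_0$-Rank-$k$: given $A\in\{0,1\}^{n\times d}$ with $n\ge d$, a positive integer $k$, and an inner product function $\langle\cdot,\cdot\rangle:\{0,1\}^k\times\{0,1\}^k\to\mathbb{R}$ (assumed evaluable in time $2^{O(k)}$), compute $U\in\{0,1\}^{n\times k}$ and $V\in\{0,1\}^{k\times d}$ minimizing $\|A-U\cdot V\|_0$, where $U\cdot V$ is the $n\times d$ matrix with $(U\cdot V)_{i,j}=\langle U_{i,:},V_{:,j}\rangle$ and $\|M\|_0$ is the number of nonzero entries of $M$. An algorithm is an $\alpha$-approximation if it outputs $U,V$ with $\|A-U V\|_0\le\alpha\cdot\min_{U'\in\{0,1\}^{n\times k},V'\in\{0,1\}^{k\times d}}\|A-U'V'\|_0$. Special cases include the ordinary real product, the product over $\mathbb{F}_2$, and the Boolean semiring product $\langle x,y\rangle=\bigvee_i (x_i\wedge y_i)$. *)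

theory Defs
  imports "HOL-Probability.Probability" "Jordan_Normal_Form.Matrix"
begin

section \<open>Generalized Binary l0-Rank-k\<close>

type_synonym inner_prod = "real vec \<Rightarrow> real vec \<Rightarrow> real"

definition binary_mats :: "nat \<Rightarrow> nat \<Rightarrow> real mat set" where
  "binary_mats n d = {M \<in> carrier_mat n d. elements_mat M \<subseteq> {0, 1}}"

definition gen_mult :: "inner_prod \<Rightarrow> real mat \<Rightarrow> real mat \<Rightarrow> real mat" where
  "gen_mult ip U V = mat (dim_row U) (dim_col V) (\<lambda>(i, j). ip (row U i) (col V j))"

definition l0_norm :: "real mat \<Rightarrow> nat" where
  "l0_norm M = card {(i, j). i < dim_row M \<and> j < dim_col M \<and> M $$ (i, j) \<noteq> 0}"

definition l0_opt :: "nat \<Rightarrow> inner_prod \<Rightarrow> real mat \<Rightarrow> nat" where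
  "l0_opt k ip A =
     (MIN (U, V) \<in> binary_mats (dim_row A) k \<times> binary_mats k (dim_col A).
        l0_norm (A - gen_mult ip U V))"

definition approx_solution ::
    "real \<Rightarrow> nat \<Rightarrow> inner_prod \<Rightarrow> real mat \<Rightarrow> real mat \<Rightarrow> real mat \<Rightarrow> bool" where
  "approx_solution \<alpha> k ip A U V \<longleftrightarrow>
     U \<in> binary_mats (dim_row A) k \<and> V \<in> binary_mats k (dim_col A) \<and>
     real (l0_norm (A - gen_mult ip U V)) \<le> \<alpha> * real (l0_opt k ip A)"

lemma gen_mult_scalar_prod: "gen_mult scalar_prod U V = U * V"
  unfolding gen_mult_def times_mat_def ..

section \<open>Randomized word RAM with an inner product oracle\<close>

text \<open>
  Registers and memory cells hold words, i.e. natural numbers below \<open>2 ^ w\<close> for a word length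
  \<open>w\<close>; a program may name finitely many registers, while memory is accessed indirectly. The values
  of the inner product are arbitrary reals, so they do not fit into a word: the oracle instruction
  \<open>Inner\<close> places the value in a separate real accumulator, which can only be compared with a word
  (enough to test whether an entry of \<open>A\<close> and the value agree). An oracle call costs \<open>\<tau>\<close>, the time
  needed to evaluate the inner product once; every other instruction costs 1. Results exceeding a word are reduced modulo \<open>2 ^ w\<close>. As usual for word RAMs,
  \<open>w\<close> is a parameter of the machine that programs do not know, meant to be at least a constant
  multiple of the logarithm of the running time, so that indices and counters fit into a word.
\<close>

datatype arith = Add | Sub | Mul | Div | Mod

datatype instr =
    Const nat nat             \<comment> \<open>\<open>Const r c\<close>: load the constant \<open>c\<close> into register \<open>r\<close>\<close>
  | Arith arith nat nat nat   \<comment> \<open>destination register, two operand registers\<close>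
  | Load nat nat              \<comment> \<open>\<open>Load r s\<close>: register \<open>r\<close> gets the cell whose address is in \<open>s\<close>\<close>
  | Store nat nat             \<comment> \<open>\<open>Store r s\<close>: the cell whose address is in \<open>r\<close> gets register \<open>s\<close>\<close>
  | Rand nat nat              \<comment> \<open>\<open>Rand r s\<close>: register \<open>r\<close> gets a uniform number below register \<open>s\<close>\<close>
  | Jump nat
  | Jump_Less nat nat nat     \<comment> \<open>two registers to compare, jump target\<close>
  | Inner nat nat             \<comment> \<open>registers with the start addresses of two vectors of k cells\<close>
  | Jump_Acc nat nat          \<comment> \<open>\<open>Jump_Acc r l\<close>: jump to \<open>l\<close> if the accumulator equals register \<open>r\<close>\<close>

record state =
  pc :: nat
  reg :: "nat \<Rightarrow> nat"
  mem :: "nat \<Rightarrow> nat"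
  acc :: real
  cost :: nat

fun arith_op :: "arith \<Rightarrow> nat \<Rightarrow> nat \<Rightarrow> nat" where
  "arith_op Add x y = x + y"
| "arith_op Sub x y = x - y"
| "arith_op Mul x y = x * y"
| "arith_op Div x y = x div y"
| "arith_op Mod x y = x mod y"

text \<open>Any nonzero word represents the bit 1, so the oracle only ever sees vectors in \<open>{0, 1}\<^sup>k\<close>.\<close>

definition mem_bit :: "state \<Rightarrow> nat \<Rightarrow> real" where
  "mem_bit s a = of_bool (mem s a \<noteq> 0)"

definition mem_vec :: "nat \<Rightarrow> state \<Rightarrow> nat \<Rightarrow> real vec" where
  "mem_vec k s a = vec k (\<lambda>i. mem_bit s (a + i))"

definition mem_mat :: "nat \<Rightarrow> nat \<Rightarrow> state \<Rightarrow> nat \<Rightarrow> real mat" where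
  "mem_mat n d s a = mat n d (\<lambda>(i, j). mem_bit s (a + i * d + j))"

definition set_reg :: "nat \<Rightarrow> nat \<Rightarrow> state \<Rightarrow> state" where
  "set_reg r x s = s\<lparr>reg := (reg s)(r := x), pc := Suc (pc s)\<rparr>"

definition jump_if :: "bool \<Rightarrow> nat \<Rightarrow> state \<Rightarrow> state" where
  "jump_if b l s = s\<lparr>pc := if b then l else Suc (pc s)\<rparr>"

fun instr_cost :: "nat \<Rightarrow> instr \<Rightarrow> nat" where
  "instr_cost \<tau> (Inner r q) = \<tau>"
| "instr_cost \<tau> _ = 1"

fun exec :: "nat \<Rightarrow> nat \<Rightarrow> inner_prod \<Rightarrow> instr \<Rightarrow> state \<Rightarrow> state pmf" where
  "exec w k ip (Const r c) s = return_pmf (set_reg r (take_bit w c) s)"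
| "exec w k ip (Arith f r q t) s =
     return_pmf (set_reg r (take_bit w (arith_op f (reg s q) (reg s t))) s)"
| "exec w k ip (Load r q) s = return_pmf (set_reg r (mem s (reg s q)) s)"
| "exec w k ip (Store r q) s =
     return_pmf (s\<lparr>mem := (mem s)(reg s r := reg s q), pc := Suc (pc s)\<rparr>)"
| "exec w k ip (Rand r q) s =
     (if reg s q = 0 then return_pmf (set_reg r 0 s)
      else map_pmf (\<lambda>x. set_reg r x s) (pmf_of_set {..<reg s q}))"
| "exec w k ip (Jump l) s = return_pmf (jump_if True l s)"
| "exec w k ip (Jump_Less r q l) s = return_pmf (jump_if (reg s r < reg s q) l s)"
| "exec w k ip (Inner r q) s =
     return_pmf (s\<lparr>acc := ip (mem_vec k s (reg s r)) (mem_vec k s (reg s q)), pc := Suc (pc s)\<rparr>)"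
| "exec w k ip (Jump_Acc r l) s = return_pmf (jump_if (acc s = real (reg s r)) l s)"

text \<open>A program halts when its program counter leaves the program; halted states do not change.\<close>

definition halted :: "instr list \<Rightarrow> state \<Rightarrow> bool" where
  "halted P s \<longleftrightarrow> length P \<le> pc s"

definition step :: "instr list \<Rightarrow> nat \<Rightarrow> nat \<Rightarrow> inner_prod \<Rightarrow> nat \<Rightarrow> state \<Rightarrow> state pmf" where
  "step P w k ip \<tau> s =
     (if halted P s then return_pmf s
      else map_pmf (\<lambda>s'. s'\<lparr>cost := cost s' + instr_cost \<tau> (P ! pc s)\<rparr>) (exec w k ip (P ! pc s) s))"

fun steps ::
    "instr list \<Rightarrow> nat \<Rightarrow> nat \<Rightarrow> inner_prod \<Rightarrow> nat \<Rightarrow> nat \<Rightarrow> state \<Rightarrow> state pmf" where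
  "steps P w k ip \<tau> 0 s = return_pmf s"
| "steps P w k ip \<tau> (Suc t) s = bind_pmf (step P w k ip \<tau> s) (steps P w k ip \<tau> t)"

text \<open>
  Input: \<open>n\<close>, \<open>d\<close>, \<open>k\<close> in registers 0, 1, 2, and \<open>A\<close> row by row in the memory cells from address 0
  on; all else is 0. Output: registers 0 and 1 hold the addresses at which \<open>U\<close> and \<open>V\<close> are stored,
  again row by row.
\<close>

definition init_state :: "nat \<Rightarrow> nat \<Rightarrow> real mat \<Rightarrow> state" where
  "init_state w k A =
     (let n = dim_row A; d = dim_col A in
      \<lparr>pc = 0,
       reg = (\<lambda>_. 0)(0 := take_bit w n, 1 := take_bit w d, 2 := take_bit w k),
       mem = (\<lambda>a. if a < n * d then of_bool (A $$ (a div d, a mod d) \<noteq> 0) else 0),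
       acc = 0,
       cost = 0\<rparr>)"

definition output_left :: "nat \<Rightarrow> real mat \<Rightarrow> state \<Rightarrow> real mat" where
  "output_left k A s = mem_mat (dim_row A) k s (reg s 0)"

definition output_right :: "nat \<Rightarrow> real mat \<Rightarrow> state \<Rightarrow> real mat" where
  "output_right k A s = mem_mat k (dim_col A) s (reg s 1)"

text \<open>
  Since every instruction costs at least 1 (for \<open>\<tau> \<ge> 1\<close>), a run of cost at most \<open>T\<close> has halted after
  \<open>\<lfloor>T\<rfloor>\<close> steps. The time bound is required of every run, whatever the random choices.
\<close>

definition final_states ::
    "instr list \<Rightarrow> nat \<Rightarrow> nat \<Rightarrow> inner_prod \<Rightarrow> nat \<Rightarrow> real mat \<Rightarrow> real \<Rightarrow> state pmf" where
  "final_states P w k ip \<tau> A T = steps P w k ip \<tau> (nat \<lfloor>T\<rfloor>) (init_state w k A)"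

definition runs_in_time ::
    "instr list \<Rightarrow> nat \<Rightarrow> nat \<Rightarrow> inner_prod \<Rightarrow> nat \<Rightarrow> real mat \<Rightarrow> real \<Rightarrow> bool" where
  "runs_in_time P w k ip \<tau> A T \<longleftrightarrow>
     (\<forall>s \<in> set_pmf (final_states P w k ip \<tau> A T). halted P s \<and> real (cost s) \<le> T)"

definition success_prob ::
    "instr list \<Rightarrow> nat \<Rightarrow> nat \<Rightarrow> inner_prod \<Rightarrow> nat \<Rightarrow> real mat \<Rightarrow> real \<Rightarrow> real \<Rightarrow> real" where
  "success_prob P w k ip \<tau> A T \<alpha> =
     measure_pmf.prob (final_states P w k ip \<tau> A T)
       {s. halted P s \<and> approx_solution \<alpha> k ip A (output_left k A s) (output_right k A s)}"

text \<open>
  The running time, with \<open>2 powr (C * k)\<close> for \<open>2\<^bsup>O(k)\<^esup>\<close>. Logarithms are binary, which makes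
  \<open>log 2 (log 2 d)\<close> nonnegative for all \<open>d \<ge> 2\<close>; for \<open>d = 1\<close> the last factor is 1, the exponent
  being irrelevant.
\<close>

definition time_bound :: "real \<Rightarrow> real \<Rightarrow> nat \<Rightarrow> nat \<Rightarrow> nat \<Rightarrow> real" where
  "time_bound C \<epsilon> k n d =
     (1 / \<epsilon>) powr (2 powr (C * real k) / \<epsilon>\<^sup>2) * real n *
     real d powr (1 + (log 2 (log 2 (real d))) powr 1.1 / log 2 (real d))"

end

theory Submission
  imports Defs
begin

text \<open>
  With \<open>K = 2 ^ k\<close>, rows of \<open>U\<close> and columns of \<open>V\<close> are codes below \<open>K\<close>, and the task is to choose codes
  that minimize the number of disagreements between \<open>A\<close> and a \<open>K \<times> K\<close> table of inner products. Given the
  codes of the rows, the best code of every column is found by inspection. If, for each of the \<open>K\<close>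
  clusters of columns of an optimal solution, we knew its size up to a factor \<open>1 + O(1/q)\<close> and had \<open>t\<close>
  uniform samples from it, then choosing for every row the code of least estimated cost would lose a factor
  of \<open>1 + 1/q\<close> only, by Chebyshev's inequality.

  The samples are guessed. Choosing \<open>K\<close> columns one after the other, with probability proportional to the
  Hamming distance to those chosen before, gives centers at total distance at most \<open>10 OPT\<close> with
  probability at least \<open>20 ^ -K\<close>. A column whose distance to the centers is small relative to the size of
  its cluster may be replaced by its nearest center; every other column has a probability in this
  distribution that is comparable to its probability under the uniform distribution on its cluster. Hence a
  sample that is a random center or a column drawn in this way dominates, up to a factor polynomial in
  \<open>K\<close> and \<open>q\<close>, the uniform one. A cluster size is guessed correctly with probability of order
  \<open>1 / (q log d)\<close>.

  So a trial succeeds with probability at least \<open>1 / N\<close>, where \<open>N\<close> is the product of a number depending on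
  \<open>K\<close> and \<open>q\<close> only and of a power \<open>(O(log d)) ^ K\<close>, and \<open>N\<close> trials are made. The last factor is absorbed
  by \<open>d powr ((log log d) powr 1.1 / log d)\<close> because \<open>K x \<le> K ^ 11 + x powr 1.1\<close>.
\<close>

section \<open>Uniform random tapes\<close>

text \<open>A union bound over the \<open>n\<close> rows would force \<open>t\<close> to grow with
  \<open>log n\<close>. Instead the expected regret of each row is bounded by a small multiple of
  its best cost, and Markov's inequality is applied once, to the total regret. Second moments are
  enough for this, and \<open>t\<close> depends on \<open>K\<close> and \<open>q\<close> alone. The
  time bound is due on every run, so all \<open>N * L\<close> random words are drawn in advance by
  one loop, and the rest of the program is verified as a deterministic function of this tape. A
  uniform choice below \<open>M\<close> thereby becomes a residue modulo \<open>M\<close>, which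
  loses a factor 2. Such losses are harmless: probabilities are only ever bounded from below, and
  more trials make up for them. The program may depend on \<open>\<epsilon>\<close> only, through
  \<open>q\<close>, and does not know the word length. Hence it computes \<open>K\<close>,
  \<open>t\<close>, \<open>b\<close> and \<open>N\<close> itself, together with a number
  \<open>H\<close> that exceeds all counts and indices; the random words are uniform below
  \<open>H\<close>.\<close>

lemma measure_bind_finite:
  assumes "finite A" "set_pmf p \<subseteq> A"
  shows "measure_pmf.prob (bind_pmf p f) E = (\<Sum>x\<in>A. pmf p x * measure_pmf.prob (f x) E)"
proof -
  have "measure_pmf.prob (bind_pmf p f) E = (\<integral>x. measure_pmf.prob (f x) E \<partial>measure_pmf p)"
    unfolding measure_pmf_bind
    by (subst measure_pmf.measure_bind[where N = "count_space UNIV"])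
      (auto simp: measure_pmf_in_subprob_algebra)
  also have "\<dots> = (\<Sum>x\<in>A. pmf p x * measure_pmf.prob (f x) E)"
    using assms by (subst integral_measure_pmf[of A]) auto
  finally show ?thesis .
qed

text \<open>Chains the phases of a trial: after every good outcome of the first draw, the next phase
  succeeds with probability at least \<open>\<rho>\<close>, whatever that outcome was.\<close>

lemma prob_bind_ge:
  assumes "finite (set_pmf p)" "0 \<le> \<rho>" "\<And>x. x \<in> set_pmf p \<Longrightarrow> x \<in> G \<Longrightarrow> \<rho> \<le> measure_pmf.prob (f x) E"
  shows "measure_pmf.prob p G * \<rho> \<le> measure_pmf.prob (bind_pmf p f) E"
proof -
  have "measure_pmf.prob p G = (\<Sum>x\<in>set_pmf p. pmf p x * measure_pmf.prob (return_pmf x) G)"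
    using measure_bind_finite[OF assms(1) subset_refl, of return_pmf G] by (simp add: bind_return_pmf')
  then have "measure_pmf.prob p G * \<rho> = (\<Sum>x\<in>set_pmf p. pmf p x * (indicator G x * \<rho>))"
    by (simp add: sum_distrib_right mult.assoc)
  also have "\<dots> \<le> (\<Sum>x\<in>set_pmf p. pmf p x * measure_pmf.prob (f x) E)"
    using assms(2,3) by (intro sum_mono mult_left_mono) (auto simp: indicator_def)
  finally show ?thesis by (simp add: measure_bind_finite[OF assms(1) subset_refl])
qed

text \<open>Every residue below \<open>M\<close> has at least \<open>B div M\<close> representatives
  below \<open>B\<close>, and \<open>M \<le> B\<close> makes \<open>B div M\<close> at least half of
  \<open>B / M\<close>. This is the price of drawing below \<open>M\<close> by reducing a tape
  word.\<close>

lemma prob_residues: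
  assumes M: "0 < M" "M \<le> B" and E: "E \<subseteq> {..<M}"
  shows "real (card E) / (2 * real M) \<le> measure_pmf.prob (pmf_of_set {..<B}) {z. z mod M \<in> E}"
proof -
  let ?f = "\<lambda>(e, q). q * M + e"
  have inj: "inj_on ?f (E \<times> {..<B div M})"
  proof (rule inj_onI, clarify)
    fix e q e' q' assume "e \<in> E" "e' \<in> E" and eq: "q * M + e = q' * M + e'"
    then have "e < M" "e' < M" using E by auto
    then have "(q * M + e) div M = q" "(q * M + e) mod M = e" "(q' * M + e') div M = q'" "(q' * M + e') mod M = e'"
      by auto
    then show "e = e' \<and> q = q'" using eq by metis
  qed
  have sub: "?f ` (E \<times> {..<B div M}) \<subseteq> {..<B} \<inter> {z. z mod M \<in> E}"
  proof clarify
    fix e q assume e: "e \<in> E" and q: "q < B div M"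
    then have "e < M" using E by auto
    have "(q + 1) * M \<le> (B div M) * M" using q by (intro mult_le_mono1) simp
    also have "\<dots> \<le> B" by simp
    finally show "q * M + e \<in> {..<B} \<inter> {z. z mod M \<in> E}" using \<open>e < M\<close> e by auto
  qed
  have "card E * (B div M) = card (E \<times> {..<B div M})" by (simp add: card_cartesian_product)
  also have "\<dots> = card (?f ` (E \<times> {..<B div M}))" using card_image[OF inj] by simp
  also have "\<dots> \<le> card ({..<B} \<inter> {z. z mod M \<in> E})" using sub by (intro card_mono) auto
  finally have c: "card E * (B div M) \<le> card ({..<B} \<inter> {z. z mod M \<in> E})" .
  have "B < (B div M + 1) * M" using dividend_less_times_div[OF M(1), of B] by (simp add: algebra_simps)
  moreover have "1 \<le> B div M" using M by (simp add: div_greater_zero_iff Suc_leI)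
  then have "(B div M + 1) * M \<le> (2 * (B div M)) * M" by (intro mult_le_mono1) simp
  ultimately have "B \<le> 2 * (B div M) * M" by linarith
  then have "card E * B \<le> card E * (2 * (B div M) * M)" by (intro mult_le_mono2)
  also have "\<dots> = (card E * (B div M)) * (2 * M)" by (simp add: algebra_simps)
  also have "\<dots> \<le> card ({..<B} \<inter> {z. z mod M \<in> E}) * (2 * M)" using c by (intro mult_le_mono1)
  finally have "real (card E * B) \<le> real (card ({..<B} \<inter> {z. z mod M \<in> E}) * (2 * M))"
    by (simp only: of_nat_le_iff)
  then have "real (card E) * real B \<le> real (card ({..<B} \<inter> {z. z mod M \<in> E})) * (2 * real M)" by simp
  then show ?thesis using M by (auto simp: measure_pmf_of_set lessThan_empty_iff field_simps)
qed

text \<open>Independent draws from different distributions, whereas \<open>replicate_pmf\<close>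
  repeats one: the ideal samples of different clusters follow different laws.\<close>

primrec plist :: "'a pmf list \<Rightarrow> 'a list pmf" where
  "plist [] = return_pmf []"
| "plist (p # ps) = bind_pmf p (\<lambda>x. map_pmf ((#) x) (plist ps))"

lemma finite_set_plist: "(\<And>p. p \<in> set ps \<Longrightarrow> finite (set_pmf p)) \<Longrightarrow> finite (set_pmf (plist ps))"
  by (induction ps) auto

lemma finite_set_replicate_pmf: "finite (set_pmf p) \<Longrightarrow> finite (set_pmf (replicate_pmf m p))"
  by (induction m) auto

lemma map_replicate_pmf: "map_pmf (map f) (replicate_pmf m p) = replicate_pmf m (map_pmf f p)"
proof (induction m)
  case (Suc m)
  show ?case by (simp add: map_bind_pmf bind_map_pmf Suc.IH[symmetric])
qed simp

text \<open>Change of measure: the lower bound \<open>\<alpha>\<close> on the likelihood ratio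
  multiplies over the coordinates. It transfers the analysis of samples from the unknown clusters to
  the samples that can actually be drawn.\<close>

lemma prob_plist_le:
  assumes "finite (set_pmf p)" "0 \<le> \<alpha>" "\<And>p' x. p' \<in> set ps \<Longrightarrow> \<alpha> * pmf p' x \<le> pmf p x"
    "\<And>p'. p' \<in> set ps \<Longrightarrow> finite (set_pmf p')"
  shows "\<alpha> ^ length ps * measure_pmf.prob (plist ps) E \<le> measure_pmf.prob (replicate_pmf (length ps) p) E"
  using assms(3,4)
proof (induction ps arbitrary: E)
  case (Cons q ps)
  let ?A = "set_pmf p \<union> set_pmf q"
  have fin: "finite ?A" using assms(1) Cons.prems by simp
  have "\<alpha> ^ length (q # ps) * measure_pmf.prob (plist (q # ps)) E =
    (\<Sum>x\<in>?A. (\<alpha> * pmf q x) * (\<alpha> ^ length ps * measure_pmf.prob (plist ps) ((#) x -` E)))"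
    using fin by (simp add: measure_bind_finite[of ?A] sum_distrib_left mult_ac)
  also have "\<dots> \<le> (\<Sum>x\<in>?A. pmf p x * measure_pmf.prob (replicate_pmf (length ps) p) ((#) x -` E))"
    using Cons assms(2) by (intro sum_mono mult_mono Cons.IH) auto
  also have "\<dots> = measure_pmf.prob (replicate_pmf (length (q # ps)) p) E"
    using fin by (simp add: measure_bind_finite[of ?A] flip: map_pmf_def)
  finally show ?case .
qed simp

lemma expectation_plist_Cons:
  fixes f :: "'a list \<Rightarrow> real"
  assumes "finite (set_pmf p)" "\<And>p. p \<in> set ps \<Longrightarrow> finite (set_pmf p)"
  shows "measure_pmf.expectation (plist (p # ps)) f =
    measure_pmf.expectation p (\<lambda>x. measure_pmf.expectation (plist ps) (\<lambda>xs. f (x # xs)))"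
proof -
  have "measure_pmf.expectation (plist (p # ps)) f =
    (\<Sum>x\<in>set_pmf p. pmf p x * measure_pmf.expectation (plist ps) (\<lambda>xs. f (x # xs)))"
    using assms finite_set_plist[of ps]
    by (simp add: pmf_expectation_bind[of "set_pmf p"])
  also have "\<dots> = measure_pmf.expectation p (\<lambda>x. measure_pmf.expectation (plist ps) (\<lambda>xs. f (x # xs)))"
    using integral_measure_pmf[OF assms(1), of p "\<lambda>x. measure_pmf.expectation (plist ps) (\<lambda>xs. f (x # xs))"]
    by simp
  finally show ?thesis .
qed

text \<open>The summands are independent and centered, so the cross terms vanish and variances add;
  the induction peels off the first draw.\<close>

lemma plist_moments:
  fixes h :: "nat \<Rightarrow> 'a \<Rightarrow> real"
  assumes "\<And>p. p \<in> set ps \<Longrightarrow> finite (set_pmf p)"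
    "\<And>s. s < length ps \<Longrightarrow> measure_pmf.expectation (ps ! s) (h s) = 0"
  shows "measure_pmf.expectation (plist ps) (\<lambda>xs. \<Sum>s<length ps. h s (xs ! s)) = 0 \<and>
    measure_pmf.expectation (plist ps) (\<lambda>xs. (\<Sum>s<length ps. h s (xs ! s))\<^sup>2) =
      (\<Sum>s<length ps. measure_pmf.expectation (ps ! s) (\<lambda>x. (h s x)\<^sup>2))"
  using assms
proof (induction ps arbitrary: h)
  case (Cons p ps)
  let ?H = "\<lambda>xs. \<Sum>s<length ps. h (Suc s) (xs ! s)"
  have IH: "measure_pmf.expectation (plist ps) ?H = 0"
    "measure_pmf.expectation (plist ps) (\<lambda>xs. (?H xs)\<^sup>2) =
      (\<Sum>s<length ps. measure_pmf.expectation (ps ! s) (\<lambda>x. (h (Suc s) x)\<^sup>2))"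
    using Cons.IH[of "\<lambda>s. h (Suc s)"] Cons.prems(1) Cons.prems(2)[of "Suc _"] by auto
  have fin: "finite (set_pmf p)" "finite (set_pmf (plist ps))" "\<And>p. p \<in> set ps \<Longrightarrow> finite (set_pmf p)"
    using Cons.prems(1) finite_set_plist[of ps] by auto
  note int = integrable_measure_pmf_finite[OF fin(1)] integrable_measure_pmf_finite[OF fin(2)]
  have h0: "measure_pmf.expectation p (h 0) = 0" using Cons.prems(2)[of 0] by simp
  have 1: "measure_pmf.expectation (plist ps) (\<lambda>xs. h 0 x + ?H xs) = h 0 x" for x
    using IH(1) by (simp add: int)
  have 2: "measure_pmf.expectation (plist ps) (\<lambda>xs. (h 0 x + ?H xs)\<^sup>2) =
      (h 0 x)\<^sup>2 + measure_pmf.expectation (plist ps) (\<lambda>xs. (?H xs)\<^sup>2)" for x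
  proof -
    have "(\<lambda>xs. (h 0 x + ?H xs)\<^sup>2) = (\<lambda>xs. (h 0 x)\<^sup>2 + (2 * h 0 x * ?H xs + (?H xs)\<^sup>2))"
      by (auto simp: power2_sum)
    then have "measure_pmf.expectation (plist ps) (\<lambda>xs. (h 0 x + ?H xs)\<^sup>2) =
      (h 0 x)\<^sup>2 + (2 * h 0 x * measure_pmf.expectation (plist ps) ?H + measure_pmf.expectation (plist ps) (\<lambda>xs. (?H xs)\<^sup>2))"
      by (simp add: int)
    then show ?thesis using IH(1) by simp
  qed
  show ?case
    using expectation_plist_Cons[OF fin(1,3), where f = "\<lambda>xs. \<Sum>s<length (p # ps). h s (xs ! s)"]
      expectation_plist_Cons[OF fin(1,3), where f = "\<lambda>xs. (\<Sum>s<length (p # ps). h s (xs ! s))\<^sup>2"]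
    by (simp add: sum.lessThan_Suc_shift 1 2 h0 IH(2) int del: sum.lessThan_Suc plist.simps)
qed simp

text \<open>Markov's inequality at twice the bound. For \<open>m = 0\<close>, where division is
  impossible and which occurs when the best cost is 0, \<open>F\<close> vanishes almost surely
  instead.\<close>

lemma prob_le_half:
  fixes F :: "'a \<Rightarrow> real"
  assumes fin: "finite (set_pmf p)" and F: "\<And>x. 0 \<le> F x" and E: "measure_pmf.expectation p F \<le> m"
  shows "1 / 2 \<le> measure_pmf.prob p {x. F x \<le> 2 * m}"
proof -
  have "0 \<le> measure_pmf.expectation p F" using F by (intro Bochner_Integration.integral_nonneg) auto
  then have m0: "0 \<le> m" using E by linarith
  have "2 * m * measure_pmf.prob p {x. 2 * m < F x} \<le> measure_pmf.expectation p F"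
  proof -
    have "2 * m * measure_pmf.prob p {x. 2 * m < F x} = measure_pmf.expectation p (\<lambda>x. 2 * m * indicator {x. 2 * m < F x} x)"
      by simp
    also have "\<dots> \<le> measure_pmf.expectation p F"
      using F fin by (intro integral_mono integrable_measure_pmf_finite) (auto simp: indicator_def)
    finally show ?thesis .
  qed
  have "measure_pmf.prob p {x. 2 * m < F x} \<le> 1 / 2"
  proof (cases "m = 0")
    case True
    have "measure_pmf.expectation p F = 0" using E \<open>0 \<le> measure_pmf.expectation p F\<close> True by linarith
    then have "AE x in measure_pmf p. F x = 0"
      using integral_nonneg_eq_0_iff_AE[of "measure_pmf p" F] F fin integrable_measure_pmf_finite by auto
    then have "measure_pmf.prob p {x. 2 * m < F x} = 0"
      by (subst measure_pmf.prob_eq_0) (auto simp: True AE_measure_pmf_iff)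
    then show ?thesis by simp
  next
    case False
    then have "m * (2 * measure_pmf.prob p {x. 2 * m < F x}) \<le> m * 1"
      using \<open>2 * m * measure_pmf.prob p {x. 2 * m < F x} \<le> measure_pmf.expectation p F\<close> E by simp
    then show ?thesis using False m0 by simp
  qed
  moreover have "{x. 2 * m < F x} = UNIV - {x. F x \<le> 2 * m}" by auto
  then have "measure_pmf.prob p {x. 2 * m < F x} = 1 - measure_pmf.prob p {x. F x \<le> 2 * m}"
    using measure_pmf.prob_compl[of "{x. F x \<le> 2 * m}" p] by simp
  ultimately show ?thesis by simp
qed

text \<open>The trials read disjoint blocks of one flat tape and hence fail independently; the
  induction splits off the first block.\<close>

lemma prob_all_blocks_bad:
  fixes p :: "'a pmf"
  assumes "finite (set_pmf p)" and good: "\<rho> \<le> measure_pmf.prob (replicate_pmf L p) {zs. good zs}" "\<rho> \<le> 1"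
  shows "measure_pmf.prob (replicate_pmf (N * L) p) {zs. \<forall>g<N. \<not> good (take L (drop (g * L) zs))} \<le> (1 - \<rho>) ^ N"
proof (induction N)
  case (Suc N)
  let ?R = "replicate_pmf L p" and ?Q = "replicate_pmf (N * L) p"
  have fin: "finite (set_pmf ?R)" using finite_set_replicate_pmf[OF assms(1)] .
  let ?E = "\<lambda>N. {zs. \<forall>g<N. \<not> good (take L (drop (g * L) zs))}"
  have "measure_pmf.prob (replicate_pmf (Suc N * L) p) (?E (Suc N)) =
    (\<Sum>xs\<in>set_pmf ?R. pmf ?R xs * measure_pmf.prob ?Q {ys. xs @ ys \<in> ?E (Suc N)})"
    using fin by (simp add: replicate_pmf_distrib measure_bind_finite[of "set_pmf ?R"] vimage_def flip: map_pmf_def)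
  also have "\<dots> \<le> (\<Sum>xs\<in>set_pmf ?R. pmf ?R xs * (indicator {zs. \<not> good zs} xs * (1 - \<rho>) ^ N))"
  proof (intro sum_mono mult_left_mono)
    fix xs assume xs: "xs \<in> set_pmf ?R"
    then have len: "length xs = L" by (auto simp: set_replicate_pmf)
    have "{ys. xs @ ys \<in> ?E (Suc N)} \<subseteq> (if good xs then {} else ?E N)"
    proof
      fix ys assume "ys \<in> {ys. xs @ ys \<in> ?E (Suc N)}"
      then have *: "\<not> good (take L (drop (g * L) (xs @ ys)))" if "g < Suc N" for g using that by auto
      have "\<not> good (take L (drop (g * L) ys))" if "g < N" for g using *[of "Suc g"] that len by simp
      moreover have "\<not> good xs" using *[of 0] len by simp
      ultimately show "ys \<in> (if good xs then {} else ?E N)" by simp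
    qed
    then have "measure_pmf.prob ?Q {ys. xs @ ys \<in> ?E (Suc N)} \<le> measure_pmf.prob ?Q (if good xs then {} else ?E N)"
      by (intro measure_pmf.finite_measure_mono) auto
    also have "\<dots> \<le> indicator {zs. \<not> good zs} xs * (1 - \<rho>) ^ N" using Suc.IH by auto
    finally show "measure_pmf.prob ?Q {ys. xs @ ys \<in> ?E (Suc N)} \<le> indicator {zs. \<not> good zs} xs * (1 - \<rho>) ^ N" .
  qed auto
  also have "\<dots> = (\<Sum>xs\<in>set_pmf ?R. pmf ?R xs * measure_pmf.prob (return_pmf xs) {zs. \<not> good zs}) * (1 - \<rho>) ^ N"
    by (simp add: sum_distrib_right mult.assoc)
  also have "(\<Sum>xs\<in>set_pmf ?R. pmf ?R xs * measure_pmf.prob (return_pmf xs) {zs. \<not> good zs}) =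
    measure_pmf.prob ?R {zs. \<not> good zs}"
    using measure_bind_finite[OF fin subset_refl, of return_pmf] by (simp add: bind_return_pmf')
  also have "\<dots> = 1 - measure_pmf.prob ?R {zs. good zs}"
    using measure_pmf.prob_compl[of "{zs. good zs}" ?R] by (simp add: Compl_eq_Diff_UNIV[symmetric] Collect_neg_eq)
  also have "\<dots> * (1 - \<rho>) ^ N \<le> (1 - \<rho>) * (1 - \<rho>) ^ N"
    using assms by (intro mult_right_mono zero_le_power) auto
  finally show ?case by simp
qed simp

section \<open>Sampling column centers\<close>

text \<open>Inversion of the cumulative weights: the selected index is the number of prefix sums
  that do not exceed the reduced word. The outer \<open>mod d\<close> acts only if all weights are
  0; then the count is \<open>d\<close> and column 0 is selected.\<close>

definition sel :: "nat \<Rightarrow> (nat \<Rightarrow> nat) \<Rightarrow> nat \<Rightarrow> nat" where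
  "sel d r z = card {j. j < d \<and> (\<Sum>j'\<le>j. r j') \<le> z mod (\<Sum>j'<d. r j')} mod d"

lemma sel_less: "0 < d \<Longrightarrow> sel d r z < d"
  by (simp add: sel_def)

lemma sel_eq:
  assumes "j < d" "(\<Sum>j'<j. r j') \<le> c" "c < (\<Sum>j'\<le>j. r j')"
  shows "sel d r c = j"
proof -
  have mono: "(\<Sum>j'<a. r j') \<le> (\<Sum>j'<b. r j')" if "a \<le> b" for a b
    using that by (intro sum_mono2) auto
  have "c < (\<Sum>j'<d. r j')"
    using assms mono[of "Suc j" d] by (simp add: lessThan_Suc_atMost)
  moreover have "{i. i < d \<and> (\<Sum>j'\<le>i. r j') \<le> c} = {..<j}"
  proof (rule Set.set_eqI, rule iffI)
    fix i assume "i \<in> {i. i < d \<and> (\<Sum>j'\<le>i. r j') \<le> c}"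
    then have "\<not> j \<le> i" using mono[of "Suc j" "Suc i"] assms(3) by (auto simp: lessThan_Suc_atMost)
    then show "i \<in> {..<j}" by simp
  next
    fix i assume "i \<in> {..<j}"
    then show "i \<in> {i. i < d \<and> (\<Sum>j'\<le>i. r j') \<le> c}"
      using mono[of "Suc i" j] assms by (auto simp: lessThan_Suc_atMost)
  qed
  ultimately show ?thesis using assms(1) by (simp add: sel_def)
qed

lemma card_sel:
  assumes "J \<subseteq> {..<d}"
  shows "(\<Sum>j\<in>J. r j) \<le> card {c. c < (\<Sum>j<d. r j) \<and> sel d r c \<in> J}"
proof -
  let ?I = "\<lambda>j. {(\<Sum>j'<j. r j')..<(\<Sum>j'\<le>j. r j')}"
  have fin: "finite J" using assms finite_subset by blast
  have I: "sel d r c = j" if "j \<in> J" "c \<in> ?I j" for c j using sel_eq that assms by auto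
  have disj: "\<forall>i\<in>J. \<forall>j\<in>J. i \<noteq> j \<longrightarrow> ?I i \<inter> ?I j = {}" using I by blast
  have "(\<Sum>j\<in>J. r j) = (\<Sum>j\<in>J. card (?I j))"
    by (intro sum.cong) (simp_all flip: lessThan_Suc_atMost)
  also have "\<dots> = card (\<Union>j\<in>J. ?I j)"
    using fin disj by (intro card_UN_disjoint[symmetric]) auto
  also have "\<dots> \<le> card {c. c < (\<Sum>j<d. r j) \<and> sel d r c \<in> J}"
  proof (intro card_mono)
    show "(\<Union>j\<in>J. ?I j) \<subseteq> {c. c < (\<Sum>j<d. r j) \<and> sel d r c \<in> J}"
    proof
      fix c assume "c \<in> (\<Union>j\<in>J. ?I j)"
      then obtain j where j: "j \<in> J" "c \<in> ?I j" by blast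
      have "(\<Sum>j'<Suc j. r j') \<le> (\<Sum>j'<d. r j')" using j(1) assms by (intro sum_mono2) auto
      then show "c \<in> {c. c < (\<Sum>j<d. r j) \<and> sel d r c \<in> J}"
        using I[OF j] j by (auto simp: lessThan_Suc_atMost)
    qed
  qed auto
  finally show ?thesis .
qed

lemma sel_mod: "sel d r (z mod (\<Sum>j<d. r j)) = sel d r z"
  by (simp add: sel_def)

lemma prob_sel:
  assumes "J \<subseteq> {..<d}" "0 < (\<Sum>j<d. r j)" "(\<Sum>j<d. r j) \<le> B"
  shows "real (\<Sum>j\<in>J. r j) / (2 * real (\<Sum>j<d. r j)) \<le>
    measure_pmf.prob (pmf_of_set {..<B}) {z. sel d r z \<in> J}"
proof -
  let ?R = "\<Sum>j<d. r j"
  let ?E = "{c. c < ?R \<and> sel d r c \<in> J}"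
  have "real (\<Sum>j\<in>J. r j) / (2 * real ?R) \<le> real (card ?E) / (2 * real ?R)"
    using card_sel[OF assms(1), of r] by (intro divide_right_mono) (simp_all del: of_nat_sum)
  also have "\<dots> \<le> measure_pmf.prob (pmf_of_set {..<B}) {z. z mod ?R \<in> ?E}"
    using assms by (intro prob_residues) auto
  also have "{z. z mod ?R \<in> ?E} = {z. sel d r z \<in> J}"
    using assms(2) by (auto simp: sel_mod)
  finally show ?thesis .
qed

text \<open>\<open>us\<close> and \<open>vs\<close> are the row and column codes of a reference
  solution, later an optimal one, and \<open>Z\<close> is the table of products; all costs are
  compared with its cost \<open>OPT\<close>. Everything is a natural number, so that the program
  computes exactly these quantities.\<close>

locale clustering =
  fixes n d K :: nat and A Z :: "nat \<Rightarrow> nat \<Rightarrow> nat" and us vs :: "nat \<Rightarrow> nat"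
  assumes d_pos: "0 < d" and K_ge2: "2 \<le> K"
    and vs_less: "\<And>j. j < d \<Longrightarrow> vs j < K" and us_less: "\<And>i. i < n \<Longrightarrow> us i < K"
begin

definition ham :: "nat \<Rightarrow> nat \<Rightarrow> nat" where
  "ham j j' = (\<Sum>i<n. of_bool (A i j \<noteq> A i j'))"

text \<open>Deviation of column \<open>j\<close> from the ideal column of cluster \<open>y\<close>,
  the one that the row codes \<open>us\<close> prescribe for code \<open>y\<close>.\<close>

definition dl :: "nat \<Rightarrow> nat \<Rightarrow> nat" where
  "dl y j = (\<Sum>i<n. of_bool (A i j \<noteq> Z (us i) y))"

definition Om :: "nat \<Rightarrow> nat set" where "Om y = {j. j < d \<and> vs j = y}"

definition sz :: "nat \<Rightarrow> nat" where "sz y = card (Om y)"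

definition opt :: "nat \<Rightarrow> nat" where "opt y = (\<Sum>j\<in>Om y. dl y j)"

definition OPT :: nat where "OPT = (\<Sum>j<d. dl (vs j) j)"

definition rad :: "nat list \<Rightarrow> nat \<Rightarrow> nat" where "rad X j = Min (ham j ` set X)"

definition RR :: "nat list \<Rightarrow> nat" where "RR X = (\<Sum>j<d. rad X j)"

text \<open>Some center deviates from the ideal column by at most four times the average deviation
  in the cluster; multiplied out to avoid division.\<close>

definition cov :: "nat list \<Rightarrow> nat \<Rightarrow> bool" where
  "cov X y \<longleftrightarrow> (\<exists>x\<in>set X. dl y x * sz y \<le> 4 * opt y)"

definition Cov :: "nat list \<Rightarrow> nat set" where "Cov X = {y. y < K \<and> 0 < sz y \<and> cov X y}"

definition Unc :: "nat list \<Rightarrow> nat set" where "Unc X = {y. y < K \<and> 0 < sz y \<and> \<not> cov X y}"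

text \<open>Columns of at most twice the average deviation: by Markov's inequality at least half of
  the cluster. Picking any of them as a center covers the cluster.\<close>

definition Gd :: "nat \<Rightarrow> nat set" where "Gd y = {j \<in> Om y. dl y j * sz y \<le> 2 * opt y}"

text \<open>The seeding of k-means++ with distances in place of squared distances, started from
  column 0. With \<open>K\<close> random words it yields \<open>K + 1\<close> centers.\<close>

definition cent :: "nat list \<Rightarrow> nat list" where
  "cent zs = foldl (\<lambda>X z. X @ [sel d (rad X) z]) [0] zs"

lemma finite_Om [simp]: "finite (Om y)" by (simp add: Om_def)

lemma Gd_sub: "Gd y \<subseteq> Om y" and finite_Gd [simp]: "finite (Gd y)"
  by (auto simp: Gd_def)

lemma ham_triangle: "ham j j' \<le> dl y j + dl y j'" "dl y j \<le> ham j j' + dl y j'"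
  unfolding ham_def dl_def sum.distrib[symmetric] by (intro sum_mono; auto)+

lemma ham_commute: "ham j j' = ham j' j"
  by (simp add: ham_def eq_commute)

lemma ham_le: "ham j j' \<le> n"
  unfolding ham_def using sum_mono[of "{..<n}" "\<lambda>i. of_bool (A i j \<noteq> A i j')" "\<lambda>_. 1::nat"] by simp

lemma sum_Om: "(\<Sum>j<d. f j) = (\<Sum>y<K. \<Sum>j\<in>Om y. f j)" for f :: "nat \<Rightarrow> 'b::comm_monoid_add"
proof -
  have "(\<Sum>y<K. \<Sum>j\<in>Om y. f j) = (\<Sum>y<K. \<Sum>j | j \<in> {..<d} \<and> vs j = y. f j)"
    by (simp add: Om_def)
  also have "\<dots> = (\<Sum>j<d. f j)" using vs_less by (intro sum.group) auto
  finally show ?thesis by simp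
qed

lemma OPT_eq: "OPT = (\<Sum>y<K. opt y)"
  unfolding OPT_def opt_def sum_Om by (intro sum.cong refl) (auto simp: Om_def)

lemma rad_le: "x \<in> set X \<Longrightarrow> rad X j \<le> ham j x"
  by (simp add: rad_def)

lemma rad_ex: "X \<noteq> [] \<Longrightarrow> \<exists>x\<in>set X. rad X j = ham j x"
  unfolding rad_def using Min_in[of "ham j ` set X"] by fastforce

lemma rad_le_n: "X \<noteq> [] \<Longrightarrow> rad X j \<le> n"
  using rad_ex ham_le by metis

lemma RR_le: "X \<noteq> [] \<Longrightarrow> RR X \<le> n * d"
  unfolding RR_def using sum_mono[of "{..<d}" "rad X" "\<lambda>_. n"] rad_le_n by (simp add: mult.commute)

lemma RR_snoc: "X \<noteq> [] \<Longrightarrow> RR (X @ [x]) \<le> RR X"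
  unfolding RR_def rad_def by (intro sum_mono) (auto intro!: Min_antimono)

lemma covered_mass: "cov X y \<Longrightarrow> (\<Sum>j\<in>Om y. rad X j) \<le> 5 * opt y"
proof -
  assume "cov X y"
  then obtain x where x: "x \<in> set X" "dl y x * sz y \<le> 4 * opt y" by (auto simp: cov_def)
  have "(\<Sum>j\<in>Om y. rad X j) \<le> (\<Sum>j\<in>Om y. dl y j + dl y x)"
    using rad_le[OF x(1)] ham_triangle(1) by (intro sum_mono) (meson order_trans)
  also have "\<dots> = opt y + dl y x * sz y" by (simp add: sum.distrib opt_def sz_def)
  finally show ?thesis using x(2) by simp
qed

text \<open>Let \<open>D\<close> be the least deviation of a center, more than four times the
  average. A column of \<open>Gd y\<close> deviates by at most twice the average, hence lies at
  distance at least \<open>D / 2\<close> from all centers. As \<open>Gd y\<close> is at least half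
  of the cluster, it carries mass at least \<open>sz y * D / 4\<close>, while the whole cluster
  carries at most \<open>opt y + sz y * D\<close>, which is at most
  \<open>5 / 4 * sz y * D\<close>.\<close>

lemma uncovered_mass:
  assumes X: "X \<noteq> []" and y: "\<not> cov X y" "0 < sz y"
  shows "(\<Sum>j\<in>Om y. rad X j) \<le> 5 * (\<Sum>j\<in>Gd y. rad X j)"
proof -
  define D where "D = Min (dl y ` set X)"
  have "D \<in> dl y ` set X" unfolding D_def using X by (intro Min_in) auto
  then obtain x0 where x0: "x0 \<in> set X" "D = dl y x0" by blast
  have Dle: "D \<le> dl y x" if "x \<in> set X" for x using that by (simp add: D_def)
  have D: "4 * opt y < D * sz y" using y(1) x0 by (auto simp: cov_def not_le)
  let ?N = "sz y" and ?B = "Om y - Gd y"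
  have card: "?N \<le> 2 * card (Gd y)"
  proof (rule ccontr)
    assume "\<not> ?N \<le> 2 * card (Gd y)"
    moreover have "card ?B = ?N - card (Gd y)" using Gd_sub by (simp add: card_Diff_subset sz_def)
    ultimately have c: "?N < 2 * card ?B" by simp
    \<comment> \<open>The \<open>+ 1\<close> is the strictness of an inequality of natural numbers;
      it yields the contradiction even for \<open>opt y = 0\<close>.\<close>
    have "card ?B * (2 * opt y + 1) = (\<Sum>j\<in>?B. 2 * opt y + 1)" by simp
    also have "\<dots> \<le> (\<Sum>j\<in>?B. dl y j * ?N)" by (intro sum_mono) (auto simp: Gd_def)
    also have "\<dots> \<le> (\<Sum>j\<in>Om y. dl y j * ?N)" by (intro sum_mono2) auto
    also have "\<dots> = ?N * opt y" by (simp add: opt_def sum_distrib_left mult.commute)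
    also have "\<dots> \<le> (2 * card ?B) * opt y" using c by (intro mult_le_mono1) simp
    finally have "card ?B * (2 * opt y) + card ?B \<le> card ?B * (2 * opt y)" by (simp add: algebra_simps)
    then show False using c by linarith
  qed
  have good: "D \<le> 2 * rad X j" if j: "j \<in> Gd y" for j
  proof -
    obtain x where x: "x \<in> set X" "rad X j = ham j x" using rad_ex[OF X] by blast
    have "D \<le> rad X j + dl y j"
      using Dle[OF x(1)] ham_triangle(2)[of y x j] x(2) ham_commute[of x j] by simp
    then have "D * ?N \<le> (rad X j + dl y j) * ?N" by (rule mult_le_mono1)
    then have "D * ?N \<le> rad X j * ?N + 2 * opt y" using j by (simp add: Gd_def algebra_simps)
    then have "D * ?N \<le> (2 * rad X j) * ?N" using D by linarith
    then show ?thesis using y(2) by (metis mult_le_cancel2)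
  qed
  have "?N * D \<le> (2 * card (Gd y)) * D" using card by (rule mult_le_mono1)
  also have "\<dots> = 2 * (\<Sum>j\<in>Gd y. D)" by simp
  also have "\<dots> \<le> 2 * (\<Sum>j\<in>Gd y. 2 * rad X j)" using good by (intro mult_le_mono2 sum_mono)
  also have "\<dots> = 4 * (\<Sum>j\<in>Gd y. rad X j)" by (simp add: sum_distrib_left)
  finally have g: "?N * D \<le> 4 * (\<Sum>j\<in>Gd y. rad X j)" .
  have "(\<Sum>j\<in>Om y. rad X j) \<le> (\<Sum>j\<in>Om y. dl y j + D)"
    using rad_le[OF x0(1)] ham_triangle(1) x0(2) by (intro sum_mono) (metis order_trans)
  also have "\<dots> = opt y + ?N * D" by (simp add: sum.distrib opt_def sz_def)
  finally show ?thesis using g D by (simp add: mult.commute)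
qed

text \<open>Covered clusters carry at most \<open>5 * OPT\<close>, less than half of the total; so
  uncovered clusters carry more than half, and a fifth of this lies on columns that would cover a
  new cluster.\<close>

lemma Gd_mass:
  assumes "X \<noteq> []" "10 * OPT < RR X"
  shows "RR X \<le> 10 * (\<Sum>j\<in>(\<Union>y\<in>Unc X. Gd y). rad X j)"
proof -
  let ?f = "\<lambda>y. \<Sum>j\<in>Om y. rad X j"
  have fin: "finite (Cov X)" "finite (Unc X)" by (auto simp: Cov_def Unc_def)
  have "RR X = (\<Sum>y<K. ?f y)" by (simp add: RR_def sum_Om)
  also have "\<dots> = (\<Sum>y\<in>Cov X \<union> Unc X. ?f y)"
    by (intro sum.mono_neutral_right) (auto simp: Cov_def Unc_def sz_def card_gt_0_iff)
  also have "\<dots> = (\<Sum>y\<in>Cov X. ?f y) + (\<Sum>y\<in>Unc X. ?f y)"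
    using fin by (intro sum.union_disjoint) (auto simp: Cov_def Unc_def)
  finally have 1: "RR X = (\<Sum>y\<in>Cov X. ?f y) + (\<Sum>y\<in>Unc X. ?f y)" .
  have "(\<Sum>y\<in>Cov X. ?f y) \<le> (\<Sum>y\<in>Cov X. 5 * opt y)"
    by (intro sum_mono covered_mass) (auto simp: Cov_def)
  also have "\<dots> \<le> (\<Sum>y<K. 5 * opt y)" by (intro sum_mono2) (auto simp: Cov_def)
  finally have 2: "(\<Sum>y\<in>Cov X. ?f y) \<le> 5 * OPT" by (simp add: OPT_eq sum_distrib_left)
  have "(\<Sum>y\<in>Unc X. ?f y) \<le> (\<Sum>y\<in>Unc X. 5 * (\<Sum>j\<in>Gd y. rad X j))"
    by (intro sum_mono uncovered_mass assms) (auto simp: Unc_def)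
  also have "\<dots> = 5 * (\<Sum>j\<in>(\<Union>y\<in>Unc X. Gd y). rad X j)"
    using fin by (subst sum.UNION_disjoint) (auto simp: Gd_def Om_def sum_distrib_left)
  finally show ?thesis using 1 2 assms(2) by linarith
qed

lemma cent_snoc: "cent (zs @ [z]) = cent zs @ [sel d (rad (cent zs)) z]"
  by (simp add: cent_def)

lemma cent_Nil: "cent [] = [0]"
  by (simp add: cent_def)

lemma length_cent: "length (cent zs) = Suc (length zs)"
  by (induction zs rule: rev_induct) (auto simp: cent_snoc cent_Nil)

lemma cent_nonempty [simp]: "cent zs \<noteq> []"
  using length_cent[of zs] by auto

lemma cent_less: "x \<in> set (cent zs) \<Longrightarrow> x < d"
  by (induction zs rule: rev_induct) (auto simp: cent_snoc cent_Nil d_pos sel_less)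

text \<open>The share 1/10 of \<open>Gd_mass\<close> is halved by reducing a tape word modulo the
  total distance.\<close>

lemma cent_step:
  assumes "n * d \<le> B" "10 * OPT < RR (cent zs)"
  shows "1 / 20 \<le> measure_pmf.prob (pmf_of_set {..<B}) {z. card (Cov (cent zs)) < card (Cov (cent (zs @ [z])))}"
proof -
  let ?X = "cent zs"
  let ?J = "\<Union>y\<in>Unc ?X. Gd y"
  have J: "?J \<subseteq> {..<d}" by (auto simp: Gd_def Om_def)
  have m: "RR ?X \<le> 10 * (\<Sum>j\<in>?J. rad ?X j)" using Gd_mass assms(2) by simp
  have R: "0 < (\<Sum>j<d. rad ?X j)" "(\<Sum>j<d. rad ?X j) \<le> B" "(\<Sum>j<d. rad ?X j) = RR ?X"
    using assms RR_le[of ?X] by (auto simp flip: RR_def)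
  have "real (RR ?X) \<le> real (10 * (\<Sum>j\<in>?J. rad ?X j))" using m by (simp only: of_nat_le_iff)
  then have "1 / 20 \<le> real (\<Sum>j\<in>?J. rad ?X j) / (2 * real (\<Sum>j<d. rad ?X j))"
    using R(1) unfolding R(3) by (simp add: field_simps)
  also have "\<dots> \<le> measure_pmf.prob (pmf_of_set {..<B}) {z. sel d (rad ?X) z \<in> ?J}"
    by (rule prob_sel[OF J R(1,2)])
  also have "\<dots> \<le> measure_pmf.prob (pmf_of_set {..<B}) {z. card (Cov ?X) < card (Cov (cent (zs @ [z])))}"
  proof (intro measure_pmf.finite_measure_mono)
    show "{z. sel d (rad ?X) z \<in> ?J} \<subseteq> {z. card (Cov ?X) < card (Cov (cent (zs @ [z])))}"
    proof clarify
      fix z y assume y: "y \<in> Unc ?X" "sel d (rad ?X) z \<in> Gd y"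
      have "y \<in> Cov (cent (zs @ [z]))" "y \<notin> Cov ?X"
        using y by (auto simp: Unc_def Cov_def cov_def Gd_def cent_snoc)
      moreover have "Cov ?X \<subseteq> Cov (cent (zs @ [z]))" by (auto simp: Cov_def cov_def cent_snoc)
      ultimately show "card (Cov ?X) < card (Cov (cent (zs @ [z])))"
        by (intro psubset_card_mono) (auto simp: Cov_def)
    qed
  qed simp
  finally show ?thesis .
qed

text \<open>Progress is measured by the number of covered clusters: as long as the centers are too
  expensive, every successful draw covers one more, and cheap centers stay cheap when others are
  added.\<close>

lemma phase1_aux:
  assumes "n * d \<le> B" "0 < B"
  shows "(1 / 20) ^ s \<le> measure_pmf.prob (replicate_pmf s (pmf_of_set {..<B}))
    {zs. RR (cent zs) \<le> 10 * OPT \<or> s \<le> card (Cov (cent zs))}"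
proof (induction s)
  case (Suc s)
  let ?U = "pmf_of_set {..<B}"
  let ?E = "\<lambda>s. {zs. RR (cent zs) \<le> 10 * OPT \<or> s \<le> card (Cov (cent zs))}"
  have fin: "finite (set_pmf ?U)" using assms(2) by (simp add: lessThan_empty_iff)
  have "(1 / 20) ^ Suc s \<le> measure_pmf.prob (replicate_pmf s ?U) (?E s) * (1 / 20)"
    using Suc.IH by simp
  also have "\<dots> \<le> measure_pmf.prob (bind_pmf (replicate_pmf s ?U) (\<lambda>zs. map_pmf (\<lambda>z. zs @ [z]) ?U)) (?E (Suc s))"
  proof (intro prob_bind_ge finite_set_replicate_pmf fin)
    fix zs assume zs: "zs \<in> ?E s"
    show "1 / 20 \<le> measure_pmf.prob (map_pmf (\<lambda>z. zs @ [z]) ?U) (?E (Suc s))"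
    proof (cases "RR (cent zs) \<le> 10 * OPT")
      case True
      have "RR (cent (zs @ [z])) \<le> RR (cent zs)" for z by (simp add: cent_snoc RR_snoc)
      then have "(\<lambda>z. zs @ [z]) -` ?E (Suc s) = UNIV" using True order_trans by blast
      then show ?thesis by simp
    next
      case False
      then have "1 / 20 \<le> measure_pmf.prob ?U {z. card (Cov (cent zs)) < card (Cov (cent (zs @ [z])))}"
        using assms by (intro cent_step) auto
      also have "\<dots> \<le> measure_pmf.prob ?U ((\<lambda>z. zs @ [z]) -` ?E (Suc s))"
        using False zs by (intro measure_pmf.finite_measure_mono) auto
      finally show ?thesis by simp
    qed
  qed auto
  \<comment> \<open>\<open>replicate_pmf\<close> adds draws in front, while centers are appended at
    the end.\<close>
  also have "bind_pmf (replicate_pmf s ?U) (\<lambda>zs. map_pmf (\<lambda>z. zs @ [z]) ?U) = replicate_pmf (Suc s) ?U"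
    using replicate_pmf_distrib[of s 1 ?U]
    by (simp add: replicate_pmf_1 bind_map_pmf bind_return_pmf map_pmf_def bind_assoc_pmf)
  finally show ?case .
qed simp

lemma phase1:
  assumes "n * d \<le> B" "0 < B"
  shows "(1 / 20) ^ K \<le> measure_pmf.prob (replicate_pmf K (pmf_of_set {..<B})) {zs. RR (cent zs) \<le> 10 * OPT}"
proof -
  have "RR (cent zs) \<le> 10 * OPT" if K: "K \<le> card (Cov (cent zs))" for zs
  proof (rule ccontr)
    assume "\<not> RR (cent zs) \<le> 10 * OPT"
    then have lt: "10 * OPT < RR (cent zs)" by simp
    have "Cov (cent zs) = {..<K}" using K by (intro card_seteq) (auto simp: Cov_def)
    then have "Unc (cent zs) = {}" by (auto simp: Cov_def Unc_def)
    \<comment> \<open>Without uncovered clusters the sum in \<open>Gd_mass\<close> is empty, which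
      would force \<open>RR\<close> to be 0.\<close>
    then show False using Gd_mass[of "cent zs"] lt by simp
  qed
  then have "{zs. RR (cent zs) \<le> 10 * OPT \<or> K \<le> card (Cov (cent zs))} = {zs. RR (cent zs) \<le> 10 * OPT}"
    by blast
  then show ?thesis using phase1_aux[OF assms, of K] by simp
qed

end

section \<open>Expected regret of choosing row codes by sampled costs\<close>

lemma sum_div_blocks:
  fixes f :: "nat \<Rightarrow> real"
  assumes "0 < t"
  shows "(\<Sum>s<m * t. f (s div t)) = real t * (\<Sum>y<m. f y)"
proof -
  have "(\<Sum>s<m * t. f (s div t)) = (\<Sum>y<m. \<Sum>s\<in>{y * t..<y * t + t}. f (s div t))"
    by (rule sum.nat_group[symmetric])
  also have "\<dots> = (\<Sum>y<m. \<Sum>s\<in>{y * t..<y * t + t}. f y)"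
  proof (intro sum.cong refl)
    fix y s assume "s \<in> {y * t..<y * t + t}"
    then have "s div t = y" by (intro div_nat_eqI) (auto simp: algebra_simps)
    then show "f (s div t) = f y" by simp
  qed
  finally show ?thesis by (simp add: sum_distrib_left)
qed

lemma expectation_of_bool: "measure_pmf.expectation p (\<lambda>x. of_bool (P x)) = measure_pmf.prob p {x. P x}"
proof -
  have "(\<lambda>x. of_bool (P x) :: real) = indicator {x. P x}" by (auto simp: indicator_def)
  then show ?thesis by simp
qed

text \<open>Bounds the expected loss from preferring \<open>zx\<close> to the better pattern
  \<open>zs\<close>. The variance of the difference of the estimates is at most
  \<open>4 * t * (2 * c zs + \<Delta>) * c zs\<close>, where \<open>\<Delta>\<close> is the gap of
  the true costs; it is proportional to the better cost, so Chebyshev's inequality gives a loss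
  relative to that cost and not to the number of columns.\<close>

lemma row_loss:
  fixes w :: "nat \<Rightarrow> real" and a :: "'a \<Rightarrow> nat" and zx zs :: "nat \<Rightarrow> nat" and \<nu> :: "nat \<Rightarrow> 'a pmf"
    and m t :: nat
  defines "e \<equiv> \<lambda>z y. measure_pmf.prob (\<nu> y) {j. a j \<noteq> z y}"
  defines "c \<equiv> \<lambda>z. \<Sum>y<m. w y * e z y"
  defines "Est \<equiv> \<lambda>z S. \<Sum>s<m * t. w (s div t) * of_bool (a (S ! s) \<noteq> z (s div t))"
  assumes w: "\<And>y. 0 \<le> w y" and fin: "\<And>y. finite (set_pmf (\<nu> y))" and le: "c zs \<le> c zx"
    and \<delta>: "0 < \<delta>" "\<delta> \<le> 1" "12 \<le> \<delta>\<^sup>2 * real t"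
  shows "(c zx - c zs) * measure_pmf.prob (plist (map (\<lambda>s. \<nu> (s div t)) [0..<m * t])) {S. Est zx S \<le> Est zs S} \<le> \<delta> * c zs"
proof -
  define ps where "ps = map (\<lambda>s. \<nu> (s div t)) [0..<m * t]"
  define P where "P = measure_pmf.prob (plist ps) {S. Est zx S \<le> Est zs S}"
  define \<Delta> where "\<Delta> = c zx - c zs"
  have t: "0 < t" using \<delta> by (cases t) auto
  have len: "length ps = m * t" "\<And>s. s < m * t \<Longrightarrow> ps ! s = \<nu> (s div t)" by (auto simp: ps_def)
  have fps: "\<And>p. p \<in> set ps \<Longrightarrow> finite (set_pmf p)" using fin by (auto simp: ps_def)
  note finL = finite_set_plist[OF fps]
  note int = integrable_measure_pmf_finite[OF fin] integrable_measure_pmf_finite[OF finL]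
  define g :: "nat \<Rightarrow> 'a \<Rightarrow> real" where "g y j = of_bool (a j \<noteq> zx y) - of_bool (a j \<noteq> zs y)" for y j
  define \<mu> where "\<mu> y = e zx y - e zs y" for y
  have Eg: "measure_pmf.expectation (\<nu> y) (g y) = \<mu> y" for y
    unfolding g_def \<mu>_def e_def by (simp add: int expectation_of_bool)
  define h where "h s j = w (s div t) * (g (s div t) j - \<mu> (s div t))" for s j
  have e0: "0 \<le> e z y" for z y by (simp add: e_def)
  have c0: "0 \<le> c z" for z unfolding c_def by (intro sum_nonneg mult_nonneg_nonneg w e0)
  have mom: "measure_pmf.expectation (plist ps) (\<lambda>S. (\<Sum>s<m * t. h s (S ! s))\<^sup>2) =
      (\<Sum>s<m * t. measure_pmf.expectation (\<nu> (s div t)) (\<lambda>x. (h s x)\<^sup>2))"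
  proof -
    have "measure_pmf.expectation (ps ! s) (h s) = 0" if "s < length ps" for s
    proof -
      have "h s = (\<lambda>j. w (s div t) * (g (s div t) j - \<mu> (s div t)))" by (simp add: h_def fun_eq_iff)
      then show ?thesis using that len by (simp add: int Eg)
    qed
    from plist_moments[of ps h, OF fps this, THEN conjunct2] show ?thesis using len by simp
  qed
  have var: "measure_pmf.expectation (\<nu> y) (\<lambda>x. (w y * (g y x - \<mu> y))\<^sup>2) \<le> w y * (2 * c zs + \<Delta>) * (4 * e zs y)"
    if y: "y < m" for y
  proof (cases "zx y = zs y")
    case True
    then have "g y x - \<mu> y = 0" for x by (simp add: g_def \<mu>_def e_def)
    then show ?thesis using w e0 c0 le by (simp add: \<Delta>_def)
  next
    case False
    \<comment> \<open>The second moment about 1 bounds the variance. The point 1 is chosen because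
      \<open>g\<close> equals 1 at every sample that agrees with \<open>zs\<close>, the two patterns
      being different here; only disagreements with \<open>zs\<close> contribute, which produces the
      factor \<open>e zs y\<close>.\<close>
    have sq: "(\<lambda>x. (w y * (g y x - \<mu> y))\<^sup>2) =
      (\<lambda>x. (w y)\<^sup>2 * (g y x - 1)\<^sup>2 - ((w y)\<^sup>2 * (2 * (\<mu> y - 1)) * g y x + (w y)\<^sup>2 * (1 - (\<mu> y)\<^sup>2)))"
      by (auto simp: power2_eq_square algebra_simps)
    have "measure_pmf.expectation (\<nu> y) (\<lambda>x. (w y * (g y x - \<mu> y))\<^sup>2) =
      (w y)\<^sup>2 * measure_pmf.expectation (\<nu> y) (\<lambda>x. (g y x - 1)\<^sup>2) -
      ((w y)\<^sup>2 * (2 * (\<mu> y - 1)) * \<mu> y + (w y)\<^sup>2 * (1 - (\<mu> y)\<^sup>2))"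
      unfolding sq by (simp add: int Eg)
    also have "\<dots> = (w y)\<^sup>2 * measure_pmf.expectation (\<nu> y) (\<lambda>x. (g y x - 1)\<^sup>2) - (w y)\<^sup>2 * (\<mu> y - 1)\<^sup>2"
      by (simp add: power2_eq_square algebra_simps)
    also have "\<dots> \<le> (w y)\<^sup>2 * measure_pmf.expectation (\<nu> y) (\<lambda>x. (g y x - 1)\<^sup>2)" by simp
    finally have A: "measure_pmf.expectation (\<nu> y) (\<lambda>x. (w y * (g y x - \<mu> y))\<^sup>2) \<le>
      (w y)\<^sup>2 * measure_pmf.expectation (\<nu> y) (\<lambda>x. (g y x - 1)\<^sup>2)" .
    have "measure_pmf.expectation (\<nu> y) (\<lambda>x. (g y x - 1)\<^sup>2) \<le>
      measure_pmf.expectation (\<nu> y) (\<lambda>x. 4 * of_bool (a x \<noteq> zs y))"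
      using False by (intro integral_mono int) (auto simp: g_def)
    then have B: "(w y)\<^sup>2 * measure_pmf.expectation (\<nu> y) (\<lambda>x. (g y x - 1)\<^sup>2) \<le> (w y)\<^sup>2 * (4 * e zs y)"
      by (intro mult_left_mono) (auto simp: expectation_of_bool e_def)
    \<comment> \<open>A sample cannot agree with two different values, so the two error
      probabilities add up to at least 1, and the weight of a cluster in which the patterns differ
      is at most the sum of their costs.\<close>
    have C: "w y * 1 \<le> 2 * c zs + \<Delta>"
    proof -
      have "1 = measure_pmf.prob (\<nu> y) ({j. a j \<noteq> zx y} \<union> {j. a j \<noteq> zs y})"
      proof -
        have "{j. a j \<noteq> zx y} \<union> {j. a j \<noteq> zs y} = UNIV" using False by auto
        then show ?thesis by simp
      qed
      also have "\<dots> \<le> e zx y + e zs y" unfolding e_def by (intro measure_Un_le) auto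
      finally have "w y * 1 \<le> w y * (e zx y + e zs y)" using w by (intro mult_left_mono) auto
      also have "\<dots> = w y * e zx y + w y * e zs y" by (simp add: algebra_simps)
      also have "\<dots> \<le> c zx + c zs"
        unfolding c_def using y w e0 by (intro add_mono member_le_sum) auto
      finally show ?thesis by (simp add: \<Delta>_def)
    qed
    then have "w y * (w y * 1) * (4 * e zs y) \<le> w y * (2 * c zs + \<Delta>) * (4 * e zs y)"
      using w e0 by (intro mult_right_mono mult_left_mono) auto
    moreover have "(w y)\<^sup>2 * (4 * e zs y) = w y * (w y * 1) * (4 * e zs y)" by (simp add: power2_eq_square)
    ultimately show ?thesis using A B by linarith
  qed
  have "(\<Sum>s<m * t. measure_pmf.expectation (\<nu> (s div t)) (\<lambda>x. (h s x)\<^sup>2)) =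
      real t * (\<Sum>y<m. measure_pmf.expectation (\<nu> y) (\<lambda>x. (w y * (g y x - \<mu> y))\<^sup>2))"
    unfolding h_def using sum_div_blocks[OF t, of "\<lambda>y. measure_pmf.expectation (\<nu> y) (\<lambda>x. (w y * (g y x - \<mu> y))\<^sup>2)" m] .
  also have "\<dots> \<le> real t * (\<Sum>y<m. w y * (2 * c zs + \<Delta>) * (4 * e zs y))"
    using var by (intro mult_left_mono sum_mono) auto
  also have "\<dots> = 4 * real t * (2 * c zs + \<Delta>) * c zs"
  proof -
    have "(\<Sum>y<m. w y * (2 * c zs + \<Delta>) * (4 * e zs y)) = (\<Sum>y<m. (4 * (2 * c zs + \<Delta>)) * (w y * e zs y))"
      by (intro sum.cong) auto
    also have "\<dots> = (4 * (2 * c zs + \<Delta>)) * c zs" unfolding c_def by (rule sum_distrib_left[symmetric])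
    finally show ?thesis by simp
  qed
  finally have V: "measure_pmf.expectation (plist ps) (\<lambda>S. (\<Sum>s<m * t. h s (S ! s))\<^sup>2) \<le> 4 * real t * (2 * c zs + \<Delta>) * c zs"
    by (simp add: mom)
  have hsum: "(\<Sum>s<m * t. h s (S ! s)) = Est zx S - Est zs S - real t * \<Delta>" for S
  proof -
    have "(\<Sum>s<m * t. w (s div t) * \<mu> (s div t)) = real t * (\<Sum>y<m. w y * \<mu> y)"
      using sum_div_blocks[OF t, of "\<lambda>y. w y * \<mu> y" m] .
    also have "(\<Sum>y<m. w y * \<mu> y) = \<Delta>"
      by (simp add: \<mu>_def \<Delta>_def c_def right_diff_distrib sum_subtractf)
    finally show ?thesis
      by (simp add: h_def g_def Est_def right_diff_distrib sum_subtractf)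
  qed
  have \<Delta>0: "0 \<le> \<Delta>" using le by (simp add: \<Delta>_def)
  have "(real t * \<Delta>)\<^sup>2 * P = measure_pmf.expectation (plist ps) (\<lambda>S. (real t * \<Delta>)\<^sup>2 * of_bool (Est zx S \<le> Est zs S))"
    by (simp add: P_def expectation_of_bool)
  also have "\<dots> \<le> measure_pmf.expectation (plist ps) (\<lambda>S. (\<Sum>s<m * t. h s (S ! s))\<^sup>2)"
  proof (intro integral_mono int)
    fix S
    have "(real t * \<Delta>)\<^sup>2 \<le> (Est zx S - Est zs S - real t * \<Delta>)\<^sup>2" if "Est zx S \<le> Est zs S"
      using that \<Delta>0 by (intro abs_le_square_iff[THEN iffD1]) auto
    then show "(real t * \<Delta>)\<^sup>2 * of_bool (Est zx S \<le> Est zs S) \<le> (\<Sum>s<m * t. h s (S ! s))\<^sup>2"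
      unfolding hsum by auto
  qed
  also note V
  finally have cheb: "(real t * \<Delta>)\<^sup>2 * P \<le> 4 * real t * (2 * c zs + \<Delta>) * c zs" .
  have P: "0 \<le> P" "P \<le> 1" by (auto simp: P_def)
  have "\<Delta> * P \<le> \<delta> * c zs"
  \<comment> \<open>A small gap needs no estimate. A large one satisfies
    \<open>\<delta> * (2 * c zs + \<Delta>) \<le> 3 * \<Delta>\<close>, which cancels one factor
    \<open>\<Delta>\<close>; the remaining constant \<open>4 * 3\<close> is the 12 required of
    \<open>\<delta>\<^sup>2 * t\<close>.\<close>
  proof (cases "\<Delta> \<le> \<delta> * c zs")
    case True
    have "\<Delta> * P \<le> \<Delta> * 1" using P \<Delta>0 by (intro mult_left_mono) auto
    then show ?thesis using True by simp
  next
    case False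
    then have pos: "0 < \<Delta>" using c0[of zs] \<delta>(1) by (smt (verit) mult_nonneg_nonneg)
    have "\<delta> * (2 * c zs + \<Delta>) \<le> 3 * \<Delta>"
      using False mult_right_mono[OF \<delta>(2) \<Delta>0] by (simp add: algebra_simps)
    have "(real t * \<Delta>) * (\<delta> * (real t * (\<Delta> * P))) = \<delta> * ((real t * \<Delta>)\<^sup>2 * P)"
      by (simp add: power2_eq_square mult_ac)
    also have "\<dots> \<le> \<delta> * (4 * real t * (2 * c zs + \<Delta>) * c zs)"
      using cheb \<delta> by (intro mult_left_mono) auto
    also have "\<dots> = 4 * real t * c zs * (\<delta> * (2 * c zs + \<Delta>))" by (simp add: mult_ac)
    also have "\<dots> \<le> 4 * real t * c zs * (3 * \<Delta>)"
      using \<open>\<delta> * (2 * c zs + \<Delta>) \<le> 3 * \<Delta>\<close> c0 by (intro mult_left_mono) auto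
    also have "\<dots> = (real t * \<Delta>) * (12 * c zs)" by simp
    finally have "\<delta> * (real t * (\<Delta> * P)) \<le> 12 * c zs"
      using pos t by (simp add: mult_le_cancel_left)
    also have "\<dots> \<le> (\<delta>\<^sup>2 * real t) * c zs" using \<delta>(3) c0 by (intro mult_right_mono) auto
    finally have "(\<delta> * real t) * (\<Delta> * P) \<le> (\<delta> * real t) * (\<delta> * c zs)"
      by (simp add: power2_eq_square mult_ac)
    then show ?thesis using \<delta>(1) t by (simp add: mult_le_cancel_left)
  qed
  then show ?thesis by (simp add: \<Delta>_def P_def ps_def)
qed

lemma sample_loss:
  fixes w :: "nat \<Rightarrow> real" and a :: "nat \<Rightarrow> 'a \<Rightarrow> nat" and Z :: "nat \<Rightarrow> nat \<Rightarrow> nat" and \<nu> :: "nat \<Rightarrow> 'a pmf"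
    and m n t :: nat
  defines "c \<equiv> \<lambda>i x. \<Sum>y<m. w y * measure_pmf.prob (\<nu> y) {j. a i j \<noteq> Z x y}"
  defines "Est \<equiv> \<lambda>i x S. \<Sum>s<m * t. w (s div t) * of_bool (a i (S ! s) \<noteq> Z x (s div t))"
  assumes w: "\<And>y. 0 \<le> w y" and fin: "\<And>y. finite (set_pmf (\<nu> y))"
    and \<delta>: "0 < \<delta>" "\<delta> \<le> 1" "12 \<le> \<delta>\<^sup>2 * real t" and us: "\<And>i. i < n \<Longrightarrow> us i < m"
  shows "1 / 2 \<le> measure_pmf.prob (plist (map (\<lambda>s. \<nu> (s div t)) [0..<m * t]))
    {S. \<forall>u. (\<forall>i<n. u i < m \<and> (\<forall>x<m. Est i (u i) S \<le> Est i x S)) \<longrightarrow>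
      (\<Sum>i<n. c i (u i)) \<le> (1 + 2 * (real m * \<delta>)) * (\<Sum>i<n. c i (us i))}"
proof -
  define ps where "ps = plist (map (\<lambda>s. \<nu> (s div t)) [0..<m * t])"
  have fps: "finite (set_pmf ps)" unfolding ps_def using fin by (intro finite_set_plist) auto
  note int = integrable_measure_pmf_finite[OF fps]
  have "\<exists>x<m. \<forall>x'<m. c i x \<le> c i x'" if "i < n" for i
  proof -
    have "finite (c i ` {..<m})" "c i ` {..<m} \<noteq> {}" using us[OF that] by auto
    then obtain x where x: "x < m" "c i x = Min (c i ` {..<m})" by (metis (no_types, lifting) Min_in imageE lessThan_iff)
    then have "c i x \<le> c i x'" if "x' < m" for x' using that by simp
    then show ?thesis using x by blast
  qed
  then obtain xs where xs: "\<And>i. i < n \<Longrightarrow> xs i < m" "\<And>i x. i < n \<Longrightarrow> x < m \<Longrightarrow> c i (xs i) \<le> c i x" by metis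
  have c0: "0 \<le> c i x" for i x unfolding c_def by (intro sum_nonneg mult_nonneg_nonneg w) auto
  \<comment> \<open>Charges a row for all codes that look at least as good as the best one; the code
    actually chosen is among them.\<close>
  define F where "F S = (\<Sum>i<n. \<Sum>x<m. (c i x - c i (xs i)) * of_bool (Est i x S \<le> Est i (xs i) S))" for S
  have F0: "0 \<le> F S" for S unfolding F_def using xs by (intro sum_nonneg mult_nonneg_nonneg) auto
  have "measure_pmf.expectation ps F = (\<Sum>i<n. \<Sum>x<m. (c i x - c i (xs i)) * measure_pmf.prob ps {S. Est i x S \<le> Est i (xs i) S})"
    unfolding F_def by (simp add: int expectation_of_bool del: sum_mult_of_bool_eq)
  also have "\<dots> \<le> (\<Sum>i<n. \<Sum>x<m. \<delta> * c i (xs i))"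
  proof (intro sum_mono)
    fix i x assume "i \<in> {..<n}" "x \<in> {..<m}"
    then show "(c i x - c i (xs i)) * measure_pmf.prob ps {S. Est i x S \<le> Est i (xs i) S} \<le> \<delta> * c i (xs i)"
      using row_loss[where a = "a i" and zs = "Z (xs i)" and zx = "Z x" and m = m and w = w and \<nu> = \<nu>, OF w fin _ \<delta>] xs unfolding c_def Est_def ps_def by auto
  qed
  also have "\<dots> = real m * \<delta> * (\<Sum>i<n. c i (xs i))" by (simp add: sum_distrib_left mult_ac)
  finally have "measure_pmf.expectation ps F \<le> real m * \<delta> * (\<Sum>i<n. c i (xs i))" .
  from prob_le_half[OF fps F0 this]
  have "1 / 2 \<le> measure_pmf.prob ps {S. F S \<le> 2 * (real m * \<delta> * (\<Sum>i<n. c i (xs i)))}" .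
  also have "\<dots> \<le> measure_pmf.prob ps {S. \<forall>u. (\<forall>i<n. u i < m \<and> (\<forall>x<m. Est i (u i) S \<le> Est i x S)) \<longrightarrow>
      (\<Sum>i<n. c i (u i)) \<le> (1 + 2 * (real m * \<delta>)) * (\<Sum>i<n. c i (us i))}"
  proof (intro measure_pmf.finite_measure_mono, clarify)
    fix S u assume F: "F S \<le> 2 * (real m * \<delta> * (\<Sum>i<n. c i (xs i)))"
      and u: "\<forall>i<n. u i < m \<and> (\<forall>x<m. Est i (u i) S \<le> Est i x S)"
    have "(\<Sum>i<n. c i (u i) - c i (xs i)) \<le> F S" unfolding F_def
    proof (intro sum_mono)
      fix i assume i: "i \<in> {..<n}"
      have "(c i (u i) - c i (xs i)) * of_bool (Est i (u i) S \<le> Est i (xs i) S) \<le>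
        (\<Sum>x<m. (c i x - c i (xs i)) * of_bool (Est i x S \<le> Est i (xs i) S))"
        using i u xs by (intro member_le_sum[where f = "\<lambda>x. (c i x - c i (xs i)) * of_bool (Est i x S \<le> Est i (xs i) S)"]) auto
      then show "c i (u i) - c i (xs i) \<le> (\<Sum>x<m. (c i x - c i (xs i)) * of_bool (Est i x S \<le> Est i (xs i) S))"
        using i u xs by auto
    qed
    then have "(\<Sum>i<n. c i (u i)) \<le> (\<Sum>i<n. c i (xs i)) + 2 * (real m * \<delta> * (\<Sum>i<n. c i (xs i)))"
      using F by (simp add: sum_subtractf)
    also have "\<dots> = (1 + 2 * (real m * \<delta>)) * (\<Sum>i<n. c i (xs i))" by (simp add: algebra_simps)
    also have "\<dots> \<le> (1 + 2 * (real m * \<delta>)) * (\<Sum>i<n. c i (us i))"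
      using xs us \<delta> by (intro mult_left_mono sum_mono) auto
    finally show "(\<Sum>i<n. c i (u i)) \<le> (1 + 2 * (real m * \<delta>)) * (\<Sum>i<n. c i (us i))" .
  qed simp
  finally show ?thesis by (simp add: ps_def)
qed

section \<open>Guessing cluster sizes and sampling columns\<close>

lemma pmf_map_ge:
  assumes "\<And>z. z \<in> G \<Longrightarrow> f z = x"
  shows "measure_pmf.prob p G \<le> pmf (map_pmf f p) x"
  unfolding pmf_map using assms by (intro measure_pmf.finite_measure_mono) auto

text \<open>A floating point encoding: the residue modulo \<open>b\<close> chooses a bit length, the
  quotient a number of that length. All orders of magnitude are thus equally likely, and guessing a
  size up to a constant factor costs a factor \<open>b\<close> only.\<close>

definition wt :: "nat \<Rightarrow> nat \<Rightarrow> nat" where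
  "wt b z = (z div b) mod 2 ^ (z mod b)"

text \<open>Take the bit length \<open>e\<close> with \<open>2 * N < 2 ^ e \<le> 4 * N\<close>. It
  is chosen with probability \<open>1 / b\<close>, and at least \<open>N / (8 * q)\<close> of the at
  most \<open>4 * N\<close> numbers of this length are acceptable, since the acceptable interval
  ends below \<open>2 * N\<close>; reducing a word halves the result. For \<open>N = 0\<close> the
  bit length 0 always gives the weight 0.\<close>

lemma prob_weight:
  assumes N: "4 * N \<le> 2 ^ (b - 1)" and b: "0 < b" and B: "b * 2 ^ (b - 1) \<le> B" and q: "0 < q"
  shows "1 / (64 * real q * real b) \<le>
    measure_pmf.prob (pmf_of_set {..<B}) {z. N \<le> wt b z \<and> 8 * q * wt b z \<le> (8 * q + 1) * N}"
proof (cases "N = 0")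
  case True
  have "b * 1 \<le> b * 2 ^ (b - 1)" by (intro mult_le_mono2) simp
  then have "b \<le> B" using B by linarith
  have "1 / (64 * real q * real b) \<le> real (card {0::nat}) / (2 * real b)"
    using b q by (simp add: field_simps)
  also have "\<dots> \<le> measure_pmf.prob (pmf_of_set {..<B}) {z. z mod b \<in> {0}}"
    using b \<open>b \<le> B\<close> by (intro prob_residues) auto
  also have "\<dots> \<le> measure_pmf.prob (pmf_of_set {..<B}) {z. N \<le> wt b z \<and> 8 * q * wt b z \<le> (8 * q + 1) * N}"
    using True by (intro measure_pmf.finite_measure_mono) (auto simp: wt_def)
  finally show ?thesis .
next
  case False
  obtain l where l: "2 ^ l \<le> 2 * N" "2 * N < 2 ^ (l + 1)"
    using ex_power_ivl1[of 2 "2 * N"] False by auto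
  define e where "e = l + 1"
  have e: "2 * N < 2 ^ e" "2 ^ e \<le> 4 * N" using l by (auto simp: e_def)
  have "(2::nat) ^ e \<le> 2 ^ (b - 1)" using e(2) N by linarith
  then have eb: "e \<le> b - 1" by (rule power_le_imp_le_exp[rotated]) simp
  let ?E = "(\<lambda>c. b * c + e) ` {N..N + N div (8 * q)}"
  have inj: "inj_on (\<lambda>c. b * c + e) {N..N + N div (8 * q)}" using b by (auto simp: inj_on_def)
  have card: "real N / (8 * real q) \<le> real (card ?E)"
  proof -
    have "N < 8 * q * (N div (8 * q) + 1)"
      using dividend_less_times_div[of "8 * q" N] q by (simp add: algebra_simps)
    then have "real N \<le> real (8 * q * (N div (8 * q) + 1))" by (simp only: of_nat_le_iff)
    then show ?thesis using q inj by (simp add: card_image field_simps)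
  qed
  have c: "N + N div (8 * q) < 2 ^ e" using e(1) div_le_dividend[of N "8 * q"] by linarith
  have E: "?E \<subseteq> {..<b * 2 ^ e}"
  proof (rule image_subsetI)
    fix c' assume "c' \<in> {N..N + N div (8 * q)}"
    then have "b * (c' + 1) \<le> b * 2 ^ e" using c by (intro mult_le_mono2) simp
    then show "b * c' + e \<in> {..<b * 2 ^ e}" using eb b by simp
  qed
  have B': "b * 2 ^ e \<le> B" using B eb by (meson le_trans mult_le_mono2 one_le_numeral power_increasing)
  have "1 / (64 * real q * real b) = (real N / (8 * real q)) / (2 * real (b * (4 * N)))"
    using False q b by (simp add: field_simps)
  also have "\<dots> \<le> real (card ?E) / (2 * real (b * 2 ^ e))"
  proof (intro frac_le card)
    have "b * 2 ^ e \<le> b * (4 * N)" using e(2) by (intro mult_le_mono2)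
    then show "2 * real (b * 2 ^ e) \<le> 2 * real (b * (4 * N))" by (simp only: of_nat_le_iff mult_le_cancel_left_pos zero_less_numeral)
    show "0 < 2 * real (b * 2 ^ e)" using b by simp
  qed auto
  also have "\<dots> \<le> measure_pmf.prob (pmf_of_set {..<B}) {z. z mod (b * 2 ^ e) \<in> ?E}"
    using b B' E by (intro prob_residues) auto
  also have "\<dots> \<le> measure_pmf.prob (pmf_of_set {..<B}) {z. N \<le> wt b z \<and> 8 * q * wt b z \<le> (8 * q + 1) * N}"
  proof (intro measure_pmf.finite_measure_mono, clarify)
    fix z c' assume z: "z mod (b * 2 ^ e) = b * c' + e" and c': "c' \<in> {N..N + N div (8 * q)}"
    have "z mod b = (z mod (b * 2 ^ e)) mod b" by (simp add: mod_mod_cancel)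
    then have zb: "z mod b = e" using z eb b by simp
    have "b * (z div b mod 2 ^ e) + z mod b = b * c' + e" using z mod_mult2_eq[of z b "2 ^ e"] by simp
    then have w: "wt b z = c'" using zb b by (simp add: wt_def)
    have "8 * q * c' \<le> 8 * q * N + 8 * q * (N div (8 * q))"
      using c' by (simp flip: distrib_left)
    also have "8 * q * (N div (8 * q)) \<le> N" by (rule times_div_less_eq_dividend)
    finally show "N \<le> wt b z \<and> 8 * q * wt b z \<le> (8 * q + 1) * N" using c' w by (simp add: algebra_simps)
  qed simp
  finally show ?thesis .
qed

context clustering
begin

text \<open>A single word makes both choices: its residue modulo \<open>K + 2\<close> picks one of
  the \<open>K + 1\<close> centers or asks for a fresh column, which the quotient then selects by
  distance.\<close>

definition slot :: "nat list \<Rightarrow> nat \<Rightarrow> nat" where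
  "slot X z = (if z mod (K + 2) < K + 1 then X ! (z mod (K + 2)) else sel d (rad X) (z div (K + 2)))"

definition score :: "nat \<Rightarrow> nat list \<Rightarrow> nat list \<Rightarrow> nat \<Rightarrow> nat \<Rightarrow> nat" where
  "score t W S i x = (\<Sum>s<K * t. W ! (s div t) * of_bool (A i (S ! s) \<noteq> Z x (s div t)))"

definition cst :: "(nat \<Rightarrow> nat) \<Rightarrow> (nat \<Rightarrow> nat) \<Rightarrow> nat" where
  "cst u v = (\<Sum>j<d. \<Sum>i<n. of_bool (A i j \<noteq> Z (u i) (v j)))"

definition ctr :: "nat list \<Rightarrow> nat \<Rightarrow> nat" where
  "ctr X j = (SOME x. x \<in> set X \<and> rad X j = ham j x)"

text \<open>The threshold makes the moves within one cluster cost at most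
  \<open>RR X / (80 * K * q)\<close> in total, so all moves together cost at most
  \<open>OPT / (8 * q)\<close> once \<open>RR X \<le> 10 * OPT\<close>. A column that stays has a
  share of the total distance comparable to \<open>1 / sz\<close>.\<close>

definition \<phi> :: "nat \<Rightarrow> nat list \<Rightarrow> nat \<Rightarrow> nat" where
  "\<phi> q X j = (if rad X j * sz (vs j) * (80 * K * q) \<le> RR X then ctr X j else j)"

definition \<nu> :: "nat \<Rightarrow> nat list \<Rightarrow> nat \<Rightarrow> nat pmf" where
  "\<nu> q X y = (if sz y = 0 then return_pmf (X ! 0) else map_pmf (\<phi> q X) (pmf_of_set (Om y)))"

lemma OPT_cst: "OPT = cst us vs"
  by (simp add: OPT_def dl_def cst_def)

lemma ctr: "X \<noteq> [] \<Longrightarrow> ctr X j \<in> set X \<and> rad X j = ham j (ctr X j)"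
proof -
  assume "X \<noteq> []"
  then have "\<exists>x. x \<in> set X \<and> rad X j = ham j x" using rad_ex by blast
  then show ?thesis unfolding ctr_def by (rule someI_ex)
qed

lemma near_cost:
  assumes "X \<noteq> []" "RR X \<le> 10 * OPT"
  shows "8 * q * (\<Sum>j<d. ham j (\<phi> q X j)) \<le> OPT"
proof (cases "q = 0")
  case False
  have "sz y * (80 * K * q * (\<Sum>j\<in>Om y. ham j (\<phi> q X j))) \<le> sz y * RR X" for y
  proof -
    have "sz y * (80 * K * q * (\<Sum>j\<in>Om y. ham j (\<phi> q X j))) = (\<Sum>j\<in>Om y. ham j (\<phi> q X j) * sz y * (80 * K * q))"
      by (simp add: sum_distrib_left mult_ac)
    also have "\<dots> \<le> (\<Sum>j\<in>Om y. RR X)"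
    proof (intro sum_mono)
      fix j assume "j \<in> Om y"
      then have "vs j = y" by (simp add: Om_def)
      then show "ham j (\<phi> q X j) * sz y * (80 * K * q) \<le> RR X"
        using ctr[OF assms(1), of j] by (auto simp: \<phi>_def ham_def[of j j])
    qed
    finally show ?thesis by (simp add: sz_def)
  qed
  then have y: "80 * K * q * (\<Sum>j\<in>Om y. ham j (\<phi> q X j)) \<le> RR X" for y
  proof (cases "sz y = 0")
    case True
    then show ?thesis by (simp add: sz_def)
  next
    case False
    then show ?thesis using \<open>\<And>y. sz y * _ \<le> sz y * RR X\<close>[of y] by simp
  qed
  have "80 * K * q * (\<Sum>j<d. ham j (\<phi> q X j)) = (\<Sum>y<K. 80 * K * q * (\<Sum>j\<in>Om y. ham j (\<phi> q X j)))"
    by (simp add: sum_Om sum_distrib_left)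
  also have "\<dots> \<le> (\<Sum>y<K. RR X)" using y by (intro sum_mono)
  also have "\<dots> \<le> K * (10 * OPT)" using assms(2) by simp
  finally have "(10 * K) * (8 * q * (\<Sum>j<d. ham j (\<phi> q X j))) \<le> (10 * K) * OPT" by (simp add: mult_ac)
  then show ?thesis using K_ge2 by simp
qed simp

text \<open>A center has probability at least \<open>1 / (2 * (K + 2))\<close>. Any other
  \<open>x\<close> in the support was not moved: its ideal probability is at most
  \<open>1 / sz y\<close>, while its share of the distance exceeds
  \<open>1 / (80 * K * q * sz y)\<close>. The factor \<open>2 * (K + 2)\<close> accounts for asking
  for a fresh column and for the reduction of the word.\<close>

lemma slot_dominates:
  assumes X: "length X = K + 1" and B: "(K + 2) * (n * d) \<le> B" "K + 2 \<le> B" and q: "0 < q"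
  shows "1 / (160 * real K * real q * real (K + 2)) * pmf (\<nu> q X y) x \<le> pmf (map_pmf (slot X) (pmf_of_set {..<B})) x"
proof -
  let ?\<alpha> = "1 / (160 * real K * real q * real (K + 2))"
  let ?U = "pmf_of_set {..<B}"
  have Xne: "X \<noteq> []" using X by auto
  consider "x \<in> set X" | "x \<notin> set X" "pmf (\<nu> q X y) x = 0" | "x \<notin> set X" "pmf (\<nu> q X y) x \<noteq> 0" by blast
  then show ?thesis
  proof cases
    case 1
    then obtain l where l: "l < K + 1" "X ! l = x" using X by (metis in_set_conv_nth)
    have "?\<alpha> * pmf (\<nu> q X y) x \<le> ?\<alpha> * 1" by (intro mult_left_mono pmf_le_1) auto
    also have "\<dots> \<le> real (card {l}) / (2 * real (K + 2))"
    proof -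
      have "1 * 1 \<le> K * q" using K_ge2 q by (intro mult_le_mono) auto
      then have Kq: "1 \<le> real K * real q" by (metis of_nat_1 of_nat_le_iff of_nat_mult mult_1)
      have "2 * real (K + 2) * 1 \<le> 2 * real (K + 2) * (80 * (real K * real q))"
        using Kq by (intro mult_left_mono) auto
      then have "1 / (160 * real K * real q * real (K + 2)) \<le> 1 / (2 * real (K + 2))"
        using K_ge2 q by (intro divide_left_mono) (auto simp: mult_ac)
      then show ?thesis by simp
    qed
    also have "\<dots> \<le> measure_pmf.prob ?U {z. z mod (K + 2) \<in> {l}}"
      using B l by (intro prob_residues) auto
    also have "\<dots> \<le> pmf (map_pmf (slot X) ?U) x"
      using l by (intro pmf_map_ge) (auto simp: slot_def)
    finally show ?thesis .
  next
    case 2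
    then show ?thesis by simp
  next
    case 3
    have sz: "sz y \<noteq> 0"
    proof
      assume "sz y = 0"
      then have "pmf (\<nu> q X y) x = 0" using 3(1) X by (auto simp: \<nu>_def indicator_def)
      then show False using 3 by simp
    qed
    then have Om: "Om y \<noteq> {}" by (auto simp: sz_def)
    \<comment> \<open>Moved columns land on centers, so only \<open>x\<close> itself can be sent to
      the non-center \<open>x\<close>.\<close>
    have *: "j = x" if "j \<in> Om y" "\<phi> q X j = x" for j
      using that 3(1) ctr[OF Xne, of j] by (auto simp: \<phi>_def split: if_splits)
    have "pmf (\<nu> q X y) x = real (card (Om y \<inter> \<phi> q X -` {x})) / real (sz y)"
      using sz Om by (simp add: \<nu>_def pmf_map measure_pmf_of_set sz_def)
    moreover have "Om y \<inter> \<phi> q X -` {x} \<subseteq> {x}" using * by auto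
    then have "card (Om y \<inter> \<phi> q X -` {x}) \<le> 1" using card_mono[of "{x}"] by fastforce
    ultimately have le: "pmf (\<nu> q X y) x \<le> 1 / real (sz y)" by (simp add: divide_right_mono)
    have "Om y \<inter> \<phi> q X -` {x} \<noteq> {}"
      using 3(2) \<open>pmf (\<nu> q X y) x = _\<close> by (auto simp del: vimage_singleton_eq)
    then obtain j where j: "j \<in> Om y" "\<phi> q X j = x" by auto
    then have x: "x \<in> Om y" "\<phi> q X x = x" using *[OF j] by auto
    have xd: "x < d" "vs x = y" using x by (auto simp: Om_def)
    have far: "RR X < rad X x * sz y * (80 * K * q)"
      using x(2) 3(1) ctr[OF Xne, of x] xd by (auto simp: \<phi>_def not_le split: if_splits)
    have radR: "rad X x \<le> RR X" unfolding RR_def using xd by (intro member_le_sum) auto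
    have R: "0 < RR X" using far radR by (cases "RR X") auto
    define m where "m = K + 2"
    have m: "0 < m" "K + 1 < m" by (auto simp: m_def)
    \<comment> \<open>One residue modulo \<open>m * RR X\<close> determines both the residue modulo
      \<open>m\<close> and the quotient modulo \<open>RR X\<close>, that is, both choices of
      \<open>slot\<close>.\<close>
    let ?M = "m * RR X"
    have "m * RR X \<le> m * (n * d)" using RR_le[OF Xne] by (rule mult_le_mono2)
    then have M: "0 < ?M" "?M \<le> B" using R B m by (auto simp: m_def)
    let ?C = "{c. c < RR X \<and> sel d (rad X) c \<in> {x}}"
    let ?E = "(\<lambda>e. m * e + (K + 1)) ` ?C"
    have inj: "inj_on (\<lambda>e. m * e + (K + 1)) ?C" using m by (auto simp: inj_on_def)
    have "rad X x \<le> card ?C" using card_sel[of "{x}" d "rad X"] xd by (simp add: RR_def)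
    then have card: "rad X x \<le> card ?E" using inj by (simp add: card_image)
    have E: "?E \<subseteq> {..<?M}"
    proof
      fix e assume "e \<in> ?E"
      then obtain c where c: "c < RR X" "e = m * c + (K + 1)" by blast
      then have "m * (c + 1) \<le> m * RR X" by (intro mult_le_mono2) simp
      then show "e \<in> {..<?M}" using m c(2) by simp
    qed
    have szR: "0 < real (sz y)" "0 < real (RR X)" using sz R by auto
    have "?\<alpha> * pmf (\<nu> q X y) x \<le> ?\<alpha> * (1 / real (sz y))" using le by (intro mult_left_mono) auto
    also have "\<dots> \<le> real (rad X x) / (2 * real ?M)"
    proof -
      have "real (RR X) \<le> real (rad X x * sz y * (80 * K * q))" using far by (simp only: of_nat_le_iff)
      then have "real (RR X) \<le> real (rad X x) * (real (sz y) * (80 * real K * real q))" by (simp add: mult_ac)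
      then have "real (RR X) / (real (sz y) * (80 * real K * real q)) \<le> real (rad X x)"
        using szR K_ge2 q by (simp add: pos_divide_le_eq)
      then have "real (RR X) / (real (sz y) * (80 * real K * real q)) / (2 * real ?M) \<le> real (rad X x) / (2 * real ?M)"
        by (intro divide_right_mono) auto
      moreover have "real (RR X) / (real (sz y) * (80 * real K * real q)) / (2 * real ?M) = ?\<alpha> * (1 / real (sz y))"
      proof -
        have "r / (s * (80 * k' * q')) / (2 * (m' * r)) = 1 / (160 * k' * q' * m') * (1 / s)"
          if "0 < r" "0 < s" "0 < k'" "0 < q'" "0 < m'" for r s k' q' m' :: real
          using that by (simp add: field_simps)
        then have "real (RR X) / (real (sz y) * (80 * real K * real q)) / (2 * (real m * real (RR X))) =
            1 / (160 * real K * real q * real m) * (1 / real (sz y))"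
          by this (use szR K_ge2 q m in auto)
        then show ?thesis by (simp only: of_nat_mult m_def)
      qed
      ultimately show ?thesis by simp
    qed
    also have "\<dots> \<le> real (card ?E) / (2 * real ?M)" using card by (intro divide_right_mono) auto
    also have "\<dots> \<le> measure_pmf.prob ?U {z. z mod ?M \<in> ?E}" using M E by (intro prob_residues)
    also have "\<dots> \<le> pmf (map_pmf (slot X) ?U) x"
    proof (intro pmf_map_ge)
      fix z assume "z \<in> {z. z mod ?M \<in> ?E}"
      then obtain c where z: "z mod ?M = m * c + (K + 1)" and c: "c < RR X" "sel d (rad X) c = x" by blast
      have "z mod m = (z mod ?M) mod m" by (simp add: mod_mod_cancel)
      also have "\<dots> = K + 1" unfolding z using m by simp
      finally have zm: "z mod m = K + 1" .
      have "m * (z div m mod RR X) + z mod m = m * c + (K + 1)"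
        using z mod_mult2_eq[of z m "RR X"] by simp
      then have "z div m mod RR X = c" using zm m by simp
      then have "sel d (rad X) (z div m) = x"
        using sel_mod[of d "rad X" "z div m"] c(2) by (simp add: RR_def)
      then show "slot X z = x" using zm unfolding slot_def m_def by simp
    qed
    finally show ?thesis .
  qed
qed

lemma finite_set_\<nu>: "finite (set_pmf (\<nu> q X y))"
  by (cases "sz y = 0") (auto simp: \<nu>_def sz_def card_eq_0_iff)

text \<open>Multiplied by the size, so that empty clusters need no exception: the weighted error
  under \<open>\<nu>\<close> is a count over the cluster.\<close>

lemma prob_\<nu>:
  "real (sz y) * measure_pmf.prob (\<nu> q X y) {j. P j} = (\<Sum>j\<in>Om y. of_bool (P (\<phi> q X j)))"
proof (cases "sz y = 0")
  case False
  then have "Om y \<noteq> {}" by (auto simp: sz_def)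
  then have "measure_pmf.prob (\<nu> q X y) {j. P j} = real (card (Om y \<inter> {j. P (\<phi> q X j)})) / real (sz y)"
    using False by (simp add: \<nu>_def measure_pmf_of_set sz_def vimage_def)
  moreover have "(\<Sum>j\<in>Om y. of_bool (P (\<phi> q X j)) :: real) = real (card (Om y \<inter> {j. P (\<phi> q X j)}))"
    by (simp add: sum.If_cases of_bool_def Int_def)
  ultimately show ?thesis using False by simp
qed (auto simp: sz_def)

definition good_sample :: "nat \<Rightarrow> nat \<Rightarrow> nat list \<Rightarrow> nat list \<Rightarrow> bool" where
  "good_sample q t W S \<longleftrightarrow> (\<forall>u. (\<forall>i<n. u i < K \<and> (\<forall>x<K. score t W S i (u i) \<le> score t W S i x)) \<longrightarrow>
     q * cst u vs \<le> (q + 1) * OPT)"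

lemma good_sample_prob:
  assumes X: "X \<noteq> []" "RR X \<le> 10 * OPT" and q: "0 < q"
    and W: "\<And>y. y < K \<Longrightarrow> sz y \<le> W ! y \<and> 8 * q * W ! y \<le> (8 * q + 1) * sz y"
    and t: "3072 * q\<^sup>2 * K\<^sup>2 \<le> t"
  shows "1 / 2 \<le> measure_pmf.prob (plist (map (\<lambda>s. \<nu> q X (s div t)) [0..<K * t])) {S. good_sample q t W S}"
proof -
  \<comment> \<open>Makes the factor \<open>1 + 2 * (K * \<delta>)\<close> of
    \<open>sample_loss\<close> equal to \<open>1 + 1 / (8 * q)\<close>; the condition
    \<open>12 \<le> \<delta>\<^sup>2 * t\<close> then explains
    \<open>3072 = 12 * 16\<^sup>2\<close>.\<close>
  define \<delta> where "\<delta> = 1 / (16 * real q * real K)"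
  define c where "c i x = (\<Sum>y<K. real (W ! y) * measure_pmf.prob (\<nu> q X y) {j. A i j \<noteq> Z x y})" for i x
  have qK: "1 \<le> real q * real K"
  proof -
    have "1 * 1 \<le> q * K" using q K_ge2 by (intro mult_le_mono) auto
    then show ?thesis by (metis of_nat_1 of_nat_le_iff of_nat_mult mult_1)
  qed
  have "0 < \<delta>" using q K_ge2 by (simp add: \<delta>_def)
  moreover have "\<delta> \<le> 1" using qK by (simp add: \<delta>_def field_simps)
  moreover have "12 \<le> \<delta>\<^sup>2 * real t"
  proof -
    have "real (3072 * q\<^sup>2 * K\<^sup>2) \<le> real t" using t by (simp only: of_nat_le_iff)
    then have "\<delta>\<^sup>2 * (3072 * (real q)\<^sup>2 * (real K)\<^sup>2) \<le> \<delta>\<^sup>2 * real t" by (intro mult_left_mono) auto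
    moreover have "\<delta>\<^sup>2 * (3072 * (real q)\<^sup>2 * (real K)\<^sup>2) = 12"
      using q K_ge2 by (simp add: \<delta>_def power2_eq_square field_simps)
    ultimately show ?thesis by simp
  qed
  ultimately have \<delta>: "0 < \<delta>" "\<delta> \<le> 1" "12 \<le> \<delta>\<^sup>2 * real t" by blast+
  have K\<delta>: "2 * (real K * \<delta>) = 1 / (8 * real q)" using K_ge2 by (simp add: \<delta>_def field_simps)
  let ?M = "\<lambda>u. \<Sum>j<d. \<Sum>i<n. of_bool (A i (\<phi> q X j) \<noteq> Z (u i) (vs j)) :: real"
  let ?h = "real (\<Sum>j<d. ham j (\<phi> q X j))"
  have M_eq: "?M u = (\<Sum>i<n. \<Sum>y<K. real (sz y) * measure_pmf.prob (\<nu> q X y) {j. A i j \<noteq> Z (u i) y})" for u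
  proof -
    have "?M u = (\<Sum>i<n. \<Sum>y<K. \<Sum>j\<in>Om y. of_bool (A i (\<phi> q X j) \<noteq> Z (u i) (vs j)))"
      by (subst sum.swap) (simp add: sum_Om)
    also have "\<dots> = (\<Sum>i<n. \<Sum>y<K. \<Sum>j\<in>Om y. of_bool (A i (\<phi> q X j) \<noteq> Z (u i) y))"
      by (intro sum.cong refl) (auto simp: Om_def)
    finally show ?thesis by (simp add: prob_\<nu>)
  qed
  have c_ge: "?M u \<le> (\<Sum>i<n. c i (u i))" for u
    unfolding M_eq c_def using W by (intro sum_mono mult_right_mono) auto
  have c_le: "(\<Sum>i<n. c i (u i)) \<le> (1 + 1 / (8 * real q)) * ?M u" for u
  proof -
    have "real (W ! y) \<le> (1 + 1 / (8 * real q)) * real (sz y)" if "y < K" for y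
    proof -
      have "real (8 * q * W ! y) \<le> real ((8 * q + 1) * sz y)" using W[OF that] by (simp only: of_nat_le_iff)
      then show ?thesis using q by (simp add: field_simps)
    qed
    then have "(\<Sum>i<n. c i (u i)) \<le> (\<Sum>i<n. \<Sum>y<K. (1 + 1 / (8 * real q)) * real (sz y) * measure_pmf.prob (\<nu> q X y) {j. A i j \<noteq> Z (u i) y})"
      unfolding c_def by (intro sum_mono mult_right_mono) auto
    also have "\<dots> = (1 + 1 / (8 * real q)) * ?M u"
      unfolding M_eq by (simp add: sum_distrib_left mult.assoc)
    finally show ?thesis .
  qed
  have M1: "real (cst u vs) \<le> ?M u + ?h" and M2: "?M u \<le> real (cst u vs) + ?h" for u
    unfolding cst_def ham_def of_nat_sum sum.distrib[symmetric] by (intro sum_mono; auto)+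
  have h: "?h \<le> 1 / (8 * real q) * real OPT"
  proof -
    have "real (8 * q * (\<Sum>j<d. ham j (\<phi> q X j))) \<le> real OPT"
      using near_cost[OF X, of q] by (simp only: of_nat_le_iff)
    then show ?thesis using q by (simp add: field_simps)
  qed
  have "1 / 2 \<le> measure_pmf.prob (plist (map (\<lambda>s. \<nu> q X (s div t)) [0..<K * t]))
    {S. \<forall>u. (\<forall>i<n. u i < K \<and> (\<forall>x<K. (\<Sum>s<K * t. real (W ! (s div t)) * of_bool (A i (S ! s) \<noteq> Z (u i) (s div t)))
        \<le> (\<Sum>s<K * t. real (W ! (s div t)) * of_bool (A i (S ! s) \<noteq> Z x (s div t))))) \<longrightarrow>
      (\<Sum>i<n. c i (u i)) \<le> (1 + 2 * (real K * \<delta>)) * (\<Sum>i<n. c i (us i))}"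
    unfolding c_def using us_less by (intro sample_loss \<delta> finite_set_\<nu>) auto
  also have "\<dots> \<le> measure_pmf.prob (plist (map (\<lambda>s. \<nu> q X (s div t)) [0..<K * t])) {S. good_sample q t W S}"
  proof (intro measure_pmf.finite_measure_mono subsetI CollectI, unfold good_sample_def, intro allI impI)
    fix S u
    assume *: "S \<in> {S. \<forall>u. (\<forall>i<n. u i < K \<and> (\<forall>x<K. (\<Sum>s<K * t. real (W ! (s div t)) * of_bool (A i (S ! s) \<noteq> Z (u i) (s div t)))
        \<le> (\<Sum>s<K * t. real (W ! (s div t)) * of_bool (A i (S ! s) \<noteq> Z x (s div t))))) \<longrightarrow>
      (\<Sum>i<n. c i (u i)) \<le> (1 + 2 * (real K * \<delta>)) * (\<Sum>i<n. c i (us i))}"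
      and u: "\<forall>i<n. u i < K \<and> (\<forall>x<K. score t W S i (u i) \<le> score t W S i x)"
    have sc: "(\<Sum>s<K * t. real (W ! (s div t)) * of_bool (A i (S ! s) \<noteq> Z x (s div t))) = real (score t W S i x)" for i x
      unfolding score_def of_nat_sum by (intro sum.cong) auto
    have cu: "(\<Sum>i<n. c i (u i)) \<le> (1 + 1 / (8 * real q)) * (\<Sum>i<n. c i (us i))"
      using *[unfolded mem_Collect_eq sc of_nat_le_iff K\<delta>, rule_format, of u] u by simp
    \<comment> \<open>Each error is of relative size \<open>x\<close>: one factor
      \<open>1 + x\<close> for sampling, one for the guessed sizes, and \<open>x * OPT\<close> for
      moving columns, both when passing from \<open>us\<close> to the moved columns and when passing
      back. The total stays below \<open>1 + 8 * x = 1 + 1 / q\<close>.\<close>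
    define x where "x = 1 / (8 * real q)"
    have x: "0 < x" "x \<le> 1 / 8" "8 * x = 1 / real q" using q by (auto simp: x_def field_simps)
    have "real (cst u vs) \<le> (1 + x) * (\<Sum>i<n. c i (us i)) + ?h"
      using M1[of u] c_ge[of u] cu unfolding x_def by linarith
    also have "\<dots> \<le> (1 + x) * ((1 + x) * ?M us) + ?h"
      using c_le[of us] x by (intro add_right_mono mult_left_mono) (auto simp: x_def)
    also have "\<dots> \<le> (1 + x) * ((1 + x) * (real OPT + x * real OPT)) + x * real OPT"
      using M2[of us] h x by (intro add_mono mult_left_mono) (auto simp: x_def OPT_cst)
    also have "\<dots> = (1 + 4 * x + 3 * (x * x) + x * (x * x)) * real OPT" by (simp add: algebra_simps)
    also have "\<dots> \<le> (1 + 8 * x) * real OPT"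
    proof (intro mult_right_mono)
      have "x * x \<le> x * 1" using x by (intro mult_left_mono) auto
      moreover have "x * (x * x) \<le> x * 1" using x \<open>x * x \<le> x * 1\<close> by (intro mult_left_mono) linarith+
      ultimately show "1 + 4 * x + 3 * (x * x) + x * (x * x) \<le> 1 + 8 * x" by linarith
    qed simp
    finally have "real q * real (cst u vs) \<le> real q * ((1 + 1 / real q) * real OPT)"
      using x(3) by (intro mult_left_mono) auto
    also have "\<dots> = real ((q + 1) * OPT)" using q by (simp add: field_simps)
    finally show "q * cst u vs \<le> (q + 1) * OPT" by (metis of_nat_le_iff of_nat_mult)
  qed simp
  finally show ?thesis .
qed

end

section \<open>Success probability of one trial\<close>

lemma prob_replicate_all:
  assumes "finite (set_pmf p)" "0 \<le> \<beta>" "\<And>y. y < m \<Longrightarrow> \<beta> \<le> measure_pmf.prob p {z. C y z}"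
  shows "\<beta> ^ m \<le> measure_pmf.prob (replicate_pmf m p) {zs. \<forall>y<m. C y (zs ! y)}"
  using assms(3)
proof (induction m arbitrary: C)
  case (Suc m)
  let ?R = "replicate_pmf m p"
  have "\<beta> ^ Suc m = \<beta> * \<beta> ^ m" by simp
  also have "\<dots> \<le> measure_pmf.prob p {z. C 0 z} * \<beta> ^ m"
    using Suc.prems[of 0] assms(2) by (intro mult_right_mono) auto
  also have "\<dots> \<le> measure_pmf.prob (bind_pmf p (\<lambda>x. map_pmf ((#) x) ?R)) {zs. \<forall>y<Suc m. C y (zs ! y)}"
  proof (intro prob_bind_ge assms zero_le_power)
    fix x assume x: "x \<in> {z. C 0 z}"
    have "\<beta> ^ m \<le> measure_pmf.prob ?R {zs. \<forall>y<m. C (Suc y) (zs ! y)}"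
      using Suc.IH[of "\<lambda>y. C (Suc y)"] Suc.prems by auto
    also have "\<dots> \<le> measure_pmf.prob ?R ((#) x -` {zs. \<forall>y<Suc m. C y (zs ! y)})"
      using x by (intro measure_pmf.finite_measure_mono) (auto simp: less_Suc_eq_0_disj)
    finally show "\<beta> ^ m \<le> measure_pmf.prob (map_pmf ((#) x) ?R) {zs. \<forall>y<Suc m. C y (zs ! y)}" by simp
  qed
  also have "bind_pmf p (\<lambda>x. map_pmf ((#) x) ?R) = replicate_pmf (Suc m) p" by (simp add: map_pmf_def)
  finally show ?case .
qed simp

context clustering
begin

text \<open>Fixes the layout of a block: \<open>K\<close> words for the centers, \<open>K\<close>
  for the cluster sizes, and \<open>t\<close> for the samples of each cluster.\<close>

definition good_trial :: "nat \<Rightarrow> nat \<Rightarrow> nat \<Rightarrow> nat list \<Rightarrow> bool" where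
  "good_trial q t b zs \<longleftrightarrow> good_sample q t (map (wt b) (take K (drop K zs)))
     (map (slot (cent (take K zs))) (drop (2 * K) zs))"

theorem trial_prob:
  assumes B: "(K + 2) * (n * d) \<le> B" "K + 2 \<le> B" "b * 2 ^ (b - 1) \<le> B" and q: "0 < q"
    and t: "3072 * q\<^sup>2 * K\<^sup>2 \<le> t" and b: "0 < b" "4 * d \<le> 2 ^ (b - 1)"
  shows "1 / real ((1280 * K\<^sup>2 * q) ^ (K * t + K) * b ^ K) \<le>
    measure_pmf.prob (replicate_pmf (K + (K + K * t)) (pmf_of_set {..<B})) {zs. good_trial q t b zs}"
proof -
  let ?U = "pmf_of_set {..<B}"
  define \<alpha> where "\<alpha> = 1 / (160 * real K * real q * real (K + 2))"
  define \<beta> where "\<beta> = 1 / (64 * real q * real b)"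
  have B0: "0 < B" using B(2) by simp
  have "1 * (n * d) \<le> (K + 2) * (n * d)" by (intro mult_le_mono1) simp
  then have Bnd: "n * d \<le> B" using B(1) by linarith
  have fin: "finite (set_pmf ?U)" using B0 by (simp add: lessThan_empty_iff)
  have pos: "0 \<le> \<alpha>" "0 \<le> \<beta>" by (auto simp: \<alpha>_def \<beta>_def)
  let ?GW = "\<lambda>zs. \<forall>y<K. sz y \<le> wt b (zs ! y) \<and> 8 * q * wt b (zs ! y) \<le> (8 * q + 1) * sz y"
  have "sz y \<le> d" for y
    unfolding sz_def using card_mono[of "{..<d}" "Om y"] by (auto simp: Om_def)
  then have "4 * sz y \<le> 2 ^ (b - 1)" for y using b(2) by (meson le_trans mult_le_mono2)
  then have PW: "\<beta> ^ K \<le> measure_pmf.prob (replicate_pmf K ?U) {zs. ?GW zs}"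
    using prob_weight[OF _ b(1) B(3) q] unfolding \<beta>_def
    by (intro prob_replicate_all fin) auto
  have P3: "\<alpha> ^ (K * t) * (1 / 2) \<le> measure_pmf.prob (replicate_pmf (K * t) ?U) {zs. good_sample q t W (map (slot X) zs)}"
    if X: "length X = K + 1" "RR X \<le> 10 * OPT"
      and W: "\<And>y. y < K \<Longrightarrow> sz y \<le> W ! y \<and> 8 * q * W ! y \<le> (8 * q + 1) * sz y" for X W
  proof -
    let ?ps = "map (\<lambda>s. \<nu> q X (s div t)) [0..<K * t]"
    have "X \<noteq> []" using X(1) by auto
    have "\<alpha> ^ (K * t) * (1 / 2) \<le> \<alpha> ^ length ?ps * measure_pmf.prob (plist ?ps) {S. good_sample q t W S}"
    proof -
      have "\<alpha> ^ (K * t) * (1 / 2) \<le> \<alpha> ^ (K * t) * measure_pmf.prob (plist ?ps) {S. good_sample q t W S}"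
        using good_sample_prob[OF \<open>X \<noteq> []\<close> X(2) q W t] pos by (intro mult_left_mono) auto
      then show ?thesis by simp
    qed
    also have "\<dots> \<le> measure_pmf.prob (replicate_pmf (length ?ps) (map_pmf (slot X) ?U)) {S. good_sample q t W S}"
    proof (rule prob_plist_le)
      show "finite (set_pmf (map_pmf (slot X) ?U))" using fin by simp
      show "\<alpha> * pmf p' x \<le> pmf (map_pmf (slot X) ?U) x" if "p' \<in> set ?ps" for p' x
        using that slot_dominates[OF X(1) B(1,2) q] by (auto simp: \<alpha>_def)
      show "finite (set_pmf p')" if "p' \<in> set ?ps" for p' using that finite_set_\<nu> by auto
    qed (rule pos)
    also have "\<dots> = measure_pmf.prob (replicate_pmf (K * t) ?U) {zs. good_sample q t W (map (slot X) zs)}"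
      by (simp add: map_replicate_pmf[symmetric] vimage_def)
    finally show ?thesis .
  qed
  have "(1 / 20) ^ K * (\<beta> ^ K * (\<alpha> ^ (K * t) * (1 / 2))) \<le>
    measure_pmf.prob (replicate_pmf K ?U) {zs. RR (cent zs) \<le> 10 * OPT} * (\<beta> ^ K * (\<alpha> ^ (K * t) * (1 / 2)))"
    using phase1[OF Bnd B0] pos by (intro mult_right_mono) auto
  also have "\<dots> \<le> measure_pmf.prob (bind_pmf (replicate_pmf K ?U) (\<lambda>z1. bind_pmf (replicate_pmf K ?U)
      (\<lambda>z2. map_pmf (\<lambda>z3. z1 @ z2 @ z3) (replicate_pmf (K * t) ?U)))) {zs. good_trial q t b zs}"
  proof (intro prob_bind_ge finite_set_replicate_pmf fin)
    fix z1 assume z1: "z1 \<in> set_pmf (replicate_pmf K ?U)" "z1 \<in> {zs. RR (cent zs) \<le> 10 * OPT}"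
    have "\<beta> ^ K * (\<alpha> ^ (K * t) * (1 / 2)) \<le>
      measure_pmf.prob (replicate_pmf K ?U) {zs. ?GW zs} * (\<alpha> ^ (K * t) * (1 / 2))"
      using PW pos by (intro mult_right_mono) auto
    also have "\<dots> \<le> measure_pmf.prob (bind_pmf (replicate_pmf K ?U)
      (\<lambda>z2. map_pmf (\<lambda>z3. z1 @ z2 @ z3) (replicate_pmf (K * t) ?U))) {zs. good_trial q t b zs}"
    proof (intro prob_bind_ge finite_set_replicate_pmf fin)
      fix z2 assume z2: "z2 \<in> set_pmf (replicate_pmf K ?U)" "z2 \<in> {zs. ?GW zs}"
      have len: "length z1 = K" "length z2 = K" using z1 z2 by (auto simp: set_replicate_pmf)
      have "\<alpha> ^ (K * t) * (1 / 2) \<le> measure_pmf.prob (replicate_pmf (K * t) ?U)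
        {zs. good_sample q t (map (wt b) z2) (map (slot (cent z1)) zs)}"
        using z1 z2 len by (intro P3) (auto simp: length_cent)
      also have "{zs. good_sample q t (map (wt b) z2) (map (slot (cent z1)) zs)} =
        (\<lambda>z3. z1 @ z2 @ z3) -` {zs. good_trial q t b zs}"
        using len by (auto simp: good_trial_def)
      finally show "\<alpha> ^ (K * t) * (1 / 2) \<le> measure_pmf.prob (map_pmf (\<lambda>z3. z1 @ z2 @ z3) (replicate_pmf (K * t) ?U)) {zs. good_trial q t b zs}"
        by simp
    qed (use pos in auto)
    finally show "\<beta> ^ K * (\<alpha> ^ (K * t) * (1 / 2)) \<le> \<dots>" .
  qed (use pos in auto)
  also have "bind_pmf (replicate_pmf K ?U) (\<lambda>z1. bind_pmf (replicate_pmf K ?U)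
      (\<lambda>z2. map_pmf (\<lambda>z3. z1 @ z2 @ z3) (replicate_pmf (K * t) ?U))) = replicate_pmf (K + (K + K * t)) ?U"
    by (simp add: replicate_pmf_distrib map_pmf_def bind_assoc_pmf bind_return_pmf)
  finally have main: "(1 / 20) ^ K * (\<beta> ^ K * (\<alpha> ^ (K * t) * (1 / 2))) \<le>
    measure_pmf.prob (replicate_pmf (K + (K + K * t)) ?U) {zs. good_trial q t b zs}" .
  \<comment> \<open>In the base \<open>1280 * K\<^sup>2 * q\<close>, the number
    \<open>1280 = 20 * 64\<close> accounts for centers and sizes, \<open>K\<^sup>2\<close> for the
    factor 2 of the final 1/2, and the samples fit because \<open>K + 2 \<le> 8 * K\<close>.\<close>
  let ?D = "20 ^ K * ((64 * q * b) ^ K * ((160 * K * q * (K + 2)) ^ (K * t) * 2))"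
  have "2 * (1280 * q) ^ K \<le> (1280 * K\<^sup>2 * q) ^ K"
  proof -
    have "2 ^ 1 \<le> (K\<^sup>2) ^ K"
    proof -
      have "2 * 1 \<le> K * K" using K_ge2 by (intro mult_le_mono) auto
      then have "2 \<le> K\<^sup>2" by (simp add: power2_eq_square)
      have "2 ^ 1 \<le> (2::nat) ^ K" using K_ge2 by (intro power_increasing) auto
      also have "\<dots> \<le> (K\<^sup>2) ^ K" using \<open>2 \<le> K\<^sup>2\<close> by (intro power_mono) auto
      finally show ?thesis .
    qed
    then have "2 * (1280 * q) ^ K \<le> (K\<^sup>2) ^ K * (1280 * q) ^ K" by (intro mult_le_mono1) simp
    also have "\<dots> = (1280 * K\<^sup>2 * q) ^ K" by (simp add: power_mult_distrib mult_ac)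
    finally show ?thesis .
  qed
  moreover have "(160 * K * q * (K + 2)) ^ (K * t) \<le> (1280 * K\<^sup>2 * q) ^ (K * t)"
  proof (rule power_mono)
    have "160 * K * q * (K + 2) \<le> 160 * K * q * (8 * K)" using K_ge2 by (intro mult_le_mono2) simp
    then show "160 * K * q * (K + 2) \<le> 1280 * K\<^sup>2 * q" by (simp add: power2_eq_square mult_ac)
  qed simp
  ultimately have "(2 * (1280 * q) ^ K) * (160 * K * q * (K + 2)) ^ (K * t) * b ^ K \<le>
    (1280 * K\<^sup>2 * q) ^ K * (1280 * K\<^sup>2 * q) ^ (K * t) * b ^ K" by (intro mult_le_mono1 mult_le_mono)
  also have "\<dots> = (1280 * K\<^sup>2 * q) ^ (K * t + K) * b ^ K" by (simp add: power_add mult_ac)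
  also have "(2 * (1280 * q) ^ K) * (160 * K * q * (K + 2)) ^ (K * t) * b ^ K = ?D"
  proof -
    have "(1280 * q) ^ K * b ^ K = (1280 * q * b) ^ K" by (rule power_mult_distrib[symmetric])
    also have "1280 * q * b = 20 * (64 * q * b)" by simp
    also have "(20 * (64 * q * b)) ^ K = 20 ^ K * (64 * q * b) ^ K" by (rule power_mult_distrib)
    finally have "20 ^ K * (64 * q * b) ^ K = (1280 * q) ^ K * b ^ K" ..
    moreover have "(2 * x) * e * y = a * (c * (e * 2))" if "a * c = x * y" for a c e x y :: nat
    proof -
      have "a * (c * (e * 2)) = (a * c) * (e * 2)" by (rule mult.assoc[symmetric])
      also have "\<dots> = (x * y) * (e * 2)" by (simp only: that)
      also have "\<dots> = (2 * x) * e * y" by (simp add: mult_ac)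
      finally show ?thesis by (rule sym)
    qed
    ultimately show ?thesis by blast
  qed
  finally have le: "real ?D \<le> real ((1280 * K\<^sup>2 * q) ^ (K * t + K) * b ^ K)" by (simp only: of_nat_le_iff)
  have D: "(1 / 20) ^ K * (\<beta> ^ K * (\<alpha> ^ (K * t) * (1 / 2))) = 1 / real ?D"
    unfolding \<alpha>_def \<beta>_def of_nat_mult of_nat_power of_nat_numeral power_one_over
    by (simp only: divide_inverse inverse_mult_distrib mult_1_left mult_1_right)
  have "0 < ?D" using q b K_ge2 by simp
  then have "1 / real ((1280 * K\<^sup>2 * q) ^ (K * t + K) * b ^ K) \<le> 1 / real ?D"
  proof -
    have "1 / y \<le> 1 / x" if "0 < x" "x \<le> y" for x y :: real
      using that by (intro divide_left_mono mult_pos_pos) auto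
    moreover have "0 < real ?D" using \<open>0 < ?D\<close> by (simp only: of_nat_0_less_iff)
    ultimately show ?thesis using le by blast
  qed
  then show ?thesis using main D by linarith
qed

end

section \<open>A structured language compiled to the word RAM\<close>

text \<open>
  Array \<open>a\<close> occupies the \<open>H\<close> memory cells from \<open>a * H\<close> on, where register 3 holds \<open>H\<close>; the registers
  from 100 on are temporaries. \<open>Orc r e f\<close> applies the inner product to two vectors in array 1 and
  stores 0, 1 or 2 in \<open>r\<close>, where 2 stands for any value other than 0 and 1. \<open>For i e b c\<close> counts in
  register \<open>i\<close> and keeps its bound in register \<open>Suc i\<close>; the number \<open>b\<close> is a ghost that the compiler
  ignores: it only bounds the number of iterations in \<open>ctime\<close>.
\<close>

datatype exp = V nat | C nat | Op arith exp exp | Ar nat exp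

datatype com =
    Asg nat exp
  | Sto nat exp exp
  | Orc nat exp exp
  | Seq com com (infixr ";;" 60)
  | For nat exp nat com

record cfg =
  vr :: "nat \<Rightarrow> nat"
  ar :: "nat \<Rightarrow> nat \<Rightarrow> nat"

text \<open>The registers from \<open>r\<close> on form the evaluation stack. A register is copied
  by adding it to 0.\<close>

fun cexp :: "nat \<Rightarrow> exp \<Rightarrow> instr list" where
  "cexp r (V v) = [Const r 0, Arith Add r r v]"
| "cexp r (C c) = [Const r c]"
| "cexp r (Op f a b) = cexp r a @ cexp (Suc r) b @ [Arith f r r (Suc r)]"
| "cexp r (Ar a e) =
     cexp r e @ [Const (Suc r) a, Arith Mul (Suc r) (Suc r) 3, Arith Add r r (Suc r), Load r r]"

primrec elen :: "exp \<Rightarrow> nat" where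
  "elen (V v) = 2"
| "elen (C c) = 1"
| "elen (Op f a b) = elen a + elen b + 1"
| "elen (Ar a e) = elen e + 4"

lemma length_cexp [simp]: "length (cexp r e) = elen e"
  by (induction e arbitrary: r) auto

primrec clen :: "com \<Rightarrow> nat" where
  "clen (Asg r e) = elen e + 2"
| "clen (Sto a i e) = elen i + elen e + 4"
| "clen (Orc r e f) = elen e + elen f + 8"
| "clen (c ;; c') = clen c + clen c'"
| "clen (For i e b c) = elen e + clen c + 8"

text \<open>\<open>l\<close> is the address of the first instruction, from which absolute jump
  targets are computed. \<open>Orc\<close> adds register 3 to its operands because array 1 begins at
  address \<open>H\<close>.\<close>

primrec ccom :: "nat \<Rightarrow> com \<Rightarrow> instr list" where
  "ccom l (Asg r e) = cexp 100 e @ [Const r 0, Arith Add r r 100]"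
| "ccom l (Sto a i e) =
     cexp 100 i @ [Const 101 a, Arith Mul 101 101 3, Arith Add 100 100 101] @
     cexp 101 e @ [Store 100 101]"
| "ccom l (Orc r e f) =
     cexp 100 e @ [Arith Add 100 100 3] @ cexp 101 f @
     [Arith Add 101 101 3, Inner 100 101,
      Const r 0, Jump_Acc r (l + elen e + elen f + 8),
      Const r 1, Jump_Acc r (l + elen e + elen f + 8), Const r 2]"
| "ccom l (c ;; c') = ccom l c @ ccom (l + clen c) c'"
| "ccom l (For i e b c) =
     cexp 100 e @ [Const (Suc i) 0, Arith Add (Suc i) (Suc i) 100, Const i 0] @
     [Jump_Less i (Suc i) (l + elen e + 5), Jump (l + elen e + clen c + 8)] @
     ccom (l + elen e + 5) c @ [Const 100 1, Arith Add i i 100, Jump (l + elen e + 3)]"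

lemma length_ccom [simp]: "length (ccom l c) = clen c"
  by (induction c arbitrary: l) auto

primrec writes :: "com \<Rightarrow> nat set" where
  "writes (Asg r e) = {r}"
| "writes (Sto a i e) = {}"
| "writes (Orc r e f) = {r}"
| "writes (c ;; c') = writes c \<union> writes c'"
| "writes (For i e b c) = {i, Suc i} \<union> writes c"

primrec stores :: "com \<Rightarrow> nat set" where
  "stores (Asg r e) = {}"
| "stores (Sto a i e) = {a}"
| "stores (Orc r e f) = {}"
| "stores (c ;; c') = stores c \<union> stores c'"
| "stores (For i e b c) = stores c"

primrec evars :: "exp \<Rightarrow> nat set" where
  "evars (V v) = {v}"
| "evars (C c) = {}"
| "evars (Op f a b) = evars a \<union> evars b"
| "evars (Ar a e) = evars e"

primrec wf_com :: "com \<Rightarrow> bool" where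
  "wf_com (Asg r e) \<longleftrightarrow> r < 100 \<and> evars e \<subseteq> {..<100}"
| "wf_com (Sto a i e) \<longleftrightarrow> evars i \<union> evars e \<subseteq> {..<100}"
| "wf_com (Orc r e f) \<longleftrightarrow> r < 100 \<and> evars e \<union> evars f \<subseteq> {..<100}"
| "wf_com (c ;; c') \<longleftrightarrow> wf_com c \<and> wf_com c'"
| "wf_com (For i e b c) \<longleftrightarrow>
     Suc i < 100 \<and> evars e \<subseteq> {..<100} \<and> i \<notin> writes c \<and> Suc i \<notin> writes c \<and> wf_com c"

primrec ctime :: "nat \<Rightarrow> com \<Rightarrow> nat" where
  "ctime \<tau> (Asg r e) = elen e + 2"
| "ctime \<tau> (Sto a i e) = elen i + elen e + 4"
| "ctime \<tau> (Orc r e f) = elen e + elen f + \<tau> + 7"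
| "ctime \<tau> (c ;; c') = ctime \<tau> c + ctime \<tau> c'"
| "ctime \<tau> (For i e b c) = elen e + b * (ctime \<tau> c + 4) + 5"

primrec iter :: "nat \<Rightarrow> (nat \<Rightarrow> 'a \<Rightarrow> 'a option) \<Rightarrow> 'a \<Rightarrow> 'a option" where
  "iter 0 f s = Some s"
| "iter (Suc m) f s = Option.bind (iter m f s) (f m)"

definition setv :: "nat \<Rightarrow> nat \<Rightarrow> cfg \<Rightarrow> cfg" where
  "setv r x s = s\<lparr>vr := (vr s)(r := x)\<rparr>"

definition seta :: "nat \<Rightarrow> nat \<Rightarrow> nat \<Rightarrow> cfg \<Rightarrow> cfg" where
  "seta a i x s = s\<lparr>ar := (ar s)(a := (ar s a)(i := x))\<rparr>"

lemma vr_setv [simp]: "vr (setv r x s) = (vr s)(r := x)"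
  and ar_setv [simp]: "ar (setv r x s) = ar s"
  and vr_seta [simp]: "vr (seta a i x s) = vr s"
  and ar_seta [simp]: "ar (seta a i x s) = (ar s)(a := (ar s a)(i := x))"
  by (simp_all add: setv_def seta_def)

primrec eval :: "exp \<Rightarrow> cfg \<Rightarrow> nat" where
  "eval (V r) s = vr s r"
| "eval (C c) s = c"
| "eval (Op f a b) s = arith_op f (eval a s) (eval b s)"
| "eval (Ar a e) s = ar s a (eval e s)"

section \<open>Semantics of commands and simulation by the machine\<close>

fun determ :: "instr \<Rightarrow> bool" where
  "determ (Rand r q) = False"
| "determ _ = True"

text \<open>A value other than 0 and 1 disagrees with every entry of the input, so for counting
  disagreements one code for all of them is enough.\<close>

definition code3 :: "real \<Rightarrow> nat" where
  "code3 x = (if x = 0 then 0 else if x = 1 then 1 else 2)"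

text \<open>Arrays have numbers below 16 and \<open>H\<close> cells each, so
  \<open>16 * H \<le> 2 ^ w\<close> makes every address a word. \<open>1 \<le> \<tau>\<close> makes
  the number of steps at most the cost.\<close>

locale ram =
  fixes w k :: nat and ip :: inner_prod and \<tau> H :: nat
  assumes H_pos: "0 < H" and word: "16 * H \<le> 2 ^ w" and tau: "1 \<le> \<tau>"
begin

text \<open>No intermediate result overflows and no array access leaves its array, so the machine's
  reduction modulo \<open>2 ^ w\<close> agrees with \<open>eval\<close> on unbounded
  numbers.\<close>

primrec safe :: "exp \<Rightarrow> cfg \<Rightarrow> bool" where
  "safe (V r) s = True"
| "safe (C c) s = (c < 2 ^ w)"
| "safe (Op f a b) s = (safe a s \<and> safe b s \<and> arith_op f (eval a s) (eval b s) < 2 ^ w)"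
| "safe (Ar a e) s = (safe e s \<and> a < 16 \<and> vr s 3 = H \<and> eval e s < H)"

definition cvec :: "cfg \<Rightarrow> nat \<Rightarrow> real vec" where
  "cvec s a = vec k (\<lambda>i. of_bool (ar s 1 (a + i) \<noteq> 0))"

text \<open>Undefined on overflow, on accesses out of range, and on loops that exceed their ghost
  bound; a defined result therefore carries the time bound \<open>ctime\<close> with it.\<close>

primrec sem :: "com \<Rightarrow> cfg \<Rightarrow> cfg option" where
  "sem (Asg r e) s = (if safe e s then Some (setv r (eval e s) s) else None)"
| "sem (Sto a i e) s =
     (if safe i s \<and> safe e s \<and> a < 16 \<and> vr s 3 = H \<and> eval i s < H
      then Some (seta a (eval i s) (eval e s) s) else None)"
| "sem (Orc r e f) s =
     (if safe e s \<and> safe f s \<and> vr s 3 = H \<and> eval e s + k \<le> H \<and> eval f s + k \<le> H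
      then Some (setv r (code3 (ip (cvec s (eval e s)) (cvec s (eval f s)))) s) else None)"
| "sem (c ;; c') s = Option.bind (sem c s) (sem c')"
| "sem (For i e b c) s =
     (if safe e s \<and> eval e s \<le> b
      then map_option (setv i (eval e s))
             (iter (eval e s) (\<lambda>j s. sem c (setv i j s)) (setv (Suc i) (eval e s) s))
      else None)"

text \<open>The temporaries from 100 on are only required to be words. Memory is cut into arrays of
  length \<open>H\<close> by \<open>div\<close> and \<open>mod\<close>.\<close>

definition rel :: "cfg \<Rightarrow> state \<Rightarrow> bool" where
  "rel s m \<longleftrightarrow> (\<forall>r<100. reg m r = vr s r) \<and> (\<forall>a. mem m a = ar s (a div H) (a mod H)) \<and>
     (\<forall>r. reg m r < 2 ^ w) \<and> (\<forall>a. mem m a < 2 ^ w)"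

fun dexec :: "instr \<Rightarrow> state \<Rightarrow> state" where
  "dexec (Const r c) s = set_reg r (take_bit w c) s"
| "dexec (Arith f r q t) s = set_reg r (take_bit w (arith_op f (reg s q) (reg s t))) s"
| "dexec (Load r q) s = set_reg r (mem s (reg s q)) s"
| "dexec (Store r q) s = s\<lparr>mem := (mem s)(reg s r := reg s q), pc := Suc (pc s)\<rparr>"
| "dexec (Jump l) s = jump_if True l s"
| "dexec (Jump_Less r q l) s = jump_if (reg s r < reg s q) l s"
| "dexec (Inner r q) s =
     s\<lparr>acc := ip (mem_vec k s (reg s r)) (mem_vec k s (reg s q)), pc := Suc (pc s)\<rparr>"
| "dexec (Jump_Acc r l) s = jump_if (acc s = real (reg s r)) l s"
| "dexec (Rand r q) s = s"

lemma exec_determ: "determ i \<Longrightarrow> exec w k ip i s = return_pmf (dexec i s)"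
  by (cases i) auto

definition xi :: "instr \<Rightarrow> state \<Rightarrow> state" where
  "xi i s = (dexec i s)\<lparr>cost := cost s + instr_cost \<tau> i\<rparr>"

lemma cost_dexec [simp]: "cost (dexec i s) = cost s"
  by (cases i) (auto simp: set_reg_def jump_if_def)

definition reach1 :: "instr list \<Rightarrow> state \<Rightarrow> state \<Rightarrow> bool" where
  "reach1 P s s' \<longleftrightarrow> pc s < length P \<and> determ (P ! pc s) \<and> s' = xi (P ! pc s) s"

abbreviation reach :: "instr list \<Rightarrow> state \<Rightarrow> state \<Rightarrow> bool" where
  "reach P \<equiv> (reach1 P)\<^sup>*\<^sup>*"

lemma step_reach1: "reach1 P s s' \<Longrightarrow> step P w k ip \<tau> s = return_pmf s'"
  by (auto simp: reach1_def step_def halted_def exec_determ xi_def)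

lemma cost_reach1: "reach1 P s s' \<Longrightarrow> cost s < cost s'"
proof -
  have "1 \<le> instr_cost \<tau> i" for i by (cases i) (use tau in auto)
  then show "reach1 P s s' \<Longrightarrow> cost s < cost s'"
    by (fastforce simp: reach1_def xi_def intro: less_le_trans)
qed

text \<open>Every instruction costs at least 1, so a bound on the cost bounds the number of
  steps.\<close>

lemma steps_reach:
  assumes "reach P s s'"
  shows "\<exists>t. t + cost s \<le> cost s' \<and> steps P w k ip \<tau> t s = return_pmf s'"
  using assms
proof (induction rule: converse_rtranclp_induct)
  case base
  show ?case by (intro exI[of _ 0]) simp
next
  case (step y z)
  then obtain t where t: "t + cost z \<le> cost s'" "steps P w k ip \<tau> t z = return_pmf s'" by blast
  show ?case
    using t cost_reach1[OF step(1)] step_reach1[OF step(1)]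
    by (intro exI[of _ "Suc t"]) (auto simp: bind_return_pmf)
qed

definition code_at :: "instr list \<Rightarrow> nat \<Rightarrow> instr list \<Rightarrow> bool" where
  "code_at P l c \<longleftrightarrow> (\<exists>xs ys. P = xs @ c @ ys \<and> length xs = l)"

lemma code_at_append: "code_at P l (c @ c') \<longleftrightarrow> code_at P l c \<and> code_at P (l + length c) c'"
proof
  assume "code_at P l (c @ c')"
  then obtain xs ys where "P = xs @ (c @ c') @ ys" "length xs = l" by (auto simp: code_at_def)
  then show "code_at P l c \<and> code_at P (l + length c) c'"
    unfolding code_at_def
    by (metis append.assoc length_append)
next
  assume "code_at P l c \<and> code_at P (l + length c) c'"
  then obtain xs ys xs' ys' where *: "P = xs @ c @ ys" "length xs = l"
    "P = xs' @ c' @ ys'" "length xs' = l + length c" unfolding code_at_def by blast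
  then have "xs @ c = xs'" by (metis append.assoc append_eq_append_conv length_append)
  with * have "P = xs @ (c @ c') @ ys'" by auto
  with * show "code_at P l (c @ c')" by (auto simp: code_at_def)
qed

lemma code_at_Cons: "code_at P l (i # c) \<longleftrightarrow> l < length P \<and> P ! l = i \<and> code_at P (Suc l) c"
proof -
  have "code_at P l [i] \<longleftrightarrow> l < length P \<and> P ! l = i"
  proof
    assume "l < length P \<and> P ! l = i"
    then have "P = take l P @ [i] @ drop (Suc l) P" "length (take l P) = l"
      by (auto simp: id_take_nth_drop)
    then show "code_at P l [i]" unfolding code_at_def by blast
  qed (auto simp: code_at_def)
  then show ?thesis using code_at_append[of P l "[i]" c] by simp
qed

lemma code_at_Nil [simp]: "code_at P l [] \<longleftrightarrow> l \<le> length P"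
proof
  assume "l \<le> length P"
  then have "P = take l P @ [] @ drop l P" "length (take l P) = l" by auto
  then show "code_at P l []" unfolding code_at_def by blast
qed (auto simp: code_at_def)

lemma code_at_split:
  assumes "code_at P l (a @ b @ c @ e)" "x = l + length a" "y = x + length b" "z = y + length c"
  shows "code_at P l a \<and> code_at P x b \<and> code_at P y c \<and> code_at P z e"
  using assms by (simp add: code_at_append)

lemma reach_code_at: "code_at P (pc m) (i # c) \<Longrightarrow> determ i \<Longrightarrow> reach P m (xi i m)"
  by (rule r_into_rtranclp) (auto simp: reach1_def code_at_Cons)

lemma xi_simps [simp]:
  "reg (xi (Const r c) m) = (reg m)(r := take_bit w c)"
  "reg (xi (Arith f r q t) m) = (reg m)(r := take_bit w (arith_op f (reg m q) (reg m t)))"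
  "reg (xi (Load r q) m) = (reg m)(r := mem m (reg m q))"
  "reg (xi (Store r q) m) = reg m"
  "reg (xi (Inner r q) m) = reg m"
  "reg (xi (Jump l) m) = reg m"
  "reg (xi (Jump_Less r q l) m) = reg m"
  "reg (xi (Jump_Acc r l) m) = reg m"
  "mem (xi (Const r c) m) = mem m"
  "mem (xi (Arith f r q t) m) = mem m"
  "mem (xi (Load r q) m) = mem m"
  "mem (xi (Store r q) m) = (mem m)(reg m r := reg m q)"
  "mem (xi (Inner r q) m) = mem m"
  "mem (xi (Jump l) m) = mem m"
  "mem (xi (Jump_Less r q l) m) = mem m"
  "mem (xi (Jump_Acc r l) m) = mem m"
  "pc (xi (Const r c) m) = Suc (pc m)"
  "pc (xi (Arith f r q t) m) = Suc (pc m)"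
  "pc (xi (Load r q) m) = Suc (pc m)"
  "pc (xi (Store r q) m) = Suc (pc m)"
  "pc (xi (Inner r q) m) = Suc (pc m)"
  "pc (xi (Jump l) m) = l"
  "pc (xi (Jump_Less r q l) m) = (if reg m r < reg m q then l else Suc (pc m))"
  "pc (xi (Jump_Acc r l) m) = (if acc m = real (reg m r) then l else Suc (pc m))"
  "acc (xi (Const r c) m) = acc m"
  "acc (xi (Inner r q) m) = ip (mem_vec k m (reg m r)) (mem_vec k m (reg m q))"
  "acc (xi (Jump_Acc r l) m) = acc m"
  "cost (xi i m) = cost m + instr_cost \<tau> i"
  by (simp_all add: xi_def set_reg_def jump_if_def)

fun straight :: "instr \<Rightarrow> bool" where
  "straight (Rand r q) = False"
| "straight (Jump l) = False"
| "straight (Jump_Less r q l) = False"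
| "straight (Jump_Acc r l) = False"
| "straight _ = True"

lemma reach_straight:
  "code_at P (pc m) c \<Longrightarrow> list_all straight c \<Longrightarrow> reach P m (fold xi c m)"
proof (induction c arbitrary: m)
  case (Cons i c)
  then have i: "determ i" "pc (xi i m) = Suc (pc m)" by (cases i; auto)+
  then have "reach P m (xi i m)" using Cons by (intro reach_code_at)
  also have "reach P (xi i m) (fold xi c (xi i m))"
    using Cons i by (intro Cons.IH) (auto simp: code_at_Cons)
  finally show ?case by simp
qed simp

lemma rel_reg: "rel s m \<Longrightarrow> r < 100 \<Longrightarrow> reg m r = vr s r"
  and rel_reg_less: "rel s m \<Longrightarrow> reg m r < 2 ^ w"
  and rel_mem: "rel s m \<Longrightarrow> mem m a = ar s (a div H) (a mod H)"
  and rel_mem_less: "rel s m \<Longrightarrow> mem m a < 2 ^ w"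
  unfolding rel_def by blast+

lemma rel_tmp:
  assumes "rel s m" "mem m' = mem m" "\<And>v. v < 100 \<Longrightarrow> reg m' v = reg m v" "\<And>v. reg m' v < 2 ^ w"
  shows "rel s m'"
  unfolding rel_def
  using assms rel_reg[OF assms(1)] rel_mem[OF assms(1)] rel_mem_less[OF assms(1)] by auto

lemma address:
  assumes "a < 16" "i < H"
  shows "i + a * H < 2 ^ w" "a * H < 2 ^ w" "a < 2 ^ w" "(i + a * H) div H = a" "(i + a * H) mod H = i"
proof -
  have "(a + 1) * H \<le> 16 * H" using assms by (intro mult_le_mono1) simp
  also have "(a + 1) * H = a * H + H" by simp
  finally have "i + a * H < 16 * H" using assms(2) by linarith
  then show "i + a * H < 2 ^ w" using word by linarith
  then show *: "a * H < 2 ^ w" by linarith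
  have "a * 1 \<le> a * H" using H_pos by (intro mult_le_mono2) simp
  then show "a < 2 ^ w" using * by linarith
qed (use assms in auto)

text \<open>Preserving all registers below \<open>r\<close> is what protects the first operand while
  the second is evaluated from \<open>Suc r\<close> on.\<close>

lemma exp_correct:
  assumes "code_at P (pc m) (cexp r e)" "rel s m" "safe e s" "100 \<le> r" "evars e \<subseteq> {..<100}"
  shows "\<exists>m'. reach P m m' \<and> pc m' = pc m + elen e \<and> reg m' r = eval e s \<and>
     (\<forall>v<r. reg m' v = reg m v) \<and> mem m' = mem m \<and> cost m' = cost m + elen e \<and> rel s m'"
  using assms
proof (induction e arbitrary: r m)
  case (V v)
  let ?m = "fold xi (cexp r (V v)) m"
  have "reach P m ?m" using V by (intro reach_straight) auto
  moreover have "reg m v = vr s v" "v \<noteq> r" "reg m v < 2 ^ w"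
    using V rel_reg[OF V(2), of v] rel_reg_less[OF V(2), of v] by auto
  moreover have "rel s ?m" by (rule rel_tmp[OF V(2)]) (use V(4) rel_reg_less[OF V(2)] in auto)
  ultimately show ?case by (intro exI[of _ ?m]) (auto simp: take_bit_nat_eq_self)
next
  case (C c)
  let ?m = "fold xi (cexp r (C c)) m"
  have "reach P m ?m" using C by (intro reach_straight) auto
  moreover have "rel s ?m" by (rule rel_tmp[OF C(2)]) (use C(4) rel_reg_less[OF C(2)] in auto)
  ultimately show ?case using C(3) by (intro exI[of _ ?m]) (auto simp: take_bit_nat_eq_self)
next
  case (Op f a b)
  obtain m1 where m1: "reach P m m1" "pc m1 = pc m + elen a" "reg m1 r = eval a s"
    "\<forall>v<r. reg m1 v = reg m v" "mem m1 = mem m" "cost m1 = cost m + elen a" "rel s m1"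
    using Op(1)[of m r] Op(3-) by (auto simp: code_at_append)
  obtain m2 where m2: "reach P m1 m2" "pc m2 = pc m1 + elen b" "reg m2 (Suc r) = eval b s"
    "\<forall>v<Suc r. reg m2 v = reg m1 v" "mem m2 = mem m1" "cost m2 = cost m1 + elen b" "rel s m2"
    using Op(2)[of m1 "Suc r"] Op(3-) m1 by (auto simp: code_at_append)
  let ?m = "xi (Arith f r r (Suc r)) m2"
  have "reach P m2 ?m" using Op(3) m1(2) m2(2) by (intro reach_code_at) (auto simp: code_at_append)
  then have "reach P m ?m" using m1(1) m2(1) by (meson rtranclp_trans)
  moreover have "rel s ?m" by (rule rel_tmp[OF m2(7)]) (use Op(6) rel_reg_less[OF m2(7)] in auto)
  ultimately show ?case using Op(5) m1(2-6) m2(2-6)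
    by (intro exI[of _ ?m]) (auto simp: take_bit_nat_eq_self)
next
  case (Ar a e)
  obtain m1 where m1: "reach P m m1" "pc m1 = pc m + elen e" "reg m1 r = eval e s"
    "\<forall>v<r. reg m1 v = reg m v" "mem m1 = mem m" "cost m1 = cost m + elen e" "rel s m1"
    using Ar(1)[of m r] Ar(2-) by (auto simp: code_at_append)
  let ?c = "[Const (Suc r) a, Arith Mul (Suc r) (Suc r) 3, Arith Add r r (Suc r), Load r r]"
  let ?m = "fold xi ?c m1"
  have "reach P m1 ?m" using Ar(2) m1(2) by (intro reach_straight) (auto simp: code_at_append)
  then have r: "reach P m ?m" using m1(1) by (meson rtranclp_trans)
  have a: "a < 16" "eval e s < H" "vr s 3 = H" using Ar(4) by auto
  note A = address[OF a(1,2)]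
  have "rel s ?m"
    by (rule rel_tmp[OF m1(7)]) (use Ar(5) rel_reg_less[OF m1(7)] rel_mem_less[OF m1(7)] in auto)
  moreover have "reg m1 3 = H" using rel_reg[OF m1(7), of 3] a by simp
  moreover have "mem m1 (eval e s + a * H) = ar s a (eval e s)"
    using rel_mem[OF m1(7), of "eval e s + a * H"] A(4,5) by simp
  ultimately show ?case using r m1(2-6) A(1-3) Ar(5)
    by (intro exI[of _ ?m]) (auto simp: take_bit_nat_eq_self)
qed

lemma sem_frame:
  assumes "sem c s = Some s'"
  shows "v \<notin> writes c \<Longrightarrow> vr s' v = vr s v" and "a \<notin> stores c \<Longrightarrow> ar s' a = ar s a"
proof -
  have "(\<forall>v. v \<notin> writes c \<longrightarrow> vr s' v = vr s v) \<and> (\<forall>a. a \<notin> stores c \<longrightarrow> ar s' a = ar s a)"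
    using assms
  proof (induction c arbitrary: s s')
    case (For i e b c)
    have *: "iter m (\<lambda>j s. sem c (setv i j s)) s = Some s' \<Longrightarrow>
      (\<forall>v. v \<notin> writes c \<union> {i} \<longrightarrow> vr s' v = vr s v) \<and> (\<forall>a. a \<notin> stores c \<longrightarrow> ar s' a = ar s a)" for m s s'
    proof (induction m arbitrary: s')
      case (Suc m)
      then obtain s1 where s1: "iter m (\<lambda>j s. sem c (setv i j s)) s = Some s1"
        "sem c (setv i m s1) = Some s'" by (auto simp: bind_eq_Some_conv)
      show ?case using Suc.IH[OF s1(1)] For(1)[OF s1(2)] by auto
    qed auto
    from For(2) obtain s1 where
      "iter (eval e s) (\<lambda>j s. sem c (setv i j s)) (setv (Suc i) (eval e s) s) = Some s1"
      "s' = setv i (eval e s) s1" by (auto split: if_splits)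
    then show ?case using *[of "eval e s" "setv (Suc i) (eval e s) s" s1] by auto
  qed (fastforce split: if_splits simp: bind_eq_Some_conv)+
  then show "v \<notin> writes c \<Longrightarrow> vr s' v = vr s v" and "a \<notin> stores c \<Longrightarrow> ar s' a = ar s a" by auto
qed

end

section \<open>Correctness of the compiler\<close>

context ram
begin

lemma rel_setv:
  assumes "rel s m" "r < 100" "mem m' = mem m" "reg m' r = x"
    "\<And>v. v < 100 \<Longrightarrow> v \<noteq> r \<Longrightarrow> reg m' v = reg m v" "\<And>v. reg m' v < 2 ^ w"
  shows "rel (setv r x s) m'"
  unfolding rel_def
  using assms(2-) rel_reg[OF assms(1)] rel_mem[OF assms(1)] rel_mem_less[OF assms(1)] by auto

lemma two_le_w: "2 \<le> w"
proof -
  have "(2::nat) ^ 2 < 2 ^ w" using word H_pos by simp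
  then show ?thesis using power_less_imp_less_exp[of "2::nat" 2 w] by simp
qed

lemma code3_less: "code3 x < 2 ^ w"
proof -
  have "3 < 16 * H" using H_pos by simp
  then show ?thesis using word by (simp add: code3_def)
qed

lemma mem_vec_cvec:
  assumes "rel s m" "a + k \<le> H"
  shows "mem_vec k m (a + H) = cvec s a"
proof -
  have "mem_bit m (a + H + i) = of_bool (ar s 1 (a + i) \<noteq> 0)" if "i < k" for i
    using rel_mem[OF assms(1), of "a + i + 1 * H"] address(4,5)[of 1 "a + i"] assms(2) that
    by (simp add: mem_bit_def add.assoc add.left_commute add.commute)
  then show ?thesis by (auto simp: mem_vec_def cvec_def)
qed

text \<open>The cost is only bounded: \<open>Orc\<close> may leave its comparisons early, and a loop
  may run for fewer rounds than its ghost bound.\<close>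

lemma com_correct:
  assumes "code_at P (pc m) (ccom (pc m) c)" "rel s m" "sem c s = Some s'" "wf_com c"
  shows "\<exists>m'. reach P m m' \<and> pc m' = pc m + clen c \<and> cost m' \<le> cost m + ctime \<tau> c \<and> rel s' m'"
  using assms
proof (induction c arbitrary: m s s')
  case (Asg r e)
  have s: "safe e s" "s' = setv r (eval e s) s" using Asg(3) by (auto split: if_splits)
  obtain m1 where m1: "reach P m m1" "pc m1 = pc m + elen e" "reg m1 100 = eval e s"
    "mem m1 = mem m" "cost m1 = cost m + elen e" "rel s m1"
    using exp_correct[of P m 100 e s] Asg s(1) by (auto simp: code_at_append)
  let ?m = "fold xi [Const r 0, Arith Add r r 100] m1"
  have "reach P m1 ?m" using Asg(1) m1(2) by (intro reach_straight) (auto simp: code_at_append)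
  then have "reach P m ?m" using m1(1) by (meson rtranclp_trans)
  moreover have "rel s' ?m" unfolding s(2)
    by (rule rel_setv[OF m1(6)]) (use Asg(4) m1(3) rel_reg_less[OF m1(6)] in
        \<open>auto simp: take_bit_nat_eq_self simp flip: m1(3)\<close>)
  ultimately show ?case using m1 by (intro exI[of _ ?m]) auto
next
  case (Sto a i e)
  have s: "safe i s" "safe e s" "a < 16" "vr s 3 = H" "eval i s < H" "s' = seta a (eval i s) (eval e s) s"
    using Sto(3) by (auto split: if_splits)
  note A = address[OF s(3,5)]
  obtain m1 where m1: "reach P m m1" "pc m1 = pc m + elen i" "reg m1 100 = eval i s"
    "cost m1 = cost m + elen i" "rel s m1"
    using exp_correct[of P m 100 i s] Sto s(1) by (auto simp: code_at_append)
  let ?c = "[Const 101 a, Arith Mul 101 101 3, Arith Add 100 100 101]"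
  let ?m2 = "fold xi ?c m1"
  have "code_at P (pc m) (cexp 100 i) \<and> code_at P (pc m + elen i) ?c \<and>
    code_at P (pc m + elen i + 3) (cexp 101 e) \<and> code_at P (pc m + elen i + 3 + elen e) [Store 100 101]"
    by (rule code_at_split) (use Sto(1) in simp_all)
  then have cd: "code_at P (pc m + elen i) ?c" "code_at P (pc m + elen i + 3) (cexp 101 e)"
    "code_at P (pc m + elen i + 3 + elen e) [Store 100 101]" by blast+
  have r2: "reach P m1 ?m2" by (intro reach_straight) (use cd(1) m1(2) in auto)
  have "reg m1 3 = H" using rel_reg[OF m1(5), of 3] s(4) by simp
  then have m2: "reg ?m2 100 = eval i s + a * H" "pc ?m2 = pc m + elen i + 3"
    "cost ?m2 = cost m + elen i + 3" using m1 A by (auto simp: take_bit_nat_eq_self)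
  have rel2: "rel s ?m2" by (rule rel_tmp[OF m1(5)]) (use rel_reg_less[OF m1(5)] in auto)
  obtain m3 where m3: "reach P ?m2 m3" "pc m3 = pc ?m2 + elen e" "reg m3 101 = eval e s"
    "reg m3 100 = reg ?m2 100" "mem m3 = mem ?m2" "cost m3 = cost ?m2 + elen e" "rel s m3"
    using exp_correct[OF _ rel2 s(2), of P 101] Sto(4) cd(2) unfolding m2(2) by (auto simp del: fold_simps)
  let ?m = "xi (Store 100 101) m3"
  have "code_at P (pc m3) [Store 100 101]" using cd(3) unfolding m3(2) m2(2) by simp
  then have "reach P m3 ?m" by (intro reach_code_at) auto
  then have r: "reach P m ?m" using m1(1) r2 m3(1) by (meson rtranclp_trans)
  have eq: "x = eval i s + a * H \<longleftrightarrow> x div H = a \<and> x mod H = eval i s" for x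
    using A(4,5) div_mult_mod_eq[of x H] by (metis add.commute)
  have "mem ?m = (mem m3)(eval i s + a * H := eval e s)" using m3(3,4) m2(1) by simp
  then have "rel s' ?m" unfolding s(6) rel_def
    using rel_reg[OF m3(7)] rel_reg_less[OF m3(7)] rel_mem[OF m3(7)] rel_mem_less[OF m3(7)]
      rel_reg_less[OF m3(7), of 101] m3(3) eq by auto
  then show ?case using r m3 m2 by (intro exI[of _ ?m]) auto
next
  case (Orc r e f)
  have s: "safe e s" "safe f s" "vr s 3 = H" "eval e s + k \<le> H" "eval f s + k \<le> H"
    "s' = setv r (code3 (ip (cvec s (eval e s)) (cvec s (eval f s)))) s"
    using Orc(3) by (auto split: if_splits)
  have H2: "x + H < 2 ^ w" if "x \<le> H" for x using that word H_pos by linarith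
  obtain m1 where m1: "reach P m m1" "pc m1 = pc m + elen e" "reg m1 100 = eval e s"
    "cost m1 = cost m + elen e" "rel s m1"
    using exp_correct[of P m 100 e s] Orc s(1) by (auto simp: code_at_append)
  let ?m2 = "xi (Arith Add 100 100 3) m1"
  let ?c = "[Arith Add 101 101 3, Inner 100 101, Const r 0]"
  let ?end = "pc m + elen e + elen f + 8"
  let ?x = "ip (cvec s (eval e s)) (cvec s (eval f s))"
  let ?d = "[Jump_Acc r ?end, Const r 1, Jump_Acc r ?end, Const r 2]"
  have cd: "code_at P (pc m + elen e) [Arith Add 100 100 3]"
    "code_at P (pc m + elen e + 1) (cexp 101 f)" "code_at P (pc m + elen e + 1 + elen f) (?c @ ?d)"
    using code_at_split[of P "pc m" "cexp 100 e" "[Arith Add 100 100 3]" "cexp 101 f" "?c @ ?d", OF _ refl refl refl]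
      Orc(1) by auto
  have r2: "reach P m1 ?m2" by (intro reach_code_at) (use cd(1) m1(2) in auto)
  have "reg m1 3 = H" using rel_reg[OF m1(5), of 3] s(3) by simp
  then have m2: "reg ?m2 100 = eval e s + H" using m1 H2 s(4) by (auto simp: take_bit_nat_eq_self)
  have rel2: "rel s ?m2" by (rule rel_tmp[OF m1(5)]) (use rel_reg_less[OF m1(5)] in auto)
  obtain m3 where m3: "reach P ?m2 m3" "pc m3 = pc ?m2 + elen f" "reg m3 101 = eval f s"
    "reg m3 100 = reg ?m2 100" "cost m3 = cost ?m2 + elen f" "rel s m3"
    using exp_correct[OF _ rel2 s(2), of P 101] Orc(4) cd(2) m1(2) by auto
  let ?m4 = "fold xi ?c m3"
  have cc: "code_at P (pc m3) (?c @ ?d)" using cd(3) m1(2) m3(2) by simp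
  have r4: "reach P m3 ?m4"
    by (intro reach_straight conjunct1[OF iffD1[OF code_at_append cc]]) auto
  have "reg m3 3 = H" using rel_reg[OF m3(6), of 3] s(3) by simp
  then have "reg (xi (Arith Add 101 101 3) m3) 101 = eval f s + H"
    "reg (xi (Arith Add 101 101 3) m3) 100 = eval e s + H"
    using m3 m2 H2 s(5) by (auto simp: take_bit_nat_eq_self)
  moreover have "rel s (xi (Arith Add 101 101 3) m3)"
    by (rule rel_tmp[OF m3(6)]) (use rel_reg_less[OF m3(6)] in auto)
  ultimately have acc: "acc ?m4 = ?x" using mem_vec_cvec s(4,5) by simp
  have regs: "reg ?m4 r = 0" "\<And>v. v < 100 \<Longrightarrow> v \<noteq> r \<Longrightarrow> reg ?m4 v = reg m3 v" "mem ?m4 = mem m3"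
    "\<And>v. reg ?m4 v < 2 ^ w" using rel_reg_less[OF m3(6)] by auto
  have pc4: "pc ?m4 = pc m3 + 3" "cost ?m4 \<le> cost m + elen e + elen f + 3 + \<tau>"
    using m3 m1 by auto
  \<comment> \<open>The three outcomes of the comparisons meet at the same address; only the
    register \<open>r\<close>, the program counter and the cost differ.\<close>
  have fin: "?case" if "reach P ?m4 m'" "reg m' r = code3 ?x" "pc m' = ?end" "mem m' = mem ?m4"
    "\<And>v. v \<noteq> r \<Longrightarrow> reg m' v = reg ?m4 v" "cost m' \<le> cost ?m4 + 4" for m'
  proof -
    have "reach P m m'" using m1(1) r2 m3(1) r4 that(1) by (meson rtranclp_trans)
    moreover have lt: "reg m' v < 2 ^ w" for v
      using that(2) that(5)[of v] regs(4)[of v] code3_less by (cases "v = r") (auto simp del: fold_simps)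
    have "rel s' m'" unfolding s(6)
    proof (rule rel_setv[OF m3(6)])
      show "mem m' = mem m3" using that(4) regs(3) by (rule trans)
      show "reg m' v = reg m3 v" if "v < 100" "v \<noteq> r" for v
        using \<open>\<And>v. v \<noteq> r \<Longrightarrow> reg m' v = reg ?m4 v\<close>[OF that(2)] regs(2)[OF that] by (rule trans)
    qed (use that(2) lt Orc(4) in auto)
    ultimately show ?thesis using that(3,6) pc4(2) by (intro exI[of _ m']) auto
  qed
  define m4 where "m4 = ?m4"
  let ?m5 = "xi (Jump_Acc r ?end) m4"
  have w1: "take_bit w (Suc 0) = 1" "take_bit w 2 = (2::nat)" "0 < w" "2 \<le> w"
  proof -
    show "2 \<le> w" by (rule two_le_w)
    then show "0 < w" by simp
    have "2 < (2::nat) ^ w" using word H_pos by linarith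
    then show "take_bit w (Suc 0) = 1" "take_bit w 2 = (2::nat)"
      using two_le_w take_bit_nat_eq_self[of 2 w] by simp_all
  qed
  have pcm: "Suc (Suc (Suc (pc m3))) = pc m4" using pc4(1) by (simp add: m4_def)
  have r5: "reach P m4 ?m5"
    using cc by (intro r_into_rtranclp) (auto simp: reach1_def code_at_append code_at_Cons pcm)
  have r0: "reg m4 r = 0" "acc m4 = ?x" "pc m4 = pc m + elen e + elen f + 4"
    using regs(1) acc pc4(1) m1 m3 by (simp_all add: m4_def)
  show ?case
  proof (cases "?x = 0")
    case True
    show ?thesis
      by (rule fin[of ?m5, folded m4_def]) (use r5 True r0 in \<open>auto simp: code3_def\<close>)
  next
    case False
    let ?m6 = "xi (Const r 1) ?m5"
    let ?m7 = "xi (Jump_Acc r ?end) ?m6"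
    have r7: "reach P ?m5 ?m6" "reach P ?m6 ?m7"
      by (rule r_into_rtranclp; use False r0 cc in \<open>auto simp: reach1_def code_at_append code_at_Cons pcm\<close>)+
    show ?thesis
    proof (cases "?x = 1")
      case True
      show ?thesis
        by (rule fin[of ?m7, folded m4_def])
          (use r5 r7 True r0 in \<open>auto simp: code3_def w1\<close>)
    next
      case False2: False
      let ?m8 = "xi (Const r 2) ?m7"
      have r8: "reach P ?m7 ?m8"
        by (rule r_into_rtranclp; use False False2 r0 cc w1 in \<open>auto simp: reach1_def code_at_append code_at_Cons pcm\<close>)
      show ?thesis
        by (rule fin[of ?m8, folded m4_def])
          (use r5 r7 r8 False False2 r0 in \<open>auto simp: code3_def w1\<close>)
    qed
  qed
next
  case (Seq c1 c2)
  then obtain s1 where s1: "sem c1 s = Some s1" "sem c2 s1 = Some s'"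
    by (auto simp: bind_eq_Some_conv)
  obtain m1 where m1: "reach P m m1" "pc m1 = pc m + clen c1" "cost m1 \<le> cost m + ctime \<tau> c1" "rel s1 m1"
    using Seq(1)[of m s s1] Seq(3-) s1 by (auto simp: code_at_append)
  obtain m2 where m2: "reach P m1 m2" "pc m2 = pc m1 + clen c2" "cost m2 \<le> cost m1 + ctime \<tau> c2" "rel s' m2"
    using Seq(2)[of m1 s1 s'] Seq(3-) s1 m1 by (auto simp: code_at_append)
  show ?case using m1 m2 by (intro exI[of _ m2]) (auto intro: rtranclp_trans)
next
  case (For i e b c)
  define N where "N = eval e s"
  define f where "f = (\<lambda>j s. sem c (setv i j s))"
  obtain sN where s: "safe e s" "N \<le> b" "iter N f (setv (Suc i) N s) = Some sN" "s' = setv i N sN"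
    using For(4) unfolding N_def f_def by (auto split: if_splits)
  have wf: "Suc i < 100" "evars e \<subseteq> {..<100}" "i \<notin> writes c" "Suc i \<notin> writes c" "wf_com c"
    using For(5) by auto
  let ?p = "pc m + elen e + 3" and ?end = "pc m + elen e + clen c + 8"
  have "code_at P (pc m) (cexp 100 e @ [Const (Suc i) 0, Arith Add (Suc i) (Suc i) 100, Const i 0]) \<and>
    code_at P ?p [Jump_Less i (Suc i) (?p + 2), Jump ?end] \<and>
    code_at P (?p + 2) (ccom (?p + 2) c) \<and>
    code_at P (?p + 2 + clen c) [Const 100 1, Arith Add i i 100, Jump ?p]"
  proof (rule code_at_split)
    have *: "pc m + elen e + 5 = 5 + (pc m + elen e)" by simp
    show "code_at P (pc m) ((cexp 100 e @ [Const (Suc i) 0, Arith Add (Suc i) (Suc i) 100, Const i 0])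
      @ [Jump_Less i (Suc i) (?p + 2), Jump ?end] @ ccom (?p + 2) c
      @ [Const 100 1, Arith Add i i 100, Jump ?p])" using For(2) by (simp add: *)
  qed simp_all
  then have cd: "code_at P (pc m) (cexp 100 e @ [Const (Suc i) 0, Arith Add (Suc i) (Suc i) 100, Const i 0])"
    "code_at P ?p [Jump_Less i (Suc i) (?p + 2), Jump ?end]"
    "code_at P (?p + 2) (ccom (?p + 2) c)"
    "code_at P (?p + 2 + clen c) [Const 100 1, Arith Add i i 100, Jump ?p]" by blast+
  obtain m1 where m1: "reach P m m1" "pc m1 = pc m + elen e" "reg m1 100 = N"
    "cost m1 = cost m + elen e" "rel s m1"
    using exp_correct[of P m 100 e s] cd(1) wf s(1) For.prems(2) N_def
    by (auto simp: code_at_append)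
  let ?m2 = "fold xi [Const (Suc i) 0, Arith Add (Suc i) (Suc i) 100, Const i 0] m1"
  have N: "N < 2 ^ w" using rel_reg_less[OF m1(5), of 100] m1(3) by simp
  have r2: "reach P m1 ?m2" by (intro reach_straight) (use cd(1) m1(2) in \<open>auto simp: code_at_append\<close>)
  have rel2: "rel (setv i 0 (setv (Suc i) N s)) ?m2"
    by (rule rel_setv[where m = "fold xi [Const (Suc i) 0, Arith Add (Suc i) (Suc i) 100] m1"],
        rule rel_setv[OF m1(5)])
      (use wf m1(3) N rel_reg_less[OF m1(5)] in \<open>auto simp: take_bit_nat_eq_self\<close>)
  \<comment> \<open>Describes the machine at the loop test before round \<open>j\<close>. Since the
    body writes neither the counter nor the bound, \<open>sem_frame\<close> keeps both
    intact.\<close>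
  have loop: "\<exists>m'. reach P m m' \<and> pc m' = ?p \<and> cost m' \<le> cost m + elen e + 3 + j * (ctime \<tau> c + 4) \<and>
      rel (setv i j sj) m' \<and> vr sj (Suc i) = N"
    if "iter j f (setv (Suc i) N s) = Some sj" "j \<le> N" for j sj
    using that
  proof (induction j arbitrary: sj)
    case 0
    show ?case
      by (rule exI[of _ ?m2]) (use 0 m1 r2 rel2 in auto)
  next
    case (Suc j)
    then obtain t where t: "iter j f (setv (Suc i) N s) = Some t" "f j t = Some sj"
      by (auto simp: bind_eq_Some_conv)
    obtain m3 where m3: "reach P m m3" "pc m3 = ?p"
      "cost m3 \<le> cost m + elen e + 3 + j * (ctime \<tau> c + 4)" "rel (setv i j t) m3" "vr t (Suc i) = N"
      using Suc.IH[OF t(1)] Suc(3) by auto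
    let ?m4 = "xi (Jump_Less i (Suc i) (?p + 2)) m3"
    have r4: "reach P m3 ?m4" using cd(2) m3(2) by (intro r_into_rtranclp) (auto simp: reach1_def code_at_Cons)
    have "reg m3 i = j" "reg m3 (Suc i) = N"
      using rel_reg[OF m3(4), of i] rel_reg[OF m3(4), of "Suc i"] wf m3(5) by auto
    then have m4: "pc ?m4 = ?p + 2" "cost ?m4 = cost m3 + 1" using Suc(3) by auto
    have rel4: "rel (setv i j t) ?m4" by (rule rel_tmp[OF m3(4)]) (use rel_reg_less[OF m3(4)] in auto)
    obtain m5 where m5: "reach P ?m4 m5" "pc m5 = ?p + 2 + clen c"
      "cost m5 \<le> cost ?m4 + ctime \<tau> c" "rel sj m5"
      using For(1)[of ?m4 "setv i j t" sj] cd(3) m4 rel4 t(2) wf f_def by auto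
    have vi: "vr sj i = j" "vr sj (Suc i) = N"
      using sem_frame(1)[of c "setv i j t" sj] t(2) wf m3(5) by (auto simp: f_def)
    let ?m6 = "fold xi [Const 100 1, Arith Add i i 100] m5"
    let ?m7 = "xi (Jump ?p) ?m6"
    have "reach P m5 ?m6" by (intro reach_straight) (use cd(4) m5(2) in \<open>auto simp: code_at_Cons\<close>)
    moreover have "reach P ?m6 ?m7"
      by (intro r_into_rtranclp) (use cd(4) m5(2) in \<open>auto simp: reach1_def code_at_Cons\<close>)
    ultimately have r7: "reach P m ?m7" using m3(1) r4 m5(1) by (meson rtranclp_trans)
    have "0 < w" using two_le_w by simp
    then have "take_bit w (Suc 0) = 1" "take_bit w (Suc j) = Suc j"
      using Suc(3) N by (auto intro!: take_bit_nat_eq_self)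
    then have "rel (setv i (Suc j) sj) ?m7"
      by (intro rel_setv[OF m5(4)])
        (use wf vi rel_reg[OF m5(4), of i] rel_reg_less[OF m5(4)] Suc(3) N in auto)
    moreover have "cost ?m7 \<le> cost m + elen e + 3 + Suc j * (ctime \<tau> c + 4)"
      using m3(3) m4(2) m5(3) by simp
    ultimately show ?case using r7 vi(2) by (intro exI[of _ ?m7]) auto
  qed
  obtain m8 where m8: "reach P m m8" "pc m8 = ?p"
      "cost m8 \<le> cost m + elen e + 3 + N * (ctime \<tau> c + 4)" "rel (setv i N sN) m8" "vr sN (Suc i) = N"
    using loop[OF s(3)] by auto
  let ?m9 = "xi (Jump_Less i (Suc i) (?p + 2)) m8"
  let ?m = "xi (Jump ?end) ?m9"
  have "reg m8 i = N" "reg m8 (Suc i) = N"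
    using rel_reg[OF m8(4), of i] rel_reg[OF m8(4), of "Suc i"] wf m8(5) by auto
  then have "pc ?m9 = ?p + 1" using m8(2) by simp
  then have "reach P m8 ?m9" "reach P ?m9 ?m"
    by (intro r_into_rtranclp; use cd(2) m8(2) in \<open>auto simp: reach1_def code_at_Cons\<close>)+
  then have r: "reach P m ?m" using m8(1) by (meson rtranclp_trans)
  moreover have "rel s' ?m" unfolding s(4) by (rule rel_tmp[OF m8(4)]) (use rel_reg_less[OF m8(4)] in auto)
  moreover have "N * (ctime \<tau> c + 4) \<le> b * (ctime \<tau> c + 4)" using s(2) by (rule mult_le_mono1)
  ultimately have "cost ?m \<le> cost m + ctime \<tau> (For i e b c)" using m8(3)
    by (simp only: xi_simps instr_cost.simps ctime.simps)
  with r \<open>rel s' ?m\<close> show ?case by (intro exI[of _ ?m]) auto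
qed

end

section \<open>Filling the random tape\<close>

definition fill_code :: "nat \<Rightarrow> instr list" where
  "fill_code l = [Jump_Less 90 91 (l + 2), Jump (l + 7), Rand 100 3, Store 90 100,
     Const 101 1, Arith Add 90 90 101, Jump l]"

definition whole :: "com \<Rightarrow> com \<Rightarrow> instr list" where
  "whole c1 c2 = ccom 0 c1 @ fill_code (clen c1) @ ccom (clen c1 + 7) c2"

context ram
begin

definition tape :: "nat \<Rightarrow> nat list \<Rightarrow> cfg \<Rightarrow> cfg" where
  "tape j zs s = s\<lparr>vr := (vr s)(90 := 3 * H + j + length zs),
     ar := (ar s)(3 := (\<lambda>i. if j \<le> i \<and> i < j + length zs then zs ! (i - j) else ar s 3 i))\<rparr>"

lemma steps_add: "steps P w k ip \<tau> (t + t') s = bind_pmf (steps P w k ip \<tau> t s) (steps P w k ip \<tau> t')"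
  by (induction t arbitrary: s) (auto simp: bind_return_pmf bind_assoc_pmf intro!: bind_pmf_cong)

lemma steps_halted: "halted P s \<Longrightarrow> steps P w k ip \<tau> t s = return_pmf s"
  by (induction t) (auto simp: step_def bind_return_pmf)

lemma steps_xi:
  assumes "code_at P (pc m) (i # c)" "determ i"
  shows "steps P w k ip \<tau> (Suc t) m = steps P w k ip \<tau> t (xi i m)"
proof -
  have "reach1 P m (xi i m)" using assms by (auto simp: reach1_def code_at_Cons)
  from step_reach1[OF this] show ?thesis by (simp add: bind_return_pmf)
qed

text \<open>Register 90 runs through the addresses of array 3 up to the value of register 91. A
  round takes six instructions, as the test jumps over the exit; one of them is the only draw,
  uniform below register 3, that is, below \<open>H\<close>.\<close>

lemma fill_iteration:
  assumes P: "code_at P l (fill_code l)" and m: "pc m = l" "reg m 3 = H" "reg m 90 = 3 * H + j"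
    "reg m 91 = 3 * H + Q" "j < Q" "Q \<le> H" "rel s m"
  shows "\<exists>g. steps P w k ip \<tau> 6 m = map_pmf g (pmf_of_set {..<H}) \<and>
    (\<forall>x<H. pc (g x) = l \<and> cost (g x) \<le> cost m + 6 \<and> rel (tape j [x] s) (g x))"
proof -
  have P: "code_at P l [Jump_Less 90 91 (l + 2)]" "code_at P (l + 2) [Rand 100 3]"
    "code_at P (l + 3) [Store 90 100]" "code_at P (l + 4) [Const 101 1]"
    "code_at P (l + 5) [Arith Add 90 90 101]" "code_at P (l + 6) [Jump l]"
    using P by (auto simp: fill_code_def code_at_Cons eval_nat_numeral)
  let ?m1 = "xi (Jump_Less 90 91 (l + 2)) m"
  let ?r = "\<lambda>x. (set_reg 100 x ?m1)\<lparr>cost := cost ?m1 + 1\<rparr>"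
  let ?c = "[Store 90 100, Const 101 1, Arith Add 90 90 101]"
  let ?g = "\<lambda>x. xi (Jump l) (fold xi ?c (?r x))"
  have e: "reg m 100 < 2 ^ w" using rel_reg_less[OF m(7)] .
  have pc1: "pc ?m1 = l + 2" using m by simp
  have "steps P w k ip \<tau> 6 m = steps P w k ip \<tau> (Suc 5) m" by simp
  also have "\<dots> = steps P w k ip \<tau> 5 ?m1"
    by (rule steps_xi[of _ _ _ "[]"]) (use P(1) m(1) in simp_all)
  also have "\<dots> = steps P w k ip \<tau> (Suc 4) ?m1" by simp
  also have "\<dots> = bind_pmf (step P w k ip \<tau> ?m1) (steps P w k ip \<tau> 4)"
    by (simp only: steps.simps)
  also have "step P w k ip \<tau> ?m1 = map_pmf ?r (pmf_of_set {..<H})"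
    using P(2) pc1 m(2) H_pos
    by (auto simp: step_def halted_def code_at_Cons pmf.map_comp o_def set_reg_def simp del: xi_simps(23))
  also have "bind_pmf \<dots> (steps P w k ip \<tau> 4) = bind_pmf (pmf_of_set {..<H}) (\<lambda>x. steps P w k ip \<tau> 4 (?r x))"
    by (simp add: bind_map_pmf)
  also have "\<dots> = bind_pmf (pmf_of_set {..<H}) (\<lambda>x. return_pmf (?g x))"
  proof (intro bind_pmf_cong refl)
    fix x
    have pcr: "pc (?r x) = l + 3" using pc1 by (simp add: set_reg_def)
    define m2 where "m2 = ?r x"
    have "steps P w k ip \<tau> (Suc 3) m2 = steps P w k ip \<tau> 3 (xi (Store 90 100) m2)"
      by (rule steps_xi[of _ _ _ "[]"]) (use P(3) pcr in \<open>simp_all add: m2_def\<close>)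
    also have "\<dots> = steps P w k ip \<tau> (Suc 2) (xi (Store 90 100) m2)" by simp
    also have "\<dots> = steps P w k ip \<tau> 2 (xi (Const 101 1) (xi (Store 90 100) m2))"
      by (rule steps_xi[of _ _ _ "[]"]) (use P(4) pcr in \<open>simp_all add: m2_def add.commute\<close>)
    also have "\<dots> = steps P w k ip \<tau> (Suc 1) (xi (Const 101 1) (xi (Store 90 100) m2))" by (simp add: numeral_2_eq_2)
    also have "\<dots> = steps P w k ip \<tau> 1 (xi (Arith Add 90 90 101) (xi (Const 101 1) (xi (Store 90 100) m2)))"
      by (rule steps_xi[of _ _ _ "[]"]) (use P(5) pcr in \<open>simp_all add: m2_def add.commute\<close>)
    also have "\<dots> = steps P w k ip \<tau> (Suc 0) (xi (Arith Add 90 90 101) (xi (Const 101 1) (xi (Store 90 100) m2)))"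
      by simp
    also have "\<dots> = steps P w k ip \<tau> 0 (xi (Jump l) (fold xi ?c m2))"
      by (simp only: fold_simps) (rule steps_xi[of _ _ _ "[]"], use P(6) pcr in \<open>simp_all add: m2_def add.commute\<close>)
    finally have "steps P w k ip \<tau> 4 m2 = return_pmf (?g x)" by (simp add: m2_def)
    then have "steps P w k ip \<tau> 4 (?r x) = return_pmf (?g x)" by (simp only: m2_def)
    then show "steps P w k ip \<tau> 4 (?r x) = return_pmf (?g x)" .
  qed
  finally have "steps P w k ip \<tau> 6 m = map_pmf ?g (pmf_of_set {..<H})"
    by (simp add: map_pmf_def)
  moreover have "pc (?g x) = l \<and> cost (?g x) \<le> cost m + 6 \<and> rel (tape j [x] s) (?g x)"
    if x: "x < H" for x
  proof (intro conjI)
    show "pc (?g x) = l" by simp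
    show "cost (?g x) \<le> cost m + 6" by (simp add: set_reg_def)
    have lt: "4 * H < 2 ^ w" using word H_pos by linarith
    have mem: "mem (?g x) = (mem m)(j + 3 * H := x)" using m(3) by (simp add: set_reg_def add.commute)
    have tb: "take_bit w (Suc 0) = 1" "take_bit w (Suc (3 * H + j)) = Suc (3 * H + j)"
      using two_le_w lt m(5,6) by (auto intro!: take_bit_nat_eq_self)
    have reg: "reg (?g x) = (reg m)(100 := x, 101 := 1, 90 := 3 * H + j + 1)"
      using m(3) tb by (auto simp: set_reg_def fun_eq_iff)
    have eq: "a = j + 3 * H \<longleftrightarrow> a div H = 3 \<and> a mod H = j" for a
          proof -
      have *: "(3::nat) < 16" "j < H" using m(5,6) by auto
      show ?thesis
      proof
        assume "a = j + 3 * H"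
        then show "a div H = 3 \<and> a mod H = j" using address(4,5)[OF *] by simp
      next
        assume "a div H = 3 \<and> a mod H = j"
        then show "a = j + 3 * H" using div_mult_mod_eq[of a H] by simp
      qed
    qed
    have one: "1 < (2::nat) ^ w" using lt H_pos by linarith
    have "(reg (?g x) r = vr (tape j [x] s) r)" if "r < 100" for r
      unfolding reg using that rel_reg[OF m(7)] by (simp add: tape_def)
    moreover have "mem (?g x) a = ar (tape j [x] s) (a div H) (a mod H)" for a
      unfolding mem using eq[of a] rel_mem[OF m(7), of a] by (auto simp: tape_def)
    moreover have "reg (?g x) r < 2 ^ w" for r
      unfolding reg using rel_reg_less[OF m(7), of r] x lt m(5,6) one by auto
    moreover have "mem (?g x) a < 2 ^ w" for a
      unfolding mem using rel_mem_less[OF m(7), of a] x lt by auto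
    ultimately show "rel (tape j [x] s) (?g x)" unfolding rel_def by blast
  qed
  ultimately show ?thesis by (intro exI[of _ ?g]) blast
qed

lemma tape_tape: "tape (Suc j) zs (tape j [x] s) = tape j (x # zs) s"
  by (auto simp: tape_def fun_eq_iff nth_Cons' not_less Suc_le_eq)

text \<open>The state is the image of independent uniform words under a function \<open>g\<close>,
  so that everything about the machine can be stated for a fixed tape.\<close>

lemma fill_loop:
  assumes P: "code_at P l (fill_code l)" and "Q \<le> H" "vr s 3 = H"
  shows "pc m = l \<Longrightarrow> reg m 90 = 3 * H + j \<Longrightarrow> reg m 91 = 3 * H + Q \<Longrightarrow> j + r = Q \<Longrightarrow>
    rel s m \<Longrightarrow> vr s 3 = H \<Longrightarrow> vr s 91 = 3 * H + Q \<Longrightarrow>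
    \<exists>g. steps P w k ip \<tau> (6 * r) m = map_pmf g (replicate_pmf r (pmf_of_set {..<H})) \<and>
    (\<forall>zs. set zs \<subseteq> {..<H} \<and> length zs = r \<longrightarrow>
       pc (g zs) = l \<and> cost (g zs) \<le> cost m + 6 * r \<and> rel (tape j zs s) (g zs))"
proof (induction r arbitrary: m j s)
  case 0
  have "tape j [] s = s"
  proof -
    have "vr s 90 = 3 * H + j" using 0 rel_reg[of s m 90] by simp
    moreover have "(\<lambda>i. if j \<le> i \<and> i < j then [] ! (i - j) else ar s 3 i) = ar s 3" by auto
    ultimately show ?thesis by (simp add: tape_def fun_upd_idem)
  qed
  then show ?case using 0 by (intro exI[of _ "\<lambda>_. m"]) auto
next
  case (Suc r)
  have "reg m 3 = H" using Suc.prems rel_reg[of s m 3] by simp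
  then obtain g where g: "steps P w k ip \<tau> 6 m = map_pmf g (pmf_of_set {..<H})"
    "\<forall>x<H. pc (g x) = l \<and> cost (g x) \<le> cost m + 6 \<and> rel (tape j [x] s) (g x)"
    using fill_iteration[OF P, of m j Q s] Suc.prems assms(2) by auto
  have "\<exists>h. steps P w k ip \<tau> (6 * r) (g x) = map_pmf h (replicate_pmf r (pmf_of_set {..<H})) \<and>
    (\<forall>zs. set zs \<subseteq> {..<H} \<and> length zs = r \<longrightarrow>
       pc (h zs) = l \<and> cost (h zs) \<le> cost (g x) + 6 * r \<and> rel (tape (Suc j) zs (tape j [x] s)) (h zs))"
    if "x < H" for x
  proof (rule Suc.IH)
    show "reg (g x) 90 = 3 * H + Suc j" "reg (g x) 91 = 3 * H + Q"
      using g(2) that rel_reg[of "tape j [x] s" "g x"] Suc.prems(7) by (auto simp: tape_def)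
  qed (use g(2) that Suc.prems in \<open>auto simp: tape_def\<close>)
  then obtain h where h: "\<And>x. x < H \<Longrightarrow>
      steps P w k ip \<tau> (6 * r) (g x) = map_pmf (h x) (replicate_pmf r (pmf_of_set {..<H}))"
    "\<And>x zs. x < H \<Longrightarrow> set zs \<subseteq> {..<H} \<and> length zs = r \<Longrightarrow>
       pc (h x zs) = l \<and> cost (h x zs) \<le> cost (g x) + 6 * r \<and> rel (tape j (x # zs) s) (h x zs)"
    unfolding tape_tape by metis
  have "steps P w k ip \<tau> (6 * Suc r) m = bind_pmf (steps P w k ip \<tau> 6 m) (steps P w k ip \<tau> (6 * r))"
    using steps_add[of P 6 "6 * r" m] by (simp add: algebra_simps)
  also have "\<dots> = bind_pmf (pmf_of_set {..<H}) (\<lambda>x. steps P w k ip \<tau> (6 * r) (g x))"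
    by (simp add: g(1) bind_map_pmf)
  also have "\<dots> = bind_pmf (pmf_of_set {..<H}) (\<lambda>x. map_pmf (h x) (replicate_pmf r (pmf_of_set {..<H})))"
    using H_pos by (intro bind_pmf_cong refl h(1)) (auto simp: lessThan_empty_iff)
  also have "\<dots> = map_pmf (\<lambda>zs. h (hd zs) (tl zs)) (replicate_pmf (Suc r) (pmf_of_set {..<H}))"
    by (simp add: map_pmf_def bind_assoc_pmf bind_return_pmf)
  finally have "steps P w k ip \<tau> (6 * Suc r) m = \<dots>" .
  moreover have "pc (h (hd zs) (tl zs)) = l \<and> cost (h (hd zs) (tl zs)) \<le> cost m + 6 * Suc r \<and>
      rel (tape j zs s) (h (hd zs) (tl zs))" if zs0: "set zs \<subseteq> {..<H} \<and> length zs = Suc r" for zs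
  proof -
    obtain x xs where zs: "zs = x # xs" using zs0 by (cases zs) auto
    then show ?thesis using h(2)[of x xs] g(2) zs0 by fastforce
  qed
  ultimately show ?case by (intro exI[of _ "\<lambda>zs. h (hd zs) (tl zs)"]) blast
qed

text \<open>Randomness enters between two deterministic commands. Hence the distribution of final
  states is the image of the uniform distribution on tapes, and the halting time and the result
  \<open>G\<close> may be verified tape by tape.\<close>

theorem whole_correct:
  assumes c1: "sem c1 s0 = Some s1" "wf_com c1" and c2: "wf_com c2"
    and s1: "vr s1 3 = H" "vr s1 90 = 3 * H" "vr s1 91 = 3 * H + Q" "Q \<le> H"
    and run: "\<And>zs. set zs \<subseteq> {..<H} \<Longrightarrow> length zs = Q \<Longrightarrow> \<exists>s2. sem c2 (tape 0 zs s1) = Some s2 \<and> G zs s2"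
    and m: "rel s0 m" "pc m = 0" "cost m = 0"
    and t: "ctime \<tau> c1 + 6 * Q + 2 + ctime \<tau> c2 \<le> t"
  shows "\<exists>g. steps (whole c1 c2) w k ip \<tau> t m = map_pmf g (replicate_pmf Q (pmf_of_set {..<H})) \<and>
    (\<forall>zs. set zs \<subseteq> {..<H} \<and> length zs = Q \<longrightarrow>
       halted (whole c1 c2) (g zs) \<and> cost (g zs) \<le> t \<and> (\<exists>s2. G zs s2 \<and> rel s2 (g zs)))"
proof -
  let ?P = "whole c1 c2" and ?l = "clen c1"
  have "code_at ?P 0 (ccom 0 c1) \<and> code_at ?P ?l (fill_code ?l) \<and> code_at ?P (?l + 7) (ccom (?l + 7) c2) \<and>
    code_at ?P (?l + 7 + clen c2) []"
    by (rule code_at_split) (auto simp: whole_def fill_code_def code_at_def)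
  then have P: "code_at ?P 0 (ccom 0 c1)" "code_at ?P ?l (fill_code ?l)"
    "code_at ?P (?l + 7) (ccom (?l + 7) c2)" by blast+
  have len: "length ?P = ?l + 7 + clen c2" by (simp add: whole_def fill_code_def)
  obtain m1 where m1: "reach ?P m m1" "pc m1 = ?l" "cost m1 \<le> ctime \<tau> c1" "rel s1 m1"
    using com_correct[of ?P m c1 s0 s1] P(1) c1 m by auto
  obtain t1 where t1: "t1 \<le> cost m1" "steps ?P w k ip \<tau> t1 m = return_pmf m1"
    using steps_reach[OF m1(1)] m(3) by auto
  have "\<exists>g. steps ?P w k ip \<tau> (6 * Q) m1 = map_pmf g (replicate_pmf Q (pmf_of_set {..<H})) \<and>
    (\<forall>zs. set zs \<subseteq> {..<H} \<and> length zs = Q \<longrightarrow>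
       pc (g zs) = ?l \<and> cost (g zs) \<le> cost m1 + 6 * Q \<and> rel (tape 0 zs s1) (g zs))"
    using fill_loop[OF P(2) s1(4,1), of m1 0 Q] m1 s1 rel_reg[OF m1(4)] by auto
  then obtain g where g: "steps ?P w k ip \<tau> (6 * Q) m1 = map_pmf g (replicate_pmf Q (pmf_of_set {..<H}))"
    "\<And>zs. set zs \<subseteq> {..<H} \<Longrightarrow> length zs = Q \<Longrightarrow>
       pc (g zs) = ?l \<and> cost (g zs) \<le> cost m1 + 6 * Q \<and> rel (tape 0 zs s1) (g zs)" by blast
  define t2 where "t2 = t - t1 - 6 * Q"
  have t2: "t = t1 + (6 * Q + t2)" "2 + ctime \<tau> c2 \<le> t2" "cost m1 + 6 * Q + 2 + ctime \<tau> c2 \<le> t"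
    using t t1(1) m1(3) unfolding t2_def by linarith+
  have "\<exists>m3. steps ?P w k ip \<tau> t2 (g zs) = return_pmf m3 \<and> halted ?P m3 \<and> cost m3 \<le> t \<and>
    (\<exists>s2. G zs s2 \<and> rel s2 m3)" if zs: "set zs \<subseteq> {..<H}" "length zs = Q" for zs
  proof -
    obtain s2 where s2: "sem c2 (tape 0 zs s1) = Some s2" "G zs s2" using run[OF zs] by blast
    note gz = g(2)[OF zs]
    let ?m1 = "xi (Jump_Less 90 91 (?l + 2)) (g zs)"
    let ?m2 = "xi (Jump (?l + 7)) ?m1"
    have eq: "reg (g zs) 90 = 3 * H + Q" "reg (g zs) 91 = 3 * H + Q"
      using rel_reg[of "tape 0 zs s1" "g zs"] gz s1 zs by (auto simp: tape_def)
    have "reach ?P (g zs) ?m1" using gz P(2)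
      by (intro r_into_rtranclp) (auto simp: reach1_def code_at_Cons fill_code_def)
    moreover have "reach ?P ?m1 ?m2" using gz P(2) eq
      by (intro r_into_rtranclp) (auto simp: reach1_def code_at_Cons fill_code_def)
    moreover have "rel (tape 0 zs s1) ?m2"
      by (rule rel_tmp[of _ "g zs"]) (use gz rel_reg_less in auto)
    then obtain m3 where m3: "reach ?P ?m2 m3" "pc m3 = ?l + 7 + clen c2"
      "cost m3 \<le> cost ?m2 + ctime \<tau> c2" "rel s2 m3"
      using com_correct[of ?P ?m2 c2 "tape 0 zs s1" s2] P(3) c2 s2 by auto
    ultimately have "reach ?P (g zs) m3" by (meson rtranclp_trans)
    then obtain t3 where t3: "t3 + cost (g zs) \<le> cost m3" "steps ?P w k ip \<tau> t3 (g zs) = return_pmf m3"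
      using steps_reach by blast
    have h: "halted ?P m3" using m3(2) len by (simp add: halted_def)
    \<comment> \<open>The surplus steps idle in the halted state.\<close>
    have "t3 \<le> t2" using t3(1) m3(3) t2(2) by simp
    then have "steps ?P w k ip \<tau> t2 (g zs) = return_pmf m3"
      using steps_add[of ?P t3 "t2 - t3" "g zs"] t3(2) steps_halted[OF h] by (simp add: bind_return_pmf)
    moreover have "cost m3 \<le> t" using m3(3) gz t2(3) by simp
    ultimately show ?thesis using h s2(2) m3(4) by blast
  qed
  then obtain f where f: "\<And>zs. set zs \<subseteq> {..<H} \<Longrightarrow> length zs = Q \<Longrightarrow>
    steps ?P w k ip \<tau> t2 (g zs) = return_pmf (f zs) \<and> halted ?P (f zs) \<and> cost (f zs) \<le> t \<and>
    (\<exists>s2. G zs s2 \<and> rel s2 (f zs))" by metis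
  have "steps ?P w k ip \<tau> t m = bind_pmf (map_pmf g (replicate_pmf Q (pmf_of_set {..<H}))) (steps ?P w k ip \<tau> t2)"
    by (simp add: t2(1) steps_add t1(2) bind_return_pmf g(1))
  also have "\<dots> = bind_pmf (replicate_pmf Q (pmf_of_set {..<H})) (\<lambda>zs. return_pmf (f zs))"
    unfolding bind_map_pmf
    using f H_pos by (intro bind_pmf_cong) (auto simp: set_replicate_pmf lessThan_empty_iff lists_eq_set)
  finally have "steps ?P w k ip \<tau> t m = map_pmf f (replicate_pmf Q (pmf_of_set {..<H}))"
    by (simp add: map_pmf_def)
  then show ?thesis using f by blast
qed

end

section \<open>The program\<close>

abbreviation Plus (infixl "+." 65) where "a +. b \<equiv> Op Add a b"
abbreviation Minus (infixl "-." 65) where "a -. b \<equiv> Op Sub a b"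
abbreviation Times (infixl "*." 70) where "a *. b \<equiv> Op Mul a b"
abbreviation DivE (infixl "\<div>" 70) where "a \<div> b \<equiv> Op Div a b"
abbreviation ModE (infixl "%." 70) where "a %. b \<equiv> Op Mod a b"

text \<open>The language has no conditional, so truth values are numbers: with truncated
  subtraction, \<open>1 - (1 - x)\<close> tells whether \<open>x\<close> is nonzero.\<close>

definition ne :: "exp \<Rightarrow> exp \<Rightarrow> exp" where "ne a b = C 1 -. (C 1 -. ((a -. b) +. (b -. a)))"
definition ls :: "exp \<Rightarrow> exp \<Rightarrow> exp" where "ls a b = C 1 -. (C 1 -. (b -. a))"
definition leq :: "exp \<Rightarrow> exp \<Rightarrow> exp" where "leq a b = C 1 -. (a -. b)"
definition mn :: "exp \<Rightarrow> exp \<Rightarrow> exp" where "mn a b = a -. (a -. b)"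

lemma eval_defs [simp]:
  "eval (ne a b) s = of_bool (eval a s \<noteq> eval b s)"
  "eval (ls a b) s = of_bool (eval a s < eval b s)"
  "eval (leq a b) s = of_bool (eval a s \<le> eval b s)"
  "eval (mn a b) s = min (eval a s) (eval b s)"
  by (auto simp: ne_def ls_def leq_def mn_def)

lemma evars_defs [simp]:
  "evars (ne a b) = evars a \<union> evars b" "evars (ls a b) = evars a \<union> evars b"
  "evars (leq a b) = evars a \<union> evars b" "evars (mn a b) = evars a \<union> evars b"
  by (auto simp: ne_def ls_def leq_def mn_def)

lemma elen_defs [simp]:
  "elen (ne a b) = 2 * elen a + 2 * elen b + 7" "elen (ls a b) = elen a + elen b + 5"
  "elen (leq a b) = elen a + elen b + 3" "elen (mn a b) = 2 * elen a + elen b + 2"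
  by (auto simp: ne_def ls_def leq_def mn_def)

section \<open>Weakest preconditions\<close>

context ram
begin

lemma one_less: "1 < (2::nat) ^ w"
  using word H_pos by linarith

lemma safe_defs:
  "safe (ne a b) s \<longleftrightarrow> safe a s \<and> safe b s \<and> (eval a s - eval b s) + (eval b s - eval a s) < 2 ^ w \<and>
     eval a s - eval b s < 2 ^ w \<and> eval b s - eval a s < 2 ^ w"
  "safe (ls a b) s \<longleftrightarrow> safe a s \<and> safe b s \<and> eval b s - eval a s < 2 ^ w"
  "safe (leq a b) s \<longleftrightarrow> safe a s \<and> safe b s \<and> eval a s - eval b s < 2 ^ w"
  "safe (mn a b) s \<longleftrightarrow> safe a s \<and> safe b s \<and> eval a s - eval b s < 2 ^ w \<and> min (eval a s) (eval b s) < 2 ^ w"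
  using one_less by (auto simp: ne_def ls_def leq_def mn_def min_def)

lemma safe_neI: "safe a s \<Longrightarrow> safe b s \<Longrightarrow> eval a s < 2 ^ w \<Longrightarrow> eval b s < 2 ^ w \<Longrightarrow> safe (ne a b) s"
  unfolding safe_defs by auto

lemma safe_lsI: "safe a s \<Longrightarrow> safe b s \<Longrightarrow> eval b s < 2 ^ w \<Longrightarrow> safe (ls a b) s"
  unfolding safe_defs by auto

lemma safe_mnI: "safe a s \<Longrightarrow> safe b s \<Longrightarrow> eval a s < 2 ^ w \<Longrightarrow> safe (mn a b) s"
  unfolding safe_defs by auto

definition wp :: "com \<Rightarrow> (cfg \<Rightarrow> bool) \<Rightarrow> cfg \<Rightarrow> bool" where
  "wp c Q s \<longleftrightarrow> (\<exists>s'. sem c s = Some s' \<and> Q s')"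

definition frame :: "com \<Rightarrow> cfg \<Rightarrow> cfg \<Rightarrow> bool" where
  "frame c s s' \<longleftrightarrow> (\<forall>v. v \<notin> writes c \<longrightarrow> vr s' v = vr s v) \<and> (\<forall>a. a \<notin> stores c \<longrightarrow> ar s' a = ar s a)"

lemma frame_vr: "frame c s s' \<Longrightarrow> v \<notin> writes c \<Longrightarrow> vr s' v = vr s v"
  by (auto simp: frame_def)

lemma sem_frame': "sem c s = Some s' \<Longrightarrow> frame c s s'"
  using sem_frame by (auto simp: frame_def)

lemma wp_conseq: "wp c Q s \<Longrightarrow> (\<And>s'. Q s' \<Longrightarrow> frame c s s' \<Longrightarrow> Q' s') \<Longrightarrow> wp c Q' s"
  using sem_frame' by (auto simp: wp_def)

lemma wp_Asg: "safe e s \<Longrightarrow> Q (setv r (eval e s) s) \<Longrightarrow> wp (Asg r e) Q s"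
  by (simp add: wp_def)

lemma wp_Sto: "safe i s \<Longrightarrow> safe e s \<Longrightarrow> a < 16 \<Longrightarrow> vr s 3 = H \<Longrightarrow> eval i s < H \<Longrightarrow>
  Q (seta a (eval i s) (eval e s) s) \<Longrightarrow> wp (Sto a i e) Q s"
  by (simp add: wp_def)

lemma wp_Asg_eq: "safe e s \<and> eval e s = x \<Longrightarrow> Q (setv r x s) \<Longrightarrow> wp (Asg r e) Q s"
  by (auto simp: wp_def)

lemma wp_Sto_eq: "safe i s \<and> safe e s \<and> eval i s = j \<and> eval e s = x \<Longrightarrow> a < 16 \<Longrightarrow> vr s 3 = H \<Longrightarrow> j < H \<Longrightarrow>
  Q (seta a j x s) \<Longrightarrow> wp (Sto a i e) Q s"
  by (auto simp: wp_def)

lemma wp_Seq: "wp c (wp c' Q) s \<Longrightarrow> wp (c ;; c') Q s"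
  by (auto simp: wp_def)

text \<open>The body is given the frame of the whole loop relative to the initial state, so an
  invariant need only mention what the loop changes.\<close>

lemma wp_For:
  assumes e: "safe e s" "eval e s = m" "m \<le> b"
    and I0: "I 0 (setv (Suc i) m s)"
    and step: "\<And>j s'. j < m \<Longrightarrow> I j s' \<Longrightarrow> frame (For i e b c) s s' \<Longrightarrow> wp c (I (Suc j)) (setv i j s')"
    and Q: "\<And>s'. I m s' \<Longrightarrow> frame (For i e b c) s s' \<Longrightarrow> Q (setv i m s')"
  shows "wp (For i e b c) Q s"
proof -
  have "\<exists>s'. iter j (\<lambda>j s. sem c (setv i j s)) (setv (Suc i) m s) = Some s' \<and> I j s' \<and> frame (For i e b c) s s'"
    if "j \<le> m" for j
    using that
  proof (induction j)
    case 0
    show ?case using I0 by (auto simp: frame_def)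
  next
    case (Suc j)
    then obtain s1 where s1: "iter j (\<lambda>j s. sem c (setv i j s)) (setv (Suc i) m s) = Some s1" "I j s1"
      "frame (For i e b c) s s1" by auto
    then obtain s2 where s2: "sem c (setv i j s1) = Some s2" "I (Suc j) s2"
      using step[of j s1] Suc.prems by (auto simp: wp_def)
    have "frame (For i e b c) s s2" using s1(3) sem_frame'[OF s2(1)] by (auto simp: frame_def)
    then show ?case using s1 s2 by auto
  qed
  from this[of m] obtain s' where "iter m (\<lambda>j s. sem c (setv i j s)) (setv (Suc i) m s) = Some s'" "I m s'"
    "frame (For i e b c) s s'" by auto
  then show ?thesis using e Q by (auto simp: wp_def)
qed

text \<open>Accumulation loops are given an exact final state, so that they can be rewritten with.\<close>

lemma wp_sum:
  assumes e: "safe e s" "eval e s = m" "m \<le> b" and c: "c \<noteq> i" "c \<noteq> Suc i"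
    and x: "\<And>j s'. j < m \<Longrightarrow> ar s' = ar s \<Longrightarrow> vr s' i = j \<Longrightarrow> (\<And>v. v \<notin> {i, Suc i, c} \<Longrightarrow> vr s' v = vr s v) \<Longrightarrow>
      safe x s' \<and> eval x s' = F j"
    and lt: "vr s c + (\<Sum>j<m. F j) < 2 ^ w"
    and Q: "Q (setv i m (setv c (vr s c + (\<Sum>j<m. F j)) (setv (Suc i) m s)))"
  shows "wp (For i e b (Asg c (V c +. x))) Q s"
proof -
  let ?I = "\<lambda>j s'. vr s' c = vr s c + (\<Sum>j<j. F j) \<and> vr s' (Suc i) = m"
  show ?thesis
  proof (rule wp_For[where I = ?I, OF e])
    show "?I 0 (setv (Suc i) m s)" using c by simp
  next
    fix j s' assume j: "j < m" and I: "?I j s'" and fr: "frame (For i e b (Asg c (V c +. x))) s s'"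
    have "safe x (setv i j s') \<and> eval x (setv i j s') = F j"
      using fr j c by (intro x) (auto simp: frame_def)
    moreover have "(\<Sum>j<Suc j. F j) \<le> (\<Sum>j<m. F j)" using j by (intro sum_mono2) auto
    then have "vr s c + (\<Sum>j<j. F j) + F j < 2 ^ w" using lt by simp
    ultimately show "wp (Asg c (V c +. x)) (?I (Suc j)) (setv i j s')"
      using c I by (intro wp_Asg) auto
  next
    fix s' assume I: "?I m s'" and fr: "frame (For i e b (Asg c (V c +. x))) s s'"
    have "setv i m s' = setv i m (setv c (vr s c + (\<Sum>j<m. F j)) (setv (Suc i) m s))"
      using fr I by (auto simp: frame_def setv_def intro!: cfg.equality)
    then show "Q (setv i m s')" using Q by simp
  qed
qed

end

text \<open>
  Registers 0 to 9 hold \<open>n\<close>, \<open>d\<close>, \<open>k\<close>, \<open>H\<close>, \<open>K = 2 ^ k\<close>, \<open>t\<close>, \<open>b\<close>, the number \<open>N\<close> of trials, the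
  number \<open>L\<close> of random words per trial, and \<open>K * t\<close>. The arrays are: 0 the input, 1 the binary
  expansions of all codes below \<open>K\<close>, 2 the table of inner products, 3 the random words, 4 the \<open>K + 1\<close>
  centers, one scratch cell and the sampled columns, 5 the distances to the centers, 6 the weights, 7 and
  8 the codes found by every trial, 9 and 10 the output.
\<close>

definition SEL :: "nat \<Rightarrow> com" where
  "SEL d = Asg 40 (C 0) ;; For 24 (V 1) d (Asg 40 (V 40 +. Ar 5 (V 24))) ;;
     Asg 43 (V 43 %. V 40) ;; Asg 41 (C 0) ;; Asg 51 (C 0) ;;
     For 24 (V 1) d (Asg 41 (V 41 +. Ar 5 (V 24)) ;; Asg 51 (V 51 +. leq (V 41) (V 43))) ;;
     Asg 51 (V 51 %. V 1)"

text \<open>Only the newest center, in register 51, is compared: a further center changes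
  \<open>rad\<close> into a minimum with the old value.\<close>

definition UPD :: "nat \<Rightarrow> nat \<Rightarrow> com" where
  "UPD n d = For 24 (V 1) d (Asg 44 (C 0) ;;
     For 26 (V 0) n (Asg 44 (V 44 +. ne (Ar 0 (V 26 *. V 1 +. V 24)) (Ar 0 (V 26 *. V 1 +. V 51)))) ;;
     Sto 5 (V 24) (mn (V 44) (Ar 5 (V 24))))"

text \<open>A conditional assignment without a branch. The truncated difference
  \<open>x - bx\<close> is exact because \<open>x\<close> is a loop counter and never smaller than
  the index stored before.\<close>

definition argmin :: "nat \<Rightarrow> nat \<Rightarrow> nat \<Rightarrow> nat \<Rightarrow> com" where
  "argmin x c best bx = Asg bx (V bx +. (V x -. V bx) *. ls (V c) (V best)) ;; Asg best (mn (V best) (V c))"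

definition PHASE1 :: "nat \<Rightarrow> nat \<Rightarrow> nat \<Rightarrow> com" where
  "PHASE1 n d K = For 22 (V 1) d (Sto 5 (V 22) (V 0)) ;; Sto 4 (C 0) (C 0) ;; Asg 51 (C 0) ;; UPD n d ;;
     For 22 (V 4) K (Asg 43 (Ar 3 (V 52 +. V 22)) ;; SEL d ;; Sto 4 (V 22 +. C 1) (V 51) ;; UPD n d)"

definition WEIGHTS :: "nat \<Rightarrow> nat \<Rightarrow> com" where
  "WEIGHTS K b = For 22 (V 4) K (Asg 43 (Ar 3 (V 52 +. (V 4 +. V 22))) ;; Asg 50 (C 1) ;;
     For 24 (V 43 %. V 6) b (Asg 50 (V 50 +. V 50)) ;; Sto 6 (V 22) (V 43 \<div> V 6 %. V 50))"

text \<open>The fresh column is always computed and put into the scratch cell \<open>K + 1\<close>,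
  right behind the centers; the choice made by \<open>slot\<close> is then a single array
  access.\<close>

definition SLOTS :: "nat \<Rightarrow> nat \<Rightarrow> com" where
  "SLOTS d Kt = For 22 (V 9) Kt (Asg 43 (Ar 3 (V 52 +. (V 4 +. V 4 +. V 22))) ;;
     Asg 54 (V 43 %. (V 4 +. C 2)) ;; Asg 43 (V 43 \<div> (V 4 +. C 2)) ;; SEL d ;;
     Sto 4 (V 4 +. C 1) (V 51) ;; Sto 4 (V 4 +. C 2 +. V 22) (Ar 4 (V 54)))"

text \<open>Register 3, that is \<open>H\<close>, serves as the initial minimum: it exceeds every
  score.\<close>

definition ROWS :: "nat \<Rightarrow> nat \<Rightarrow> nat \<Rightarrow> com" where
  "ROWS n K Kt = For 22 (V 0) n (Asg 45 (V 3) ;; Asg 46 (C 0) ;;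
     For 24 (V 4) K ((Asg 44 (C 0) ;;
       For 26 (V 9) Kt (Asg 44 (V 44 +. Ar 6 (V 26 \<div> V 5) *.
         ne (Ar 0 (V 22 *. V 1 +. Ar 4 (V 4 +. C 2 +. V 26))) (Ar 2 (V 24 *. V 4 +. V 26 \<div> V 5))))) ;;
       argmin 24 44 45 46) ;;
     Sto 7 (V 20 *. V 0 +. V 22) (V 46))"

text \<open>Register 47 accumulates the exact cost of the trial, by which the trials are compared
  afterwards.\<close>

definition COLS :: "nat \<Rightarrow> nat \<Rightarrow> nat \<Rightarrow> com" where
  "COLS n d K = Asg 47 (C 0) ;; For 22 (V 1) d (Asg 45 (V 3) ;; Asg 46 (C 0) ;;
     For 24 (V 4) K ((Asg 44 (C 0) ;;
       For 26 (V 0) n (Asg 44 (V 44 +.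
         ne (Ar 0 (V 26 *. V 1 +. V 22)) (Ar 2 (Ar 7 (V 20 *. V 0 +. V 26) *. V 4 +. V 24))))) ;;
       argmin 24 44 45 46) ;;
     Sto 8 (V 20 *. V 1 +. V 22) (V 46) ;; Asg 47 (V 47 +. V 45))"

definition TRIAL :: "nat \<Rightarrow> nat \<Rightarrow> nat \<Rightarrow> nat \<Rightarrow> nat \<Rightarrow> com" where
  "TRIAL n d K Kt b = Asg 52 (V 20 *. V 8) ;; PHASE1 n d K ;; WEIGHTS K b ;; SLOTS d Kt ;; ROWS n K Kt ;; COLS n d K"

text \<open>\<open>H\<close> is the array length, the range of the random words and the bound on
  counts and indices; being a product of the parameters, it can be computed by the program. The
  choice of \<open>b\<close> makes \<open>2 ^ (b - 1)\<close> at least four times any cluster size,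
  as \<open>prob_weight\<close> requires.\<close>

locale prog = ram w k ip \<tau> H + clustering n d K A Z us vs
  for w k ip \<tau> H n d K A Z us vs +
  fixes t b N L q :: nat
  assumes K_eq: "K = 2 ^ k" and q_pos: "0 < q" and dn: "d \<le> n" and t_eq: "t = 3072 * q\<^sup>2 * K\<^sup>2"
    and b_eq: "b = Suc (LEAST m. 4 * d \<le> 2 ^ m)"
    and N_eq: "N = (1280 * K\<^sup>2 * q) ^ (K * t + K) * b ^ K" and L_eq: "L = K + (K + K * t)"
    and H_eq: "H = 4 * (N * (n * (d * (t * (K * K)))))"
    and A01: "\<And>i j. A i j \<le> 1" and Z012: "\<And>x y. Z x y \<le> 2"
begin

lemma n_pos: "0 < n" using d_pos dn by simp
lemma K_pos: "0 < K" using K_ge2 by simp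
lemma t_ge: "3072 * K \<le> t"
proof -
  have "1 * 1 \<le> q * q" "K * 1 \<le> K * K" using q_pos K_pos by (intro mult_le_mono; simp)+
  then have "1 * K \<le> q\<^sup>2 * K\<^sup>2" unfolding power2_eq_square by (intro mult_le_mono) auto
  then show ?thesis unfolding t_eq by simp
qed
lemma t_pos: "0 < t" using t_ge K_pos by simp

lemma two_pow_b: "4 * d \<le> 2 ^ (b - 1)" "2 ^ (b - 1) < 8 * d"
proof -
  let ?P = "\<lambda>m. 4 * d \<le> 2 ^ m"
  have ex: "?P (4 * d)" using less_exp[of "4 * d"] by simp
  then show "4 * d \<le> 2 ^ (b - 1)" unfolding b_eq using LeastI[of ?P, OF ex] by simp
  show "2 ^ (b - 1) < 8 * d"
  proof (cases "(LEAST m. ?P m)")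
    case 0
    then show ?thesis using d_pos by (simp add: b_eq)
  next
    case (Suc m)
    then have "\<not> ?P m" using not_less_Least[of m ?P] by simp
    then show ?thesis using Suc by (simp add: b_eq)
  qed
qed

lemma b_pos: "0 < b" by (simp add: b_eq)

lemma N_ge: "1280 \<le> N" "b \<le> N"
proof -
  define x where "x = (1280 * K\<^sup>2 * q) ^ (K * t + K)"
  have N: "N = x * b ^ K" by (simp only: N_eq x_def)
  have "1280 * 1 * 1 \<le> 1280 * K\<^sup>2 * q" using K_pos q_pos by (intro mult_le_mono) auto
  then have y: "1280 \<le> 1280 * K\<^sup>2 * q" by linarith
  also have "\<dots> = (1280 * K\<^sup>2 * q) ^ 1" by (rule power_one_right[symmetric])
  also have "\<dots> \<le> x" unfolding x_def using y K_pos by (intro power_increasing) linarith+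
  finally have x: "1280 \<le> x" .
  have "b ^ 1 \<le> b ^ K" using b_pos K_pos by (intro power_increasing) linarith+
  then have bK: "b \<le> b ^ K" by (simp only: power_one_right)
  have "1280 * 1 \<le> x * b ^ K" using x b_pos bK by (intro mult_le_mono) linarith+
  then show "1280 \<le> N" unfolding N by simp
  have "1 * b \<le> x * b ^ K" using x bK by (intro mult_le_mono) linarith+
  then show "b \<le> N" unfolding N by simp
qed

lemma N_pos: "0 < N" using N_ge by simp

text \<open>Everything the program stores or computes is bounded by a product of a few of the factors of \<open>H\<close>.\<close>

lemma le_H:
  assumes "a0 \<le> 4" "a1 \<le> N" "a2 \<le> n" "a3 \<le> d" "a4 \<le> t" "a5 \<le> K" "a6 \<le> K"
  shows "a0 * (a1 * (a2 * (a3 * (a4 * (a5 * a6))))) \<le> H"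
  unfolding H_eq using assms by (intro mult_le_mono)

lemma H_word: "x < H \<Longrightarrow> x < 2 ^ w" "x \<le> H \<Longrightarrow> x < 2 ^ w"
  using word H_pos by linarith+

lemma nd_H: "n * d < H"
proof -
  have "4 * (1 * (n * (d * (1 * (1 * 1))))) \<le> H" using N_pos t_pos K_pos by (intro le_H) auto
  moreover have "0 < n * d" using n_pos d_pos by simp
  ultimately show ?thesis by linarith
qed

lemma A_idx: "i < n \<Longrightarrow> j < d \<Longrightarrow> i * d + j < n * d"
proof -
  assume "i < n" "j < d"
  then have "(i + 1) * d \<le> n * d" by (intro mult_le_mono1) simp
  moreover have "(i + 1) * d = i * d + d" by simp
  ultimately show ?thesis using \<open>j < d\<close> by linarith
qed

lemma A_addr: "i < n \<Longrightarrow> j < d \<Longrightarrow> i * d + j < H" "i < n \<Longrightarrow> i * d < H"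
  using A_idx[of i j] A_idx[of i 0] nd_H d_pos by linarith+

lemma small: "n < H" "d < H" "K < H" "t < H" "K * t < H" "b < H" "K + 2 + K * t < H" "K * K < H" "K + 2 < H"
proof -
  have *: "4 * (1 * (1 * (1 * (t * (K * 1))))) \<le> H" "4 * (1 * (1 * (1 * (1 * (K * K))))) \<le> H"
     "4 * (N * (1 * (1 * (1 * (1 * 1))))) \<le> H"
    using N_pos n_pos d_pos t_pos K_pos by (intro le_H; simp)+
  have "n * 1 \<le> n * d" "1 * d \<le> n * d" using n_pos d_pos by (intro mult_le_mono; simp)+
  then show "n < H" "d < H" using nd_H by linarith+
  have **: "1 * K \<le> K * K" "K * 1 \<le> K * t" "1 * t \<le> K * t" using K_pos t_pos by (intro mult_le_mono; simp)+
  have "0 < K * t" "0 < K * K" using K_pos t_pos by auto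
  then have 3: "4 * (K * t) \<le> H" "4 * (K * K) \<le> H" using * by (simp_all add: mult_ac)
  then show "K * t < H" "K * K < H" using \<open>0 < K * t\<close> \<open>0 < K * K\<close> by linarith+
  then show "K < H" "t < H" using ** by linarith+
  show "b < H" using * N_ge by simp
  show "K + 2 < H" "K + 2 + K * t < H" using 3 ** K_ge2 \<open>0 < K * t\<close> by linarith+
qed

lemma idx: "j < d \<Longrightarrow> j < H" "i < n \<Longrightarrow> i < H" "x < K \<Longrightarrow> x < H" "s < K * t \<Longrightarrow> s < H"
  using small by linarith+

lemmas idxw = idx[THEN H_word(1)] A_addr[THEN H_word(1)]

lemmas words = small[THEN H_word(1)]

declare One_nat_def [simp del]

section \<open>Environment of the program and its basic loops\<close>

definition env :: "cfg \<Rightarrow> bool" where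
  "env s \<longleftrightarrow> vr s 0 = n \<and> vr s 1 = d \<and> vr s 2 = k \<and> vr s 3 = H \<and> vr s 4 = K \<and> vr s 5 = t \<and>
     vr s 6 = b \<and> vr s 7 = N \<and> vr s 8 = L \<and> vr s 9 = K * t \<and>
     (\<forall>i<n. \<forall>j<d. ar s 0 (i * d + j) = A i j)"

lemma env_vr: "env s \<Longrightarrow> vr s 0 = n" "env s \<Longrightarrow> vr s 1 = d" "env s \<Longrightarrow> vr s 2 = k" "env s \<Longrightarrow> vr s 3 = H"
  "env s \<Longrightarrow> vr s 4 = K" "env s \<Longrightarrow> vr s 5 = t" "env s \<Longrightarrow> vr s 6 = b" "env s \<Longrightarrow> vr s 7 = N"
  "env s \<Longrightarrow> vr s 8 = L" "env s \<Longrightarrow> vr s 9 = K * t" "env s \<Longrightarrow> i < n \<Longrightarrow> j < d \<Longrightarrow> ar s 0 (i * d + j) = A i j"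
  by (auto simp: env_def)

lemma env_setv: "9 < r \<Longrightarrow> env (setv r x s) \<longleftrightarrow> env s"
  by (auto simp: env_def)

lemma env_seta: "0 < a \<Longrightarrow> env (seta a i x s) \<longleftrightarrow> env s"
  by (auto simp: env_def)

lemma env_frame: "frame c s s' \<Longrightarrow> writes c \<inter> {..9} = {} \<Longrightarrow> 0 \<notin> stores c \<Longrightarrow> env s \<Longrightarrow> env s'"
proof -
  assume fr: "frame c s s'" and w: "writes c \<inter> {..9} = {}" and st: "0 \<notin> stores c" and env: "env s"
  have "v \<notin> writes c" if "v \<le> 9" for v using w that by auto
  then show "env s'" using fr st env unfolding frame_def env_def by auto
qed

lemma writes_stores:
  "writes (SEL d') = {40, 41, 43, 51, 24, 25}" "stores (SEL d') = {}"
  "writes (UPD n' d') = {24, 25, 26, 27, 44}" "stores (UPD n' d') = {5}"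
  by (auto simp: SEL_def UPD_def)

lemma wp_SEL:
  assumes env: "env s" and r: "\<And>j. j < d \<Longrightarrow> ar s 5 j = r j" "\<And>j. j < d \<Longrightarrow> r j \<le> n" and z: "vr s 43 < H"
  shows "wp (SEL d) (\<lambda>s'. vr s' 51 = sel d r (vr s 43)) s"
proof -
  have R: "(\<Sum>j<m. r j) < 2 ^ w" if "m \<le> d" for m
  proof -
    have "(\<Sum>j<m. r j) \<le> (\<Sum>j<m. n)" using r that by (intro sum_mono) auto
    also have "\<dots> \<le> d * n" using that by simp
    finally show ?thesis using nd_H H_word(1)[of "\<Sum>j<m. r j"] by (simp add: mult.commute)
  qed
  have one: "1 < (2::nat) ^ w" by (rule one_less)
  let ?R = "\<Sum>j<d. r j"
  let ?z = "vr s 43 mod ?R"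
  have zw: "?z < 2 ^ w" using z H_word(1)[of ?z] by (meson le_less_trans mod_less_eq_dividend)
  \<comment> \<open>Prefix sum, reduced word, and the number of prefix sums that do not exceed it;
    the last is the value of \<open>sel\<close> before its outer \<open>mod\<close>.\<close>
  let ?I = "\<lambda>m s'. vr s' 41 = (\<Sum>j<m. r j) \<and> vr s' 43 = ?z \<and>
    vr s' 51 = card {j. j < m \<and> (\<Sum>j'\<le>j. r j') \<le> ?z}"
  have card_le: "card {j. j < m \<and> P j} \<le> m" for m P
    using card_mono[of "{..<m}" "{j. j < m \<and> P j}"] by auto
  have card_Suc: "card {j. j < Suc m \<and> P j} = card {j. j < m \<and> P j} + of_bool (P m)" for m P
  proof -
    have "{j. j < Suc m \<and> P j} = (if P m then insert m {j. j < m \<and> P j} else {j. j < m \<and> P j})"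
      by (auto simp: less_Suc_eq)
    then show ?thesis by simp
  qed
  have body: "wp (Asg 41 (V 41 +. Ar 5 (V 24)) ;; Asg 51 (V 51 +. leq (V 41) (V 43))) (?I (Suc j)) (setv 24 j s')"
    if j: "j < d" and I: "?I j s'" and s': "ar s' 5 = ar s 5" "vr s' 3 = H" for j s'
    using I R[of "Suc j"] R[of j] j words one card_le[of j "\<lambda>j. (\<Sum>j'\<le>j. r j') \<le> ?z"]
    by (intro wp_Seq wp_Asg)
      (auto simp: r s' idx safe_defs card_Suc lessThan_Suc_atMost[symmetric])
  note E = env_vr[OF env]
  have md: "x mod d < 2 ^ w" for x using mod_less_divisor[OF d_pos, of x] words(2) by linarith
  show ?thesis unfolding SEL_def
    apply (rule wp_Seq, rule wp_Asg, simp)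
    apply (rule wp_Seq, rule wp_sum[where m = d and F = r])
           apply (simp_all add: E idx small r R)
    apply (rule wp_Seq, rule wp_Asg, simp add: zw)
    apply (rule wp_Seq, rule wp_Asg, simp)
    apply (rule wp_Seq, rule wp_Asg, simp)
    apply (rule wp_Seq, rule wp_For[where m = d and I = ?I])
    subgoal by simp
    subgoal by (simp add: E)
    subgoal by simp
    subgoal by simp
    subgoal premises p for j s' by (rule body[OF p(1,2)]) (use p(3) in \<open>simp_all add: frame_def E\<close>)
    subgoal premises p for s'
      using p(2) by (intro wp_Asg) (auto simp: sel_def frame_def E p(1) md)
    done
qed

lemma ham_word: "ham j x < 2 ^ w" "ham j x \<le> n"
  using ham_le[of j x] small(1) H_word(1)[of "ham j x"] by auto

lemma A_word: "A i j < 2 ^ w"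
  using A01[of i j] one_less by linarith

lemma Z_word: "Z x y < 2 ^ w"
  using Z012[of x y] small(9) H_word(1)[of "Z x y"] by linarith

lemma wp_UPD:
  assumes env: "env s" and x: "vr s 51 < d"
  shows "wp (UPD n d) (\<lambda>s'. ar s' 5 = (\<lambda>j. if j < d then min (ham j (vr s 51)) (ar s 5 j) else ar s 5 j)) s"
proof -
  note E = env_vr[OF env]
  let ?x = "vr s 51"
  let ?I = "\<lambda>m s'. ar s' 5 = (\<lambda>j. if j < m then min (ham j ?x) (ar s 5 j) else ar s 5 j)"
  have body: "wp (Asg 44 (C 0) ;;
     For 26 (V 0) n (Asg 44 (V 44 +. ne (Ar 0 (V 26 *. V 1 +. V 24)) (Ar 0 (V 26 *. V 1 +. V 51)))) ;;
     Sto 5 (V 24) (mn (V 44) (Ar 5 (V 24)))) (?I (Suc j)) (setv 24 j s')"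
    if j: "j < d" and I: "?I j s'" and env': "env s'" and x': "vr s' 51 = ?x" for j s'
  proof -
    note E' = env_vr[OF env']
    have s: "(\<Sum>i<n. of_bool (A i j \<noteq> A i ?x)) = ham j ?x" by (simp add: ham_def)
    show ?thesis
      apply (rule wp_Seq, rule wp_Asg, simp)
      apply (rule wp_Seq, rule wp_sum[where m = n and F = "\<lambda>i. of_bool (A i j \<noteq> A i ?x)"])
      subgoal by simp
      subgoal by (simp add: E')
      subgoal by simp
      subgoal by simp
      subgoal by simp
      subgoal premises p for i s''
        using p j x by (auto simp: x' E' A_addr idxw A_word intro!: safe_neI)
      subgoal using ham_word[of j ?x] by (simp add: s)
      subgoal using j by (intro wp_Sto) (auto simp: I x' E' idx ham_word s less_Suc_eq fun_eq_iff intro!: safe_mnI)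
      done
  qed
  show ?thesis unfolding UPD_def
    apply (rule wp_For[where m = d and I = ?I])
    subgoal by simp
    subgoal by (simp add: E)
    subgoal by simp
    subgoal by simp
    subgoal premises p for j s'
    proof (rule body[OF p(1,2)])
      show "env s'" by (rule env_frame[OF p(3) _ _ env]) auto
      show "vr s' 51 = ?x" using frame_vr[OF p(3), of 51] by simp
    qed
    subgoal by simp
    done
qed

lemma wp_argmin:
  assumes "x \<noteq> bx" "x \<noteq> best" "c \<noteq> bx" "c \<noteq> best" "bx \<noteq> best" "vr s bx \<le> vr s x"
    "vr s x < 2 ^ w" "vr s c < 2 ^ w" "vr s best < 2 ^ w"
    "Q (setv best (min (vr s best) (vr s c)) (setv bx (if vr s c < vr s best then vr s x else vr s bx) s))"
  shows "wp (argmin x c best bx) Q s"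
  unfolding argmin_def using assms one_less
  by (intro wp_Seq wp_Asg) (auto intro!: safe_lsI safe_mnI)

text \<open>Before any candidate the minimum is the sentinel \<open>H\<close>; as all values are
  smaller, the first candidate always replaces it.\<close>

definition amin :: "(nat \<Rightarrow> nat) \<Rightarrow> nat \<Rightarrow> nat \<Rightarrow> nat \<Rightarrow> bool" where
  "amin f m B bx \<longleftrightarrow> (if m = 0 then B = H \<and> bx = 0 else bx < m \<and> B = f bx \<and> (\<forall>x<m. f bx \<le> f x))"

lemma amin_0: "amin f 0 H 0" by (simp add: amin_def)

lemma amin_Suc: "amin f m B bx \<Longrightarrow> f m < H \<Longrightarrow> amin f (Suc m) (min B (f m)) (if f m < B then m else bx)"
  unfolding amin_def by (auto simp: less_Suc_eq min_def split: if_splits)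

lemma amin_le: "amin f m B bx \<Longrightarrow> bx \<le> m"
  by (auto simp: amin_def split: if_splits)

lemma amin_less: "amin f m B bx \<Longrightarrow> (\<And>x. x < m \<Longrightarrow> f x < H) \<Longrightarrow> B < 2 ^ w"
  by (cases "m = 0") (auto simp: amin_def intro: H_word)

lemma amin_pos: "amin f m B bx \<Longrightarrow> 0 < m \<Longrightarrow> bx < m \<and> B = f bx \<and> (\<forall>x<m. f bx \<le> f x)"
  by (auto simp: amin_def)

end

section \<open>Centers, weights and samples of a trial\<close>

context prog
begin

lemma writes_parts:
  "writes (argmin x c best bx) = {bx, best}" "stores (argmin x c best bx) = {}"
  "writes (PHASE1 n' d' K') = {22, 23, 51, 43, 40, 41, 24, 25, 26, 27, 44}" "stores (PHASE1 n' d' K') = {4, 5}"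
  "writes (WEIGHTS K' b') = {22, 23, 43, 50, 24, 25}" "stores (WEIGHTS K' b') = {6}"
  "writes (SLOTS d' Kt) = {22, 23, 43, 54, 40, 41, 51, 24, 25}" "stores (SLOTS d' Kt) = {4}"
  "writes (ROWS n' K' Kt) = {22, 23, 45, 46, 24, 25, 44, 26, 27}" "stores (ROWS n' K' Kt) = {7}"
  "writes (COLS n' d' K') = {47, 22, 23, 45, 46, 24, 25, 44, 26, 27}" "stores (COLS n' d' K') = {8}"
  by (auto simp: argmin_def PHASE1_def WEIGHTS_def SLOTS_def ROWS_def COLS_def writes_stores)

lemma NL_H: "N * L < H"
proof -
  have "4 * (N * (1 * (1 * (t * (K * 1))))) \<le> H" using n_pos d_pos K_pos by (intro le_H) auto
  moreover have "L \<le> 3 * (t * K)"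
  proof -
    have "K * 1 \<le> K * t" using t_pos by (intro mult_le_mono) auto
    then have "K + (K + K * t) \<le> 3 * (K * t)" by linarith
    then show ?thesis by (simp only: L_eq mult.commute)
  qed
  then have "N * L \<le> N * (3 * (t * K))" by (intro mult_le_mono2)
  moreover have "0 < N * (t * K)" using N_pos t_pos K_pos by simp
  moreover have "N * (3 * (t * K)) = 3 * (N * (t * K))" by simp
  ultimately show ?thesis unfolding mult_1 mult_1_right by linarith
qed

lemma tape_idx: "g < N \<Longrightarrow> m < L \<Longrightarrow> g * L + m < H" "g < N \<Longrightarrow> g * L < H"
proof -
  assume "g < N"
  then have "Suc g * L \<le> N * L" by (intro mult_le_mono1) simp
  then have "g * L + L < H" using NL_H by (simp add: add.commute)
  then show "m < L \<Longrightarrow> g * L + m < H" "g * L < H" by linarith+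
qed

lemma rad_snoc: "X \<noteq> [] \<Longrightarrow> rad (X @ [x]) j = min (ham j x) (rad X j)"
  by (simp add: rad_def)

lemma wp_PHASE1:
  assumes env: "env s" and base: "\<And>m. m < K \<Longrightarrow> vr s 52 + m < H"
    and T: "\<And>m. m < K \<Longrightarrow> ar s 3 (vr s 52 + m) = z ! m \<and> z ! m < H" and z: "length z = K"
  shows "wp (PHASE1 n d K) (\<lambda>s'. (\<forall>l\<le>K. ar s' 4 l = cent z ! l) \<and> (\<forall>j<d. ar s' 5 j = rad (cent z) j)) s"
proof -
  note E = env_vr[OF env]
  let ?I1 = "\<lambda>m s'. \<forall>j<m. ar s' 5 j = n"
  let ?I = "\<lambda>m s'. (\<forall>l\<le>m. ar s' 4 l = cent (take m z) ! l) \<and> (\<forall>j<d. ar s' 5 j = rad (cent (take m z)) j)"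
  have body: "wp (Asg 43 (Ar 3 (V 52 +. V 22)) ;; SEL d ;; Sto 4 (V 22 +. C 1) (V 51) ;; UPD n d)
      (?I (Suc m)) (setv 22 m s1)"
    if m: "m < K" and I: "?I m s1" and env1: "env s1" and s1: "vr s1 52 = vr s 52" "ar s1 3 = ar s 3" for m s1
  proof -
    let ?X = "cent (take m z)"
    have Xne: "?X \<noteq> []" by simp
    let ?s2 = "setv 43 (z ! m) (setv 22 m s1)"
    have env2: "env ?s2" using env1 by (simp add: env_setv)
    let ?x = "sel d (rad ?X) (z ! m)"
    have cent': "cent (take (Suc m) z) = ?X @ [?x]"
      using m z by (simp add: take_Suc_conv_app_nth cent_snoc)
    have lenX: "length ?X = Suc m" using m z by (simp add: length_cent)
    have sel: "wp (SEL d) (\<lambda>s'. vr s' 51 = ?x) ?s2"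
      using wp_SEL[OF env2, of "rad ?X"] I rad_le_n[OF Xne] T[OF m] by simp
    have m1: "m + 1 < H" using m small(9) by simp
    have upd: "wp (UPD n d) (?I (Suc m)) (seta 4 (m + 1) ?x s3)"
      if x: "vr s3 51 = ?x" and fr: "frame (SEL d) ?s2 s3" for s3
    proof -
      have env3: "env (seta 4 (m + 1) ?x s3)"
        using env_frame[OF fr _ _ env2] by (simp add: env_seta writes_stores)
      have x': "vr (seta 4 (m + 1) ?x s3) 51 < d" using x sel_less[OF d_pos] by simp
      have a: "ar s3 = ar s1" using fr by (auto simp: frame_def writes_stores fun_eq_iff)
      show ?thesis
        by (rule wp_conseq[OF wp_UPD[OF env3 x']])
          (use I x a lenX in \<open>auto simp: cent' frame_def writes_stores rad_snoc nth_append le_Suc_eq\<close>)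
    qed
    show ?thesis
      apply (rule wp_Seq, rule wp_Asg_eq[where x = "z ! m"])
      subgoal using m base[of m] T[of m] by (auto simp: s1 env_vr[OF env1] H_word)
      apply (rule wp_Seq, rule wp_conseq[OF sel])
      subgoal premises p for s3
        apply (rule wp_Seq, rule wp_Sto_eq[where j = "m + 1" and x = ?x])
        subgoal using p m1 by (auto simp: frame_def writes_stores H_word one_less)
        subgoal by simp
        subgoal using p env_vr[OF env1] by (auto simp: frame_def writes_stores)
        subgoal by (rule m1)
        subgoal by (rule upd[OF p])
        done
      done
  qed
  show ?thesis unfolding PHASE1_def
    apply (rule wp_Seq, rule wp_For[where m = d and I = ?I1])
    subgoal by simp
    subgoal by (simp add: E)
    subgoal by simp
    subgoal by simp
    subgoal premises p for j s'
      using p(1,2) env_frame[OF p(3) _ _ env]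
      by (intro wp_Sto_eq[where j = j and x = n]) (auto simp: env_vr idx less_Suc_eq)
    subgoal premises p for s1
    proof -
      have env1: "env (setv 22 d s1)" using env_frame[OF p(2) _ _ env] by (simp add: env_setv)
      have s1: "vr s1 52 = vr s 52" "ar s1 3 = ar s 3" using p(2) by (auto simp: frame_def)
      let ?s2 = "setv 51 0 (seta 4 0 0 (setv 22 d s1))"
      have env2: "env ?s2" using env1 by (simp add: env_setv env_seta)
      have x: "vr ?s2 51 < d" using d_pos by simp
      have rad0: "rad [0] j = ham j 0" for j by (simp add: rad_def)
      show ?thesis
        apply (rule wp_Seq, rule wp_Sto_eq[where j = 0 and x = 0])
        subgoal by simp
        subgoal by simp
        subgoal using env_vr[OF env1] by simp
        subgoal using H_pos by simp
        apply (rule wp_Seq, rule wp_Asg_eq[where x = 0], simp)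
        apply (rule wp_Seq, rule wp_conseq[OF wp_UPD[OF env2 x]])
        subgoal premises u for s3
        proof -
          have env3: "env s3" using env_frame[OF u(2) _ _ env2] by (simp add: writes_stores)
          have s3: "vr s3 52 = vr s 52" "ar s3 3 = ar s 3" "ar s3 4 0 = 0"
            using u(2) s1 by (auto simp: frame_def writes_stores)
          \<comment> \<open>The distances were initialized to \<open>n\<close>, an upper bound, so
            the first minimum is the distance to column 0.\<close>
          have I0: "?I 0 s3" using u(1) p(1) s3(3) ham_le by (auto simp: cent_Nil rad0)
          show ?thesis
            apply (rule wp_For[where m = K and I = ?I])
            subgoal by simp
            subgoal using env_vr[OF env3] by simp
            subgoal by simp
            subgoal using I0 by simp
            subgoal premises r for m s4
            proof (rule body[OF r(1,2)])
              show "env s4" using env_frame[OF r(3) _ _ env3] by (simp add: writes_stores)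
              show "vr s4 52 = vr s 52" "ar s4 3 = ar s 3"
                using r(3) s3 by (auto simp: frame_def writes_stores)
            qed
            subgoal using z by simp
            done
        qed
        done
    qed
    done
qed

lemma wp_WEIGHTS:
  assumes env: "env s" and base: "\<And>m. m < K \<Longrightarrow> vr s 52 + (K + m) < H"
    and T: "\<And>m. m < K \<Longrightarrow> ar s 3 (vr s 52 + (K + m)) = z ! m \<and> z ! m < H"
  shows "wp (WEIGHTS K b) (\<lambda>s'. \<forall>y<K. ar s' 6 y = wt b (z ! y)) s"
proof -
  note E = env_vr[OF env]
  let ?I = "\<lambda>m s'. \<forall>y<m. ar s' 6 y = wt b (z ! y)"
  have pw: "(2::nat) ^ l < 2 ^ w" if "l < b" for l
  proof -
    have "(2::nat) ^ l \<le> 2 ^ (b - 1)" using that by (intro power_increasing) auto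
    also have "\<dots> < 8 * d" by (rule two_pow_b(2))
    also have "\<dots> \<le> 16 * H" using small(2) by linarith
    finally show ?thesis using word by linarith
  qed
  have body: "wp (Asg 43 (Ar 3 (V 52 +. (V 4 +. V 22))) ;; Asg 50 (C 1) ;;
    For 24 (V 43 %. V 6) b (Asg 50 (V 50 +. V 50)) ;; Sto 6 (V 22) (V 43 \<div> V 6 %. V 50)) (?I (Suc m)) (setv 22 m s1)"
    if m: "m < K" and I: "?I m s1" and env1: "env s1" and s1: "vr s1 52 = vr s 52" "ar s1 3 = ar s 3" for m s1
  proof -
    let ?z = "z ! m"
    have zl: "?z mod b < b" using b_pos by simp
    have zw: "?z < 2 ^ w" "?z mod b < 2 ^ w" "?z div b < 2 ^ w" "?z div b mod 2 ^ (?z mod b) < 2 ^ w"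
      using T[OF m] H_word(1)[of ?z] mod_less_eq_dividend[of ?z b] div_le_dividend[of ?z b]
        mod_less_eq_dividend[of "?z div b" "2 ^ (?z mod b)"] by linarith+
    note E1 = env_vr[OF env1]
    show ?thesis
      apply (rule wp_Seq, rule wp_Asg_eq[where x = ?z])
      subgoal using m base[of m] T[of m] by (auto simp: s1 E1 H_word)
      apply (rule wp_Seq, rule wp_Asg_eq[where x = 1], simp add: one_less)
      apply (rule wp_Seq, rule wp_For[where m = "?z mod b" and I = "\<lambda>l s'. vr s' 50 = 2 ^ l"])
      subgoal by (simp add: E1 zw)
      subgoal by (simp add: E1)
      subgoal using zl by simp
      subgoal by simp
      subgoal premises p for l s2
        using p(2) pw[of "Suc l"] p(1) zl by (intro wp_Asg) (auto simp: mult_2)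
      subgoal premises p for s3
        using m I p zw
        by (intro wp_Sto_eq[where j = m and x = "wt b ?z"]) (auto simp: frame_def E1 idx less_Suc_eq wt_def)
      done
  qed
  show ?thesis unfolding WEIGHTS_def
    apply (rule wp_For[where m = K and I = ?I])
    subgoal by simp
    subgoal by (simp add: E)
    subgoal by simp
    subgoal by simp
    subgoal premises r for m s4
    proof (rule body[OF r(1,2)])
      show "env s4" using env_frame[OF r(3) _ _ env] by simp
      show "vr s4 52 = vr s 52" "ar s4 3 = ar s 3"
        using r(3) by (auto simp: frame_def)
    qed
    subgoal by simp
    done
qed

lemma wp_SLOTS:
  assumes env: "env s" and base: "\<And>m. m < K * t \<Longrightarrow> vr s 52 + (K + K + m) < H"
    and T: "\<And>m. m < K * t \<Longrightarrow> ar s 3 (vr s 52 + (K + K + m)) = z ! m \<and> z ! m < H"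
    and X: "length X = K + 1" "\<forall>l\<le>K. ar s 4 l = X ! l" "\<forall>j<d. ar s 5 j = rad X j"
  shows "wp (SLOTS d (K * t)) (\<lambda>s'. \<forall>m<K * t. ar s' 4 (K + 2 + m) = slot X (z ! m)) s"
proof -
  note E = env_vr[OF env]
  have Xne: "X \<noteq> []" using X(1) by auto
  let ?I = "\<lambda>m s'. (\<forall>y<m. ar s' 4 (K + 2 + y) = slot X (z ! y)) \<and> (\<forall>l\<le>K. ar s' 4 l = X ! l)"
  have body: "wp (Asg 43 (Ar 3 (V 52 +. (V 4 +. V 4 +. V 22))) ;;
     Asg 54 (V 43 %. (V 4 +. C 2)) ;; Asg 43 (V 43 \<div> (V 4 +. C 2)) ;; SEL d ;;
     Sto 4 (V 4 +. C 1) (V 51) ;; Sto 4 (V 4 +. C 2 +. V 22) (Ar 4 (V 54))) (?I (Suc m)) (setv 22 m s1)"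
    if m: "m < K * t" and I: "?I m s1" and env1: "env s1"
      and s1: "vr s1 52 = vr s 52" "ar s1 3 = ar s 3" "ar s1 5 = ar s 5" for m s1
  proof -
    let ?z = "z ! m"
    have zK: "?z mod (K + 2) < K + 2" by simp
    have zw: "?z < H" "?z < 2 ^ w" "?z mod (K + 2) < 2 ^ w" "?z div (K + 2) < 2 ^ w" "?z div (K + 2) < H"
      using T[OF m] H_word(1)[of ?z] mod_less_eq_dividend[of ?z "K + 2"] div_le_dividend[of ?z "K + 2"] by linarith+
    have sm: "K + 2 < 2 ^ w" "K + K < 2 ^ w" "K + K + m < 2 ^ w" "2 < (2::nat) ^ w" "K + 1 < H" "K + 1 < 2 ^ w"
      "K + 2 + m < H" "K + 2 + m < 2 ^ w" "?z mod (K + 2) < H"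
    proof -
      have h: "K + 2 + m < H" "K + 1 < H" "K + 2 < H" "K + K + m < H" "2 < H" "K + K < H" "?z mod (K + 2) < H"
        using small(7,9) m K_ge2 base[OF m] zK by linarith+
      show "K + 2 < 2 ^ w" "K + K < 2 ^ w" "K + K + m < 2 ^ w" "2 < (2::nat) ^ w" "K + 1 < H" "K + 1 < 2 ^ w"
      "K + 2 + m < H" "K + 2 + m < 2 ^ w" "?z mod (K + 2) < H"
        by (rule h h[THEN H_word(1)])+
    qed
    note E1 = env_vr[OF env1]
    let ?s2 = "setv 43 (?z div (K + 2)) (setv 54 (?z mod (K + 2)) (setv 43 ?z (setv 22 m s1)))"
    have env2: "env ?s2" using env1 by (simp add: env_setv)
    let ?x = "sel d (rad X) (?z div (K + 2))"
    have sel: "wp (SEL d) (\<lambda>s'. vr s' 51 = ?x) ?s2"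
      using wp_SEL[OF env2, of "rad X"] X(3) rad_le_n[OF Xne] zw s1 by simp
    show ?thesis
      apply (rule wp_Seq, rule wp_Asg_eq[where x = ?z])
      subgoal using base[OF m] T[OF m] sm by (auto simp: s1 E1 H_word)
      apply (rule wp_Seq, rule wp_Asg_eq[where x = "?z mod (K + 2)"])
      subgoal using sm zw by (simp add: E1)
      apply (rule wp_Seq, rule wp_Asg_eq[where x = "?z div (K + 2)"])
      subgoal using sm zw by (simp add: E1)
      apply (rule wp_Seq, rule wp_conseq[OF sel])
      subgoal premises p for s3
      proof -
        have s3: "vr s3 51 = ?x" "vr s3 4 = K" "vr s3 3 = H" "vr s3 54 = ?z mod (K + 2)" "vr s3 22 = m" "ar s3 4 = ar s1 4"
          using p E1 by (auto simp: frame_def writes_stores)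
        \<comment> \<open>Cell \<open>K + 1\<close> has just received the fresh column, while the
          cells up to \<open>K\<close> still hold the centers.\<close>
        let ?v = "if ?z mod (K + 2) = K + 1 then ?x else ar s1 4 (?z mod (K + 2))"
        have slot: "?v = slot X ?z"
        proof (cases "?z mod (K + 2) = K + 1")
          case False
          then have "?z mod (K + 2) < K + 1" using zK by linarith
          then show ?thesis using I by (simp add: slot_def)
        qed (simp add: slot_def)
        show ?thesis
          apply (rule wp_Seq, rule wp_Sto_eq[where j = "K + 1" and x = ?x])
          subgoal using s3 sm one_less by simp
          subgoal by simp
          subgoal by (simp add: s3)
          subgoal by (rule sm)
          apply (rule wp_Sto_eq[where j = "K + 2 + m" and x = "slot X ?z"])
          subgoal using s3 sm slot by (auto simp: split: if_splits)
          subgoal by simp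
          subgoal by (simp add: s3)
          subgoal by (rule sm)
          subgoal using I by (auto simp: s3 less_Suc_eq)
          done
      qed
      done
  qed
  show ?thesis unfolding SLOTS_def
    apply (rule wp_For[where m = "K * t" and I = ?I])
    subgoal by simp
    subgoal by (simp add: E)
    subgoal by simp
    subgoal using X by simp
    subgoal premises r for m s4
    proof (rule body[OF r(1,2)])
      show "env s4" using env_frame[OF r(3) _ _ env] by (simp add: writes_stores)
      show "vr s4 52 = vr s 52" "ar s4 3 = ar s 3" "ar s4 5 = ar s 5"
        using r(3) by (auto simp: frame_def writes_stores)
    qed
    subgoal by simp
    done
qed

end

section \<open>Choosing the codes of rows and columns\<close>

context prog
begin

lemma Nn_H: "N * n < H" and Nd_H: "N * d < H"
proof -
  have "4 * (N * (n * (1 * (1 * (1 * 1))))) \<le> H" "4 * (N * (1 * (d * (1 * (1 * 1))))) \<le> H"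
    using n_pos d_pos K_pos t_pos N_pos by (intro le_H; simp)+
  moreover have "0 < N * n" "0 < N * d" using n_pos d_pos N_pos by auto
  ultimately show "N * n < H" "N * d < H" unfolding mult_1 mult_1_right by linarith+
qed

lemma block_idx: "g < M \<Longrightarrow> i < (m::nat) \<Longrightarrow> g * m + i < M * m" "g < M \<Longrightarrow> g * m \<le> M * m"
proof -
  assume "g < M"
  then have "Suc g * m \<le> M * m" by (intro mult_le_mono1) simp
  then have "m + g * m \<le> M * m" by (simp only: mult_Suc)
  then show "i < m \<Longrightarrow> g * m + i < M * m" "g * m \<le> M * m" by linarith+
qed

lemma u_idx: "g < N \<Longrightarrow> i < n \<Longrightarrow> g * n + i < H" "g < N \<Longrightarrow> g * n < H"
  and v_idx: "g < N \<Longrightarrow> j < d \<Longrightarrow> g * d + j < H" "g < N \<Longrightarrow> g * d < H"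
  using block_idx(1)[of g N i n] block_idx(2)[of g N n] Nn_H block_idx(1)[of g N j d] block_idx(2)[of g N d] Nd_H
  by linarith+

lemma Z_idx: "x < K \<Longrightarrow> y < K \<Longrightarrow> x * K + y < H" "x < K \<Longrightarrow> x * K < H"
  using block_idx(1)[of x K y K] block_idx(2)[of x K K] small(8) by linarith+

lemmas idxs = u_idx v_idx Z_idx u_idx[THEN H_word(1)] v_idx[THEN H_word(1)] Z_idx[THEN H_word(1)]

text \<open>Weights are guesses and may exceed \<open>d\<close>, but stay below
  \<open>8 * d\<close>; the factor \<open>N \<ge> 1280\<close> of \<open>H\<close> makes room for
  this.\<close>

lemma score_less:
  assumes "\<And>y. y < K \<Longrightarrow> W ! y \<le> 2 ^ (b - 1)"
  shows "score t W S i x < H"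
proof -
  have "score t W S i x \<le> (\<Sum>s<K * t. 8 * d)"
    unfolding score_def
  proof (intro sum_mono)
    fix s assume "s \<in> {..<K * t}"
    then have "s div t < K" using t_pos by (simp add: less_mult_imp_div_less)
    then have "W ! (s div t) \<le> 8 * d" using assms[of "s div t"] two_pow_b(2) by linarith
    then show "W ! (s div t) * of_bool (A i (S ! s) \<noteq> Z x (s div t)) \<le> 8 * d" by simp
  qed
  also have "\<dots> = 8 * (d * (t * K))" by simp
  also have "\<dots> < 4 * (N * (1 * (d * (t * (K * 1)))))"
  proof -
    have "0 < d * (t * K)" using d_pos t_pos K_pos by simp
    moreover have "1280 * (d * (t * K)) \<le> N * (d * (t * K))" using N_ge(1) by (rule mult_le_mono1)
    ultimately show ?thesis unfolding mult_1 mult_1_right by linarith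
  qed
  also have "\<dots> \<le> H" using n_pos K_pos by (intro le_H) auto
  finally show ?thesis .
qed

definition ztab :: "cfg \<Rightarrow> bool" where
  "ztab s \<longleftrightarrow> (\<forall>x<K. \<forall>y<K. ar s 2 (x * K + y) = Z x y)"

lemma ztab_eq: "ztab s \<Longrightarrow> x < K \<Longrightarrow> y < K \<Longrightarrow> ar s 2 (x * K + y) = Z x y"
  by (simp add: ztab_def)

text \<open>Shared by the loops over row and column codes. \<open>P\<close> collects what the
  evaluation of \<open>f\<close> reads; it must survive changes of the scratch registers.\<close>

lemma wp_argmin_loop:
  assumes env: "env s" "vr s 45 = H" "vr s 46 = 0" and P: "P s"
    and c: "\<And>m s'. m < K \<Longrightarrow> env s' \<Longrightarrow> P s' \<Longrightarrow> vr s' 24 = m \<Longrightarrow> wp c (\<lambda>s'. vr s' 44 = f m) s'"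
    and PF: "\<And>s s'. P s \<Longrightarrow> (\<And>v. v \<notin> {24, 25, 26, 27, 44, 45, 46} \<Longrightarrow> vr s' v = vr s v) \<Longrightarrow> ar s' = ar s \<Longrightarrow> P s'"
    and w: "writes c \<subseteq> {26, 27, 44}" "stores c = {}"
    and f: "\<And>m. m < K \<Longrightarrow> f m < H"
  shows "wp (For 24 (V 4) K (c ;; argmin 24 44 45 46)) (\<lambda>s'. amin f K (vr s' 45) (vr s' 46)) s"
proof -
  let ?c = "For 24 (V 4) K (c ;; argmin 24 44 45 46)"
  note E = env_vr[OF env(1)]
  have wr: "v \<notin> {26, 27, 44} \<Longrightarrow> v \<notin> writes c" for v using w by blast
  have envP: "env s' \<and> P s' \<and> ar s' = ar s" if "frame ?c s s'" for s'
  proof -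
    have a: "ar s' = ar s" using that w by (auto simp: frame_def writes_parts fun_eq_iff)
    have v: "\<And>v. v \<notin> {24, 25, 26, 27, 44, 45, 46} \<Longrightarrow> vr s' v = vr s v"
      using that wr by (auto simp: frame_def writes_parts)
    have "env s'" using env(1) a v unfolding env_def by simp
    then show ?thesis using a PF[OF P v a] by simp
  qed
  show ?thesis
    apply (rule wp_For[where m = K and I = "\<lambda>m s'. amin f m (vr s' 45) (vr s' 46)"])
    subgoal by simp
    subgoal by (simp add: E)
    subgoal by simp
    subgoal using env by (simp add: amin_0)
    subgoal premises p for m s'
    proof -
      let ?s1 = "setv 24 m s'"
      have e: "env ?s1" "P ?s1" using envP[OF p(3)] PF[of s' ?s1] by (simp_all add: env_setv)
      show ?thesis
        apply (rule wp_Seq, rule wp_conseq[OF c[OF p(1) e]])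
        subgoal by simp
        subgoal premises q for s2
        proof -
          have v: "vr s2 24 = m" "vr s2 45 = vr s' 45" "vr s2 46 = vr s' 46"
            using frame_vr[OF q(2) wr, of 24] frame_vr[OF q(2) wr, of 45] frame_vr[OF q(2) wr, of 46] by auto
          show ?thesis
            using amin_Suc[OF p(2) f[OF p(1)]] amin_le[OF p(2)] amin_less[OF p(2)] f p(1) q(1) v idxw(3)[OF p(1)] H_word(1)
            by (intro wp_argmin) (auto simp: min.commute)
        qed
        done
    qed
    subgoal by simp
    done
qed

lemma wp_ROWS:
  assumes env: "env s" and zt: "ztab s" and g: "vr s 20 = g" "g < N"
    and S: "\<And>m. m < K * t \<Longrightarrow> ar s 4 (K + 2 + m) = S ! m \<and> S ! m < d"
    and W: "\<And>y. y < K \<Longrightarrow> ar s 6 y = W ! y \<and> W ! y \<le> 2 ^ (b - 1)"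
  shows "wp (ROWS n K (K * t)) (\<lambda>s'. (\<forall>i<n. ar s' 7 (g * n + i) < K \<and>
      (\<forall>x<K. score t W S i (ar s' 7 (g * n + i)) \<le> score t W S i x)) \<and>
      (\<forall>a. a < g * n \<or> g * n + n \<le> a \<longrightarrow> ar s' 7 a = ar s 7 a)) s"
proof -
  note E = env_vr[OF env]
  let ?I = "\<lambda>m s'. (\<forall>i<m. ar s' 7 (g * n + i) < K \<and>
      (\<forall>x<K. score t W S i (ar s' 7 (g * n + i)) \<le> score t W S i x)) \<and>
      (\<forall>a. a < g * n \<or> g * n + m \<le> a \<longrightarrow> ar s' 7 a = ar s 7 a)"
  have sl: "score t W S i x < H" for i x using W by (intro score_less) auto
  let ?inner = "Asg 44 (C 0) ;; For 26 (V 9) (K * t) (Asg 44 (V 44 +. Ar 6 (V 26 \<div> V 5) *.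
         ne (Ar 0 (V 22 *. V 1 +. Ar 4 (V 4 +. C 2 +. V 26))) (Ar 2 (V 24 *. V 4 +. V 26 \<div> V 5))))"
  let ?P = "\<lambda>i s'. ztab s' \<and> vr s' 22 = i \<and> (\<forall>m<K * t. ar s' 4 (K + 2 + m) = S ! m) \<and> (\<forall>y<K. ar s' 6 y = W ! y)"
  have inner: "wp ?inner (\<lambda>s'. vr s' 44 = score t W S i x) s1"
    if x: "x < K" and env1: "env s1" and P: "?P i s1" and v: "vr s1 24 = x" and i: "i < n" for x i s1
  proof -
    note E1 = env_vr[OF env1]
    let ?F = "\<lambda>m. W ! (m div t) * of_bool (A i (S ! m) \<noteq> Z x (m div t))"
    have sc: "(\<Sum>m<K * t. ?F m) = score t W S i x" by (simp add: score_def)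
    have F: "?F m < 2 ^ w" if "m < K * t" for m
    proof -
      have "?F m \<le> (\<Sum>m<K * t. ?F m)" using that by (intro member_le_sum) auto
      then show ?thesis unfolding sc using sl[of i x] H_word(1)[of "?F m"] by linarith
    qed
    show ?thesis
      apply (rule wp_Seq, rule wp_Asg_eq[where x = 0], simp)
      apply (rule wp_sum[where m = "K * t" and F = ?F])
      subgoal by simp
      subgoal by (simp add: E1)
      subgoal by simp
      subgoal by simp
      subgoal by simp
      subgoal premises p for m s2
      proof -
        have md: "m div t < K" using p(1) by (simp add: less_mult_imp_div_less)
        have h: "K + 2 + m < H" using small(7) p(1) by linarith
        moreover have "K + 2 < H" "2 < H" using small(9) K_ge2 by linarith+
        ultimately have h': "K + 2 + m < 2 ^ w" "K + 2 < 2 ^ w" "2 < (2::nat) ^ w" by (blast intro: H_word)+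
        have e: "vr s2 9 = K * t" "vr s2 5 = t" "vr s2 4 = K" "vr s2 3 = H" "vr s2 1 = d" "vr s2 22 = i" "vr s2 24 = x" "vr s2 26 = m"
          "ar s2 = ar s1" using p(2,3) p(4) v P by (simp_all add: E1)
        have Sd: "S ! m < d" using S[OF p(1)] by simp
        have a: "ar s1 6 (m div t) = W ! (m div t)" "ar s1 4 (K + 2 + m) = S ! m"
          "ar s1 0 (i * d + S ! m) = A i (S ! m)" "ar s1 2 (x * K + m div t) = Z x (m div t)"
          using P md p(1) ztab_eq[of s1] x i Sd by (simp_all add: E1)
        have sne: "safe (ne (Ar 0 (V 22 *. V 1 +. Ar 4 (V 4 +. C 2 +. V 26))) (Ar 2 (V 24 *. V 4 +. V 26 \<div> V 5))) s2"
          using a(2-4) h h' md i x Sd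
          by (intro safe_neI) (simp_all add: e A_word Z_word A_addr idxw idxs)
        show ?thesis
          using sne F[OF p(1)] idx(3)[OF md] idxw(3)[OF md] a by (simp add: e)
      qed
      subgoal using sl[of i x] H_word(1) by (simp add: sc)
      subgoal by (simp add: sc)
      done
  qed
  show ?thesis unfolding ROWS_def
    apply (rule wp_For[where m = n and I = ?I])
    subgoal by simp
    subgoal by (simp add: E)
    subgoal by simp
    subgoal by simp
    subgoal premises p for i s1
    proof -
      have f1: "vr s1 20 = g" "ar s1 4 = ar s 4" "ar s1 6 = ar s 6" "ar s1 2 = ar s 2"
        using p(3) g by (auto simp: frame_def writes_parts)
      have env1: "env s1" using env_frame[OF p(3) _ _ env] by (simp add: writes_parts)
      let ?s2 = "setv 46 0 (setv 45 H (setv 22 i s1))"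
      have env2: "env ?s2" using env1 by (simp add: env_setv)
      have P2: "?P i ?s2" using zt S W by (simp add: f1 ztab_def)
      have loop: "wp (For 24 (V 4) K (?inner ;; argmin 24 44 45 46))
        (\<lambda>s'. amin (score t W S i) K (vr s' 45) (vr s' 46)) ?s2"
      proof (rule wp_argmin_loop[where P = "?P i", OF env2])
        show "?P i ?s2" by (rule P2)
        show "wp ?inner (\<lambda>s'. vr s' 44 = score t W S i m) s'"
          if "m < K" "env s'" "?P i s'" "vr s' 24 = m" for m s' by (rule inner[OF that p(1)])
      qed (use sl in \<open>auto simp: ztab_def\<close>)
      show ?thesis
        apply (rule wp_Seq, rule wp_Asg_eq[where x = H], simp add: env_vr[OF env1])
        apply (rule wp_Seq, rule wp_Asg_eq[where x = 0], simp)
        apply (rule wp_Seq, rule wp_conseq[OF loop])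
        subgoal premises q for s3
        proof -
          have f3: "vr s3 20 = g" "vr s3 0 = n" "vr s3 22 = i" "vr s3 3 = H" "ar s3 7 = ar s1 7"
            using q(2) f1 env_vr[OF env1] by (auto simp: frame_def writes_parts)
          have am: "vr s3 46 < K \<and> (\<forall>x<K. score t W S i (vr s3 46) \<le> score t W S i x)"
            using amin_pos[OF q(1) K_pos] by simp
          show ?thesis
            apply (rule wp_Sto_eq[where j = "g * n + i" and x = "vr s3 46"])
            subgoal using p(1) g idxs by (simp add: f3)
            subgoal by simp
            subgoal by (simp add: f3)
            subgoal using p(1) g idxs by simp
            subgoal using p(2) am by (auto simp: f3 less_Suc_eq)
            done
        qed
        done
    qed
    subgoal by simp
    done
qed

definition colcost :: "(nat \<Rightarrow> nat) \<Rightarrow> nat \<Rightarrow> nat \<Rightarrow> nat" where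
  "colcost u j y = (\<Sum>i<n. of_bool (A i j \<noteq> Z (u i) y))"

lemma cst_colcost: "cst u v = (\<Sum>j<d. colcost u j (v j))"
  by (simp add: cst_def colcost_def)

lemma colcost_le: "colcost u j y \<le> n"
  unfolding colcost_def using sum_mono[of "{..<n}" "\<lambda>i. of_bool (A i j \<noteq> Z (u i) y)" "\<lambda>_. 1::nat"] by simp

lemma wp_COLS:
  assumes env: "env s" and zt: "ztab s" and g: "vr s 20 = g" "g < N"
    and u: "\<And>i. i < n \<Longrightarrow> ar s 7 (g * n + i) < K"
  defines "u \<equiv> \<lambda>i. ar s 7 (g * n + i)"
  shows "wp (COLS n d K) (\<lambda>s'. (\<forall>j<d. ar s' 8 (g * d + j) < K \<and>
      (\<forall>y<K. colcost u j (ar s' 8 (g * d + j)) \<le> colcost u j y)) \<and>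
      vr s' 47 = (\<Sum>j<d. colcost u j (ar s' 8 (g * d + j))) \<and>
      (\<forall>a. a < g * d \<or> g * d + d \<le> a \<longrightarrow> ar s' 8 a = ar s 8 a)) s"
proof -
  note E = env_vr[OF env]
  let ?I = "\<lambda>m s'. (\<forall>j<m. ar s' 8 (g * d + j) < K \<and>
      (\<forall>y<K. colcost u j (ar s' 8 (g * d + j)) \<le> colcost u j y)) \<and>
      vr s' 47 = (\<Sum>j<m. colcost u j (ar s' 8 (g * d + j))) \<and>
      (\<forall>a. a < g * d \<or> g * d + m \<le> a \<longrightarrow> ar s' 8 a = ar s 8 a)"
  have sl: "colcost u j y < H" for j y using colcost_le[of u j y] small(1) by linarith
  let ?inner = "Asg 44 (C 0) ;; For 26 (V 0) n (Asg 44 (V 44 +.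
         ne (Ar 0 (V 26 *. V 1 +. V 22)) (Ar 2 (Ar 7 (V 20 *. V 0 +. V 26) *. V 4 +. V 24))))"
  let ?P = "\<lambda>j s'. ztab s' \<and> vr s' 22 = j \<and> vr s' 20 = g \<and> ar s' 7 = ar s 7"
  have inner: "wp ?inner (\<lambda>s'. vr s' 44 = colcost u j y) s1"
    if y: "y < K" and env1: "env s1" and P: "?P j s1" and v: "vr s1 24 = y" and j: "j < d" for y j s1
  proof -
    note E1 = env_vr[OF env1]
    let ?F = "\<lambda>i. of_bool (A i j \<noteq> Z (u i) y) :: nat"
    have sc: "(\<Sum>i<n. ?F i) = colcost u j y" by (simp add: colcost_def)
    show ?thesis
      apply (rule wp_Seq, rule wp_Asg_eq[where x = 0], simp)
      apply (rule wp_sum[where m = n and F = ?F])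
      subgoal by simp
      subgoal by (simp add: E1)
      subgoal by simp
      subgoal by simp
      subgoal by simp
      subgoal premises p for i s2
      proof -
        have e: "vr s2 0 = n" "vr s2 4 = K" "vr s2 3 = H" "vr s2 1 = d" "vr s2 22 = j" "vr s2 24 = y" "vr s2 26 = i" "vr s2 20 = g"
          "ar s2 = ar s1" using p(2,3) p(4) v P by (simp_all add: E1)
        have a: "ar s1 7 (g * n + i) = u i" "u i < K"
          "ar s1 0 (i * d + j) = A i j" "ar s1 2 (u i * K + y) = Z (u i) y"
          using P p(1) ztab_eq[of s1 "u i" y] y j u[OF p(1)] by (simp_all add: E1 u_def)
        have sne: "safe (ne (Ar 0 (V 26 *. V 1 +. V 22)) (Ar 2 (Ar 7 (V 20 *. V 0 +. V 26) *. V 4 +. V 24))) s2"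
          using a p(1) y j g(2)
          by (intro safe_neI) (simp_all add: e A_word Z_word A_addr idxw idxs)
        show ?thesis using sne a by (simp add: e)
      qed
      subgoal using sl[of j y] H_word(1) by (simp add: sc)
      subgoal by (simp add: sc)
      done
  qed
  show ?thesis unfolding COLS_def
    apply (rule wp_Seq, rule wp_Asg_eq[where x = 0], simp)
    apply (rule wp_For[where m = d and I = ?I])
    subgoal by simp
    subgoal by (simp add: E)
    subgoal by simp
    subgoal by simp
    subgoal premises p for j s1
    proof -
      have f1: "vr s1 20 = g" "ar s1 7 = ar s 7" "ar s1 2 = ar s 2"
        using p(3) g by (auto simp: frame_def writes_parts)
      have env0: "env (setv 47 0 s)" using env by (simp add: env_setv)
      have env1: "env s1" using env_frame[OF p(3) _ _ env0] by (simp add: writes_parts)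
      let ?s2 = "setv 46 0 (setv 45 H (setv 22 j s1))"
      have env2: "env ?s2" using env1 by (simp add: env_setv)
      have P2: "?P j ?s2" using zt by (simp add: f1 ztab_def)
      have loop: "wp (For 24 (V 4) K (?inner ;; argmin 24 44 45 46))
        (\<lambda>s'. amin (colcost u j) K (vr s' 45) (vr s' 46)) ?s2"
      proof (rule wp_argmin_loop[where P = "?P j", OF env2])
        show "?P j ?s2" by (rule P2)
        show "wp ?inner (\<lambda>s'. vr s' 44 = colcost u j m) s'"
          if "m < K" "env s'" "?P j s'" "vr s' 24 = m" for m s' by (rule inner[OF that p(1)])
      qed (use sl in \<open>auto simp: ztab_def\<close>)
      show ?thesis
        apply (rule wp_Seq, rule wp_Asg_eq[where x = H], simp add: env_vr[OF env1])
        apply (rule wp_Seq, rule wp_Asg_eq[where x = 0], simp)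
        apply (rule wp_Seq, rule wp_conseq[OF loop])
        subgoal premises q for s3
        proof -
          have f3: "vr s3 20 = g" "vr s3 1 = d" "vr s3 22 = j" "vr s3 3 = H" "ar s3 8 = ar s1 8" "vr s3 47 = vr s1 47"
            using q(2) f1 env_vr[OF env1] by (auto simp: frame_def writes_parts)
          have am: "vr s3 46 < K \<and> vr s3 45 = colcost u j (vr s3 46) \<and> (\<forall>y<K. colcost u j (vr s3 46) \<le> colcost u j y)"
            using amin_pos[OF q(1) K_pos] by simp
          let ?s4 = "seta 8 (g * d + j) (vr s3 46) s3"
          have tot: "(\<Sum>j'<Suc j. colcost u j' (ar ?s4 8 (g * d + j'))) = vr s3 47 + vr s3 45"
            using p(2) am by (simp add: f3)
          have "(\<Sum>j'<Suc j. colcost u j' (ar ?s4 8 (g * d + j'))) \<le> (\<Sum>j'<Suc j. n)"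
            by (intro sum_mono colcost_le)
          also have "\<dots> = Suc j * n" by simp
          also have "\<dots> \<le> d * n" using p(1) by (intro mult_le_mono1) simp
          finally have tw: "vr s3 47 + vr s3 45 < 2 ^ w"
            unfolding tot using nd_H H_word(1)[of "vr s3 47 + vr s3 45"] by (simp add: mult.commute)
          show ?thesis
            apply (rule wp_Seq, rule wp_Sto_eq[where j = "g * d + j" and x = "vr s3 46"])
            subgoal using p(1) g idxs by (simp add: f3)
            subgoal by simp
            subgoal by (simp add: f3)
            subgoal using p(1) g idxs by simp
            apply (rule wp_Asg_eq[where x = "vr s3 47 + vr s3 45"])
            subgoal using tw by simp
            subgoal using p(2) am tot by (auto simp: f3 less_Suc_eq)
            done
        qed
        done
    qed
    subgoal by simp
    done
qed

end

section \<open>Tables, parameters, repetition of trials and output\<close>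

definition TABLES :: "nat \<Rightarrow> nat \<Rightarrow> com" where
  "TABLES k K = For 20 (V 4) K (Asg 43 (V 20) ;;
       For 22 (V 2) k (Sto 1 (V 20 *. V 2 +. V 22) (V 43 %. C 2) ;; Asg 43 (V 43 \<div> C 2))) ;;
     For 20 (V 4) K (For 22 (V 4) K
       (Orc 44 (V 20 *. V 2) (V 22 *. V 2) ;; Sto 2 (V 20 *. V 4 +. V 22) (V 44)))"

definition OUTPUT :: "nat \<Rightarrow> nat \<Rightarrow> nat \<Rightarrow> com" where
  "OUTPUT n d k = For 20 (V 0) n (For 22 (V 2) k (Sto 9 (V 20 *. V 2 +. V 22)
       (Ar 1 (Ar 7 (V 49 *. V 0 +. V 20) *. V 2 +. V 22)))) ;;
     For 20 (V 2) k (For 22 (V 1) d (Sto 10 (V 20 *. V 1 +. V 22)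
       (Ar 1 (Ar 8 (V 49 *. V 1 +. V 22) *. V 2 +. V 20)))) ;;
     Asg 0 (C 9 *. V 3) ;; Asg 1 (C 10 *. V 3)"

definition MAIN :: "nat \<Rightarrow> nat \<Rightarrow> nat \<Rightarrow> nat \<Rightarrow> nat \<Rightarrow> nat \<Rightarrow> nat \<Rightarrow> com" where
  "MAIN n d k K Kt b N = TABLES k K ;; Asg 48 (V 3) ;; Asg 49 (C 0) ;;
     For 20 (V 7) N (TRIAL n d K Kt b ;; argmin 20 47 48 49) ;; OUTPUT n d k"

text \<open>In place of a logarithm, register 53 doubles as long as it is below \<open>4 * d\<close>
  while register 6 counts the doublings. As the number of rounds is fixed on entry to
  \<open>For\<close>, \<open>4 * d\<close> rounds are made, most of them idle; this is linear in
  \<open>d\<close>.\<close>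

definition INIT :: "nat \<Rightarrow> nat \<Rightarrow> nat \<Rightarrow> nat \<Rightarrow> nat \<Rightarrow> com" where
  "INIT q d k K Kt = Asg 4 (C 1) ;; For 20 (V 2) k (Asg 4 (V 4 +. V 4)) ;;
     Asg 5 (C (3072 * q\<^sup>2) *. (V 4 *. V 4)) ;; Asg 9 (V 4 *. V 5) ;; Asg 8 (V 4 +. (V 4 +. V 9)) ;;
     Asg 6 (C 1) ;; Asg 53 (C 1) ;;
     For 20 (C 4 *. V 1) (4 * d) (Asg 6 (V 6 +. ls (V 53) (C 4 *. V 1)) ;;
       Asg 53 (V 53 +. V 53 *. ls (V 53) (C 4 *. V 1))) ;;
     Asg 7 (C 1) ;; For 20 (V 9 +. V 4) (Kt + K) (Asg 7 (V 7 *. (C (1280 * q) *. (V 4 *. V 4)))) ;;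
     For 20 (V 4) K (Asg 7 (V 7 *. V 6)) ;;
     Asg 3 (C 4 *. (V 7 *. (V 0 *. (V 1 *. (V 5 *. (V 4 *. V 4)))))) ;;
     Asg 90 (C 3 *. V 3) ;; Asg 91 (V 90 +. V 7 *. V 8)"

context prog
begin

abbreviation ucode :: "cfg \<Rightarrow> nat \<Rightarrow> nat \<Rightarrow> nat" where "ucode s g \<equiv> \<lambda>i. ar s 7 (g * n + i)"
abbreviation vcode :: "cfg \<Rightarrow> nat \<Rightarrow> nat \<Rightarrow> nat" where "vcode s g \<equiv> \<lambda>j. ar s 8 (g * d + j)"

definition trial_ok :: "nat list \<Rightarrow> (nat \<Rightarrow> nat) \<Rightarrow> (nat \<Rightarrow> nat) \<Rightarrow> bool" where
  "trial_ok z u v \<longleftrightarrow> (\<forall>i<n. u i < K) \<and> (\<forall>j<d. v j < K) \<and> (good_trial q t b z \<longrightarrow> q * cst u v \<le> (q + 1) * OPT)"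

lemma slot_less: "length X = K + 1 \<Longrightarrow> (\<And>x. x \<in> set X \<Longrightarrow> x < d) \<Longrightarrow> slot X z < d"
  using sel_less[OF d_pos] by (auto simp: slot_def)

lemma wt_le: "wt b z \<le> 2 ^ (b - 1)"
proof -
  have "wt b z < 2 ^ (z mod b)" by (simp add: wt_def)
  also have "\<dots> \<le> 2 ^ (b - 1)" using mod_less_divisor[OF b_pos, of z] by (intro power_increasing) auto
  finally show ?thesis by simp
qed

lemma writes_TRIAL:
  "writes (TRIAL n' d' K' Kt b') = {52, 22, 23, 51, 43, 40, 41, 24, 25, 26, 27, 44, 50, 54, 45, 46, 47}"
  "stores (TRIAL n' d' K' Kt b') = {4, 5, 6, 7, 8}"
  by (auto simp: TRIAL_def writes_parts)

lemma wp_TRIAL: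
  assumes env: "env s" and zt: "ztab s" and g: "vr s 20 = g" "g < N"
    and z: "length z = L" "\<And>m. m < L \<Longrightarrow> ar s 3 (g * L + m) = z ! m \<and> z ! m < H"
  shows "wp (TRIAL n d K (K * t) b) (\<lambda>s'. trial_ok z (ucode s' g) (vcode s' g) \<and>
      vr s' 47 = cst (ucode s' g) (vcode s' g) \<and>
      (\<forall>a<g * n. ar s' 7 a = ar s 7 a) \<and> (\<forall>a<g * d. ar s' 8 a = ar s 8 a)) s"
proof -
  note E = env_vr[OF env]
  define z1 where "z1 = take K z"
  define z2 where "z2 = take K (drop K z)"
  define z3 where "z3 = drop (2 * K) z"
  have z1: "length z1 = K" "\<And>m. m < K \<Longrightarrow> z1 ! m = z ! m"
    and z2: "length z2 = K" "\<And>m. m < K \<Longrightarrow> z2 ! m = z ! (K + m)"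
    and z3: "length z3 = K * t" "\<And>m. m < K * t \<Longrightarrow> z3 ! m = z ! (K + K + m)"
    using z(1) by (auto simp: z1_def z2_def z3_def L_eq mult_2)
  let ?X = "cent z1"
  have lenX: "length ?X = K + 1" using z1 by (simp add: length_cent)
  define W where "W = map (wt b) z2"
  define S where "S = map (slot ?X) z3"
  have W: "W ! y = wt b (z2 ! y)" if "y < K" for y using that z2 by (simp add: W_def)
  have S: "S ! m = slot ?X (z3 ! m)" "S ! m < d" if "m < K * t" for m
    using that z3 slot_less[OF lenX cent_less] by (auto simp: S_def)
  have iL: "m < K \<Longrightarrow> m < L" "m < K \<Longrightarrow> K + m < L" "m < K * t \<Longrightarrow> K + K + m < L" for m
    by (auto simp: L_eq)
  have ti: "m < L \<Longrightarrow> g * L + m < H" for m using tape_idx(1)[OF g(2)] .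
  let ?s1 = "setv 52 (g * L) s"
  have env1: "env ?s1" using env by (simp add: env_setv)
  have P1: "wp (PHASE1 n d K) (\<lambda>s'. (\<forall>l\<le>K. ar s' 4 l = ?X ! l) \<and> (\<forall>j<d. ar s' 5 j = rad ?X j)) ?s1"
    by (rule wp_PHASE1[OF env1]) (use z z1 iL ti in auto)
  show ?thesis unfolding TRIAL_def
    apply (rule wp_Seq, rule wp_Asg_eq[where x = "g * L"])
    subgoal using tape_idx(2)[OF g(2)] by (simp add: E g H_word)
    apply (rule wp_Seq, rule wp_conseq[OF P1])
    subgoal premises p for s2
    proof -
      have env2: "env s2" using env_frame[OF p(2) _ _ env1] by (simp add: writes_parts)
      have f2: "vr s2 52 = g * L" "ar s2 3 = ar s 3" "ar s2 2 = ar s 2" "ar s2 7 = ar s 7" "ar s2 8 = ar s 8" "vr s2 20 = g"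
        using p(2) g by (auto simp: frame_def writes_parts)
      have P2: "wp (WEIGHTS K b) (\<lambda>s'. \<forall>y<K. ar s' 6 y = wt b (z2 ! y)) s2"
        by (rule wp_WEIGHTS[OF env2]) (use z z2 iL ti in \<open>auto simp: f2\<close>)
      show ?thesis
        apply (rule wp_Seq, rule wp_conseq[OF P2])
        subgoal premises r for s3
        proof -
          have env3: "env s3" using env_frame[OF r(2) _ _ env2] by (simp add: writes_parts)
          have f3: "vr s3 52 = g * L" "ar s3 3 = ar s 3" "ar s3 2 = ar s 2" "ar s3 7 = ar s 7" "ar s3 8 = ar s 8" "vr s3 20 = g"
            "ar s3 4 = ar s2 4" "ar s3 5 = ar s2 5"
            using r(2) f2 by (auto simp: frame_def writes_parts)
          have P3: "wp (SLOTS d (K * t)) (\<lambda>s'. \<forall>m<K * t. ar s' 4 (K + 2 + m) = slot ?X (z3 ! m)) s3"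
            by (rule wp_SLOTS[OF env3 _ _ lenX]) (use z z3 iL ti p(1) in \<open>auto simp: f3\<close>)
          show ?thesis
            apply (rule wp_Seq, rule wp_conseq[OF P3])
            subgoal premises v for s4
            proof -
              have env4: "env s4" using env_frame[OF v(2) _ _ env3] by (simp add: writes_parts)
              have f4: "ar s4 2 = ar s 2" "ar s4 7 = ar s 7" "ar s4 8 = ar s 8" "vr s4 20 = g"
                "ar s4 6 = ar s3 6"
                using v(2) f3 by (auto simp: frame_def writes_parts)
              have zt4: "ztab s4" using zt by (simp add: ztab_def f4)
              have P4: "wp (ROWS n K (K * t)) (\<lambda>s'. (\<forall>i<n. ar s' 7 (g * n + i) < K \<and>
                (\<forall>x<K. score t W S i (ar s' 7 (g * n + i)) \<le> score t W S i x)) \<and>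
                (\<forall>a. a < g * n \<or> g * n + n \<le> a \<longrightarrow> ar s' 7 a = ar s4 7 a)) s4"
                by (rule wp_ROWS[OF env4 zt4 f4(4) g(2)]) (use v(1) S r(1) W wt_le in \<open>auto simp: f4\<close>)
              show ?thesis
                apply (rule wp_Seq, rule wp_conseq[OF P4])
                subgoal premises x for s5
                proof -
                  have env5: "env s5" using env_frame[OF x(2) _ _ env4] by (simp add: writes_parts)
                  have f5: "ar s5 2 = ar s 2" "ar s5 8 = ar s 8" "vr s5 20 = g"
                    using x(2) f4 by (auto simp: frame_def writes_parts)
                  have zt5: "ztab s5" using zt by (simp add: ztab_def f5)
                  have u: "\<And>i. i < n \<Longrightarrow> ar s5 7 (g * n + i) < K" using x(1) by blast
                  let ?u = "ucode s5 g"
                  have P5: "wp (COLS n d K) (\<lambda>s'. (\<forall>j<d. ar s' 8 (g * d + j) < K \<and>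
                      (\<forall>y<K. colcost ?u j (ar s' 8 (g * d + j)) \<le> colcost ?u j y)) \<and>
                      vr s' 47 = (\<Sum>j<d. colcost ?u j (ar s' 8 (g * d + j))) \<and>
                      (\<forall>a. a < g * d \<or> g * d + d \<le> a \<longrightarrow> ar s' 8 a = ar s5 8 a)) s5"
                    by (rule wp_COLS[OF env5 zt5 f5(3) g(2) u])
                  show ?thesis
                  proof (rule wp_conseq[OF P5])
                    fix s6
                    let ?v = "vcode s6 g"
                    assume c: "(\<forall>j<d. ar s6 8 (g * d + j) < K \<and>
                      (\<forall>y<K. colcost ?u j (ar s6 8 (g * d + j)) \<le> colcost ?u j y)) \<and>
                      vr s6 47 = (\<Sum>j<d. colcost ?u j (ar s6 8 (g * d + j))) \<and>
                      (\<forall>a. a < g * d \<or> g * d + d \<le> a \<longrightarrow> ar s6 8 a = ar s5 8 a)"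
                      and fr: "frame (COLS n d K) s5 s6"
                    have a7: "ar s6 7 = ar s5 7" using fr by (auto simp: frame_def writes_parts)
                    have cost: "vr s6 47 = cst ?u ?v" using c by (simp add: cst_colcost)
                    \<comment> \<open>Every column takes its best code for the rows found, so the
                      trial is no worse than with the reference codes \<open>vs\<close>; this is why
                      the analysis of samples can keep \<open>vs\<close> fixed.\<close>
                    have "cst ?u ?v \<le> cst ?u vs"
                      unfolding cst_colcost using c vs_less by (intro sum_mono) auto
                    then have "q * cst ?u ?v \<le> q * cst ?u vs" by (rule mult_le_mono2)
                    moreover have "q * cst ?u vs \<le> (q + 1) * OPT" if "good_trial q t b z"
                    proof -
                      have "good_sample q t W S"
                        using that by (simp add: good_trial_def W_def S_def z1_def z2_def z3_def)
                      then have "(\<forall>i<n. ?u i < K \<and> (\<forall>x<K. score t W S i (?u i) \<le> score t W S i x)) \<longrightarrow>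
                        q * cst ?u vs \<le> (q + 1) * OPT" unfolding good_sample_def by (rule spec)
                      then show ?thesis by (rule mp) (use x(1) in simp)
                    qed
                    ultimately have "trial_ok z ?u ?v"
                      using c u unfolding trial_ok_def by (meson order_trans)
                    moreover have "(\<forall>a<g * n. ar s6 7 a = ar s 7 a) \<and> (\<forall>a<g * d. ar s6 8 a = ar s 8 a)"
                      using c x(1) by (simp add: a7 f4 f5)
                    ultimately show "trial_ok z (ucode s6 g) (vcode s6 g) \<and>
                      vr s6 47 = cst (ucode s6 g) (vcode s6 g) \<and>
                      (\<forall>a<g * n. ar s6 7 a = ar s 7 a) \<and> (\<forall>a<g * d. ar s6 8 a = ar s 8 a)"
                      using cost by (simp add: a7)
                  qed
                qed
                done
            qed
            done
        qed
        done
    qed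
    done
qed

lemma cst_cong: "(\<And>i. i < n \<Longrightarrow> u i = u' i) \<Longrightarrow> (\<And>j. j < d \<Longrightarrow> v j = v' j) \<Longrightarrow> cst u v = cst u' v'"
  unfolding cst_def by (intro sum.cong) auto

lemma cst_less: "cst u v < H"
proof -
  have "cst u v \<le> (\<Sum>j<d. n)" unfolding cst_colcost by (intro sum_mono colcost_le)
  then show ?thesis using nd_H by (simp add: mult.commute)
qed

lemma trial_ok_cong: "(\<And>i. i < n \<Longrightarrow> u i = u' i) \<Longrightarrow> (\<And>j. j < d \<Longrightarrow> v j = v' j) \<Longrightarrow> trial_ok z u v \<Longrightarrow> trial_ok z u' v'"
  unfolding trial_ok_def using cst_cong[of u u' v v'] by auto

lemma amin_cong: "amin f m B bx \<Longrightarrow> (\<And>x. x < m \<Longrightarrow> f x = f' x) \<Longrightarrow> amin f' m B bx"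
  by (auto simp: amin_def split: if_splits)

text \<open>Trials are ranked by their exact cost, so a single good trial suffices and need not be
  recognized.\<close>

lemma wp_TRIALS:
  assumes env: "env s" and zt: "ztab s" and i: "vr s 48 = H" "vr s 49 = 0"
    and z: "length z = N * L" "\<And>m. m < N * L \<Longrightarrow> ar s 3 m = z ! m \<and> z ! m < H"
  shows "wp (For 20 (V 7) N (TRIAL n d K (K * t) b ;; argmin 20 47 48 49)) (\<lambda>s'. \<exists>u v.
      vr s' 49 < N \<and> (\<forall>i<n. ar s' 7 (vr s' 49 * n + i) = u i) \<and> (\<forall>j<d. ar s' 8 (vr s' 49 * d + j) = v j) \<and>
      (\<forall>i<n. u i < K) \<and> (\<forall>j<d. v j < K) \<and>
      ((\<exists>g<N. good_trial q t b (take L (drop (g * L) z))) \<longrightarrow> q * cst u v \<le> (q + 1) * OPT)) s"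
proof -
  note E = env_vr[OF env]
  let ?c = "For 20 (V 7) N (TRIAL n d K (K * t) b ;; argmin 20 47 48 49)"
  let ?z = "\<lambda>g. take L (drop (g * L) z)"
  let ?f = "\<lambda>s' g. cst (ucode s' g) (vcode s' g)"
  let ?I = "\<lambda>m s'. (\<forall>g<m. trial_ok (?z g) (ucode s' g) (vcode s' g)) \<and> amin (?f s') m (vr s' 48) (vr s' 49)"
  show ?thesis
    apply (rule wp_For[where m = N and I = ?I])
    subgoal by simp
    subgoal by (simp add: E)
    subgoal by simp
    subgoal using i by (simp add: amin_def)
    subgoal premises p for g s1
    proof -
      have env1: "env (setv 20 g s1)"
        using env_frame[OF p(3) _ _ env] by (simp add: env_setv writes_TRIAL writes_parts)
      have f1: "ar s1 2 = ar s 2" "ar s1 3 = ar s 3" using p(3) by (auto simp: frame_def writes_TRIAL writes_parts)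
      have zt1: "ztab (setv 20 g s1)" using zt by (simp add: ztab_def f1)
      have bi: "m < L \<Longrightarrow> g * L + m < N * L" for m using block_idx(1)[OF p(1)] .
      have "Suc g * L \<le> N * L" using p(1) by (intro mult_le_mono1) simp
      then have lz: "length (?z g) = L" using z(1) by simp
      have zz: "ar (setv 20 g s1) 3 (g * L + m) = ?z g ! m \<and> ?z g ! m < H" if "m < L" for m
      proof -
        have "g * L \<le> N * L" using p(1) by (intro mult_le_mono1) simp
        then have "g * L \<le> length z" by (simp only: z(1))
        then show ?thesis using z(2)[OF bi[OF that]] that by (simp add: f1)
      qed
      have am: "amin (?f s1) g (vr s1 48) (vr s1 49)" using p(2) by simp
      show ?thesis
        apply (rule wp_Seq, rule wp_conseq[OF wp_TRIAL[OF env1 zt1 _ p(1) lz zz]])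
        subgoal by simp
        subgoal by simp
        subgoal premises r for s2
        proof -
          have v: "vr s2 20 = g" "vr s2 48 = vr s1 48" "vr s2 49 = vr s1 49"
            using r(2) by (auto simp: frame_def writes_TRIAL)
          \<comment> \<open>Trial \<open>g\<close> writes only block \<open>g\<close> of arrays 7
            and 8, so the costs of earlier trials, although read off the current arrays, do not
            change.\<close>
          have old: "ucode s2 h i = ucode s1 h i" "vcode s2 h j = vcode s1 h j" if "h < g" "i < n" "j < d" for h i j
            using r(1) block_idx(1)[OF that(1,2)] block_idx(1)[OF that(1,3)] by simp_all
          have feq: "?f s1 h = ?f s2 h" if "h < g" for h
            using old[OF that] n_pos d_pos by (intro cst_cong) auto
          have am2: "amin (?f s2) g (vr s2 48) (vr s2 49)"
            unfolding v using feq by (intro amin_cong[OF am]) auto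
          have ok: "trial_ok (?z h) (ucode s2 h) (vcode s2 h)" if "h < Suc g" for h
          proof (cases "h = g")
            case False
            then have h: "h < g" using that by simp
            then have "trial_ok (?z h) (ucode s1 h) (vcode s1 h)" using p(2) by blast
            moreover have "\<And>i. i < n \<Longrightarrow> ucode s1 h i = ucode s2 h i" "\<And>j. j < d \<Longrightarrow> vcode s1 h j = vcode s2 h j"
              using old(1)[OF h _ d_pos] old(2)[OF h n_pos] by simp_all
            ultimately show ?thesis by (intro trial_ok_cong[of "ucode s1 h" "ucode s2 h" "vcode s1 h" "vcode s2 h"])
          qed (use r(1) in simp)
          have am3: "amin (?f s2) (Suc g) (min (vr s2 48) (vr s2 47)) (if vr s2 47 < vr s2 48 then g else vr s2 49)"
            using amin_Suc[OF am2 cst_less] r(1) by simp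
          have "vr s2 47 < H" using r(1) cst_less by simp
          have "N * 1 \<le> N * n" using n_pos by (intro mult_le_mono2) simp
          then have "g < H" using p(1) Nn_H by linarith
          show ?thesis
          proof (rule wp_argmin)
            show "vr s2 49 \<le> vr s2 20" using amin_le[OF am2] v by simp
            show "vr s2 20 < 2 ^ w" using v \<open>g < H\<close> H_word by simp
            show "vr s2 47 < 2 ^ w" using \<open>vr s2 47 < H\<close> H_word by simp
            show "vr s2 48 < 2 ^ w" using amin_less[OF am2 cst_less] .
            show "?I (Suc g) (setv 48 (min (vr s2 48) (vr s2 47)) (setv 49 (if vr s2 47 < vr s2 48 then vr s2 20 else vr s2 49) s2))"
              using ok am3 by (cases "vr s2 47 < vr s2 48") (simp_all add: v(1) min_def)
          qed simp_all
        qed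
        done
    qed
    subgoal premises p for s1
    proof -
      have am: "vr s1 49 < N" "\<And>g. g < N \<Longrightarrow> ?f s1 (vr s1 49) \<le> ?f s1 g" using amin_pos[OF p(1)[THEN conjunct2] N_pos] by auto
      have ok: "\<And>g. g < N \<Longrightarrow> trial_ok (?z g) (ucode s1 g) (vcode s1 g)" using p(1) by blast
      have "q * ?f s1 (vr s1 49) \<le> (q + 1) * OPT" if g: "g < N" "good_trial q t b (?z g)" for g
      proof -
        have "q * ?f s1 (vr s1 49) \<le> q * ?f s1 g" using am(2)[OF g(1)] by (rule mult_le_mono2)
        also have "\<dots> \<le> (q + 1) * OPT" using ok[OF g(1)] g(2) by (simp add: trial_ok_def)
        finally show ?thesis .
      qed
      then show ?thesis using am(1) ok[OF am(1)]
        by (intro exI[of _ "ucode s1 (vr s1 49)"] exI[of _ "vcode s1 (vr s1 49)"]) (auto simp: trial_ok_def)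
    qed
    done
qed

end

definition bvec :: "nat \<Rightarrow> nat \<Rightarrow> real vec" where
  "bvec k x = vec k (\<lambda>l. of_bool (x div 2 ^ l mod 2 \<noteq> 0))"

context prog
begin

lemma k_le: "k \<le> K" "0 < k"
proof -
  show "k \<le> K" unfolding K_eq by simp
  show "0 < k" using K_ge2 K_eq by (cases k) auto
qed

lemma kk_H: "K * k < H" "k < H" "2 < H"
proof -
  have "K * k \<le> K * K" using k_le(1) by (rule mult_le_mono2)
  then show "K * k < H" "k < H" "2 < H" using small(3,8,9) k_le K_ge2 by linarith+
qed

lemma b_idx: "x < K \<Longrightarrow> l < k \<Longrightarrow> x * k + l < H" "x < K \<Longrightarrow> x * k < H" "x < K \<Longrightarrow> x * k + k \<le> H" "l < k \<Longrightarrow> l < H"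
proof -
  assume x: "x < K"
  then have "Suc x * k \<le> K * k" by (intro mult_le_mono1) simp
  then have "k + x * k \<le> K * k" by (simp only: mult_Suc)
  then show "l < k \<Longrightarrow> x * k + l < H" "x * k < H" "x * k + k \<le> H" using kk_H by linarith+
qed (use kk_H in linarith)

lemmas b_idxs = b_idx(1,2,4) b_idx(1,2,4)[THEN H_word(1)]

definition btab :: "cfg \<Rightarrow> bool" where
  "btab s \<longleftrightarrow> (\<forall>x<K. \<forall>l<k. ar s 1 (x * k + l) = x div 2 ^ l mod 2)"

lemma cvec_bvec: "btab s \<Longrightarrow> x < K \<Longrightarrow> cvec s (x * k) = bvec k x"
  by (auto simp: btab_def cvec_def bvec_def)

lemma block_neq: "a < b' \<Longrightarrow> j < m \<Longrightarrow> a * m + j \<noteq> b' * m + (i::nat)"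
  using block_idx(1)[of a b' j m] by simp

lemma wp_TABLES:
  assumes env: "env s" and Zc: "\<And>x y. x < K \<Longrightarrow> y < K \<Longrightarrow> Z x y = code3 (ip (bvec k x) (bvec k y))"
  shows "wp (TABLES k K) (\<lambda>s'. btab s' \<and> ztab s') s"
proof -
  note E = env_vr[OF env]
  let ?I1 = "\<lambda>m s'. \<forall>x<m. \<forall>l<k. ar s' 1 (x * k + l) = x div 2 ^ l mod 2"
  let ?J1 = "\<lambda>m l s'. ?I1 m s' \<and> vr s' 43 = m div 2 ^ l \<and> (\<forall>l'<l. ar s' 1 (m * k + l') = m div 2 ^ l' mod 2)"
  let ?I2 = "\<lambda>m s'. \<forall>x<m. \<forall>y<K. ar s' 2 (x * K + y) = Z x y"
  let ?J2 = "\<lambda>m l s'. ?I2 m s' \<and> (\<forall>y<l. ar s' 2 (m * K + y) = Z m y)"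
  have two: "2 < (2::nat) ^ w" using kk_H(3) H_word(1) by blast
  show ?thesis unfolding TABLES_def
    apply (rule wp_Seq, rule wp_For[where m = K and I = ?I1])
    subgoal by simp
    subgoal by (simp add: E)
    subgoal by simp
    subgoal by simp
    subgoal premises p for x s1
    proof -
      have env1: "env s1" using env_frame[OF p(3) _ _ env] by simp
      show ?thesis
        apply (rule wp_Seq, rule wp_Asg_eq[where x = x], simp)
        apply (rule wp_For[where m = k and I = "?J1 x"])
        subgoal by simp
        subgoal by (simp add: env_vr[OF env1])
        subgoal by simp
        subgoal using p(2) by simp
        subgoal premises r for l s2
        proof -
          have v: "vr s2 20 = x" "vr s2 2 = k" "vr s2 3 = H" "vr s2 43 = x div 2 ^ l"
            using r(2,3) env_vr[OF env1] by (auto simp: frame_def)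
          have xw: "x div 2 ^ l < 2 ^ w" "x div 2 ^ l mod 2 < 2 ^ w" "x div 2 ^ l div 2 < 2 ^ w"
            using idxw(3)[OF p(1)] div_le_dividend[of x "2 ^ l"] div_le_dividend[of "x div 2 ^ l" 2]
              mod_less_eq_dividend[of "x div 2 ^ l" 2] by linarith+
          have bi: "x * k + l < H" "x * k < H" "x * k + l < 2 ^ w" "x * k < 2 ^ w"
            using b_idxs p(1) r(1) by auto
          show ?thesis
            apply (rule wp_Seq, rule wp_Sto_eq[where j = "x * k + l" and x = "x div 2 ^ l mod 2"])
            subgoal using bi xw two by (simp add: v)
            subgoal by simp
            subgoal by (simp add: v)
            subgoal by (rule bi)
            apply (rule wp_Asg_eq[where x = "x div 2 ^ l div 2"])
            subgoal using xw two by (simp add: v)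
            subgoal using r(2) block_neq[of _ x _ k l]
              by (auto simp: less_Suc_eq div_mult2_eq[symmetric] mult.commute)
            done
        qed
        subgoal premises r for s2 using r(1) by (auto simp: less_Suc_eq)
        done
    qed
    subgoal premises p for s1
    proof -
      have env1: "env (setv 20 K s1)" using env_frame[OF p(2) _ _ env] by (simp add: env_setv)
      have bt: "btab (setv 20 K s1)" using p(1) by (simp add: btab_def)
      show ?thesis
        apply (rule wp_For[where m = K and I = ?I2])
        subgoal by simp
        subgoal using env_vr[OF env1] by simp
        subgoal by simp
        subgoal by simp
        subgoal premises r for x s2
        proof -
          have env2: "env (setv 20 x s2)" using env_frame[OF r(3) _ _ env1] by (simp add: env_setv)
          have bt2: "btab (setv 20 x s2)" using bt r(3) by (simp add: btab_def frame_def)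
          show ?thesis
            apply (rule wp_For[where m = K and I = "?J2 x"])
            subgoal by simp
            subgoal using env_vr[OF env2] by simp
            subgoal by simp
            subgoal using r(2) by simp
            subgoal premises u for y s3
            proof -
              let ?s4 = "setv 22 y s3"
              have env3: "env ?s4" using env_frame[OF u(3) _ _ env2] by (simp add: env_setv)
              have bt3: "btab ?s4" using bt2 u(3) by (simp add: btab_def frame_def)
              have v: "vr s3 20 = x" using u(3) by (simp add: frame_def)
              note E3 = env_vr[OF env3]
              have orc: "wp (Orc 44 (V 20 *. V 2) (V 22 *. V 2)) (\<lambda>s'. s' = setv 44 (Z x y) ?s4) ?s4"
                using cvec_bvec[OF bt3 r(1)] cvec_bvec[OF bt3 u(1)] Zc[OF r(1) u(1)] b_idx b_idxs r(1) u(1) E3(3,4) v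
                by (simp add: wp_def)
              show ?thesis
                apply (rule wp_Seq, rule wp_conseq[OF orc])
                apply (simp only:)
                apply (rule wp_Sto_eq[where j = "x * K + y" and x = "Z x y"])
                subgoal using E3(4,5) v idxs r(1) u(1) by simp
                subgoal by simp
                subgoal using E3(4) by simp
                subgoal using idxs r(1) u(1) by simp
                subgoal using u(2) block_neq[of _ x _ K y] by (auto simp: less_Suc_eq)
                done
            qed
            subgoal premises u for s3 using u(1) by (auto simp: less_Suc_eq)
            done
        qed
        subgoal premises r for s2
          using r bt by (auto simp: ztab_def btab_def frame_def)
        done
    qed
    done
qed

lemma out_idx: "i < n \<Longrightarrow> l < k \<Longrightarrow> i * k + l < H" "i < n \<Longrightarrow> i * k < H" "l < k \<Longrightarrow> j < d \<Longrightarrow> l * d + j < H" "l < k \<Longrightarrow> l * d < H"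
proof -
  have "1 * (1 * (n * (1 * (1 * (K * 1))))) \<le> H" "1 * (1 * (1 * (d * (1 * (K * 1))))) \<le> H"
    using n_pos d_pos K_pos t_pos N_pos by (intro le_H; simp)+
  then have "n * K \<le> H" "d * K \<le> H" unfolding mult_1 mult_1_right by - assumption+
  moreover have "n * k \<le> n * K" "d * k \<le> d * K" using k_le(1) by (rule mult_le_mono2)+
  moreover have "k * d = d * k" by (rule mult.commute)
  ultimately have "n * k \<le> H" "k * d \<le> H" by linarith+
  then show "i < n \<Longrightarrow> l < k \<Longrightarrow> i * k + l < H" "i < n \<Longrightarrow> i * k < H" "l < k \<Longrightarrow> j < d \<Longrightarrow> l * d + j < H" "l < k \<Longrightarrow> l * d < H"
    using block_idx(1)[of i n l k] block_idx(1)[of i n 0 k] block_idx(1)[of l k j d] block_idx(1)[of l k 0 d] k_le(2) d_pos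
    by linarith+
qed

lemmas out_idxs = out_idx out_idx[THEN H_word(1)]

definition out_ok :: "(nat \<Rightarrow> nat) \<Rightarrow> (nat \<Rightarrow> nat) \<Rightarrow> cfg \<Rightarrow> bool" where
  "out_ok u v s \<longleftrightarrow> vr s 0 = 9 * H \<and> vr s 1 = 10 * H \<and>
     (\<forall>i<n. \<forall>l<k. ar s 9 (i * k + l) = u i div 2 ^ l mod 2) \<and>
     (\<forall>j<d. \<forall>l<k. ar s 10 (l * d + j) = v j div 2 ^ l mod 2)"

lemma wp_OUTPUT:
  assumes env: "env s" and bt: "btab s" and g: "vr s 49 = g" "g < N"
    and u: "\<And>i. i < n \<Longrightarrow> ar s 7 (g * n + i) = u i \<and> u i < K"
    and v: "\<And>j. j < d \<Longrightarrow> ar s 8 (g * d + j) = v j \<and> v j < K"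
  shows "wp (OUTPUT n d k) (out_ok u v) s"
proof -
  note E = env_vr[OF env]
  let ?I1 = "\<lambda>m s'. \<forall>i<m. \<forall>l<k. ar s' 9 (i * k + l) = u i div 2 ^ l mod 2"
  let ?J1 = "\<lambda>m l s'. ?I1 m s' \<and> (\<forall>l'<l. ar s' 9 (m * k + l') = u m div 2 ^ l' mod 2)"
  let ?I2 = "\<lambda>m s'. \<forall>l<m. \<forall>j<d. ar s' 10 (l * d + j) = v j div 2 ^ l mod 2"
  let ?J2 = "\<lambda>m j s'. ?I2 m s' \<and> (\<forall>j'<j. ar s' 10 (m * d + j') = v j' div 2 ^ m mod 2)"
  have bte: "ar s 1 (x * k + l) = x div 2 ^ l mod 2" if "x < K" "l < k" for x l
    using bt that by (simp add: btab_def)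
  have c: "9 * H < 2 ^ w" "10 * H < 2 ^ w" "9 < (2::nat) ^ w" "10 < (2::nat) ^ w" using word H_pos by linarith+
  show ?thesis unfolding OUTPUT_def
    apply (rule wp_Seq, rule wp_For[where m = n and I = ?I1])
    subgoal by simp
    subgoal by (simp add: E)
    subgoal by simp
    subgoal by simp
    subgoal premises p for i s1
    proof -
      have env1: "env s1" using env_frame[OF p(3) _ _ env] by simp
      show ?thesis
        apply (rule wp_For[where m = k and I = "?J1 i"])
        subgoal by simp
        subgoal by (simp add: env_vr[OF env1])
        subgoal by simp
        subgoal using p(2) by simp
        subgoal premises r for l s2
        proof -
          have f: "vr s2 20 = i" "vr s2 2 = k" "vr s2 3 = H" "vr s2 49 = g" "vr s2 0 = n" "ar s2 7 = ar s 7" "ar s2 1 = ar s 1"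
            using r(3) p(3) g(1) env_vr[OF env1] by (auto simp: frame_def)
          show ?thesis
            apply (rule wp_Sto_eq[where j = "i * k + l" and x = "u i div 2 ^ l mod 2"])
            subgoal using u[OF p(1)] bte[of "u i" l] p(1) r(1) g(2) out_idxs idxs b_idxs by (simp add: f)
            subgoal by simp
            subgoal by (simp add: f)
            subgoal using out_idxs p(1) r(1) by simp
            subgoal using r(2) block_neq[of _ i _ k l] by (auto simp: less_Suc_eq)
            done
        qed
        subgoal premises r for s2 using r(1) by (auto simp: less_Suc_eq)
        done
    qed
    subgoal premises p for s1
    proof -
      have env1: "env (setv 20 n s1)" using env_frame[OF p(2) _ _ env] by (simp add: env_setv)
      have f1: "ar s1 8 = ar s 8" "ar s1 1 = ar s 1" "vr s1 49 = g" using p(2) g by (auto simp: frame_def)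
      show ?thesis
        apply (rule wp_Seq, rule wp_For[where m = k and I = ?I2])
        subgoal by simp
        subgoal using env_vr[OF env1] by simp
        subgoal by simp
        subgoal by simp
        subgoal premises r for l s2
        proof -
          have env2: "env (setv 20 l s2)" using env_frame[OF r(3) _ _ env1] by (simp add: env_setv)
          show ?thesis
            apply (rule wp_For[where m = d and I = "?J2 l"])
            subgoal by simp
            subgoal using env_vr[OF env2] by simp
            subgoal by simp
            subgoal using r(2) by simp
            subgoal premises x for j s3
            proof -
              have f: "vr s3 20 = l" "vr s3 2 = k" "vr s3 3 = H" "vr s3 49 = g" "vr s3 1 = d" "ar s3 8 = ar s 8" "ar s3 1 = ar s 1"
                using r(3) x(3) f1 env_vr[OF env2] by (auto simp: frame_def)
              show ?thesis
                apply (rule wp_Sto_eq[where j = "l * d + j" and x = "v j div 2 ^ l mod 2"])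
                subgoal using v[OF x(1)] bte[of "v j" l] x(1) r(1) g(2) out_idxs idxs b_idxs by (simp add: f)
                subgoal by simp
                subgoal by (simp add: f)
                subgoal using out_idxs x(1) r(1) by simp
                subgoal using x(2) block_neq[of _ l _ d j] by (auto simp: less_Suc_eq)
                done
            qed
            subgoal premises x for s3 using x(1) by (auto simp: less_Suc_eq)
            done
        qed
        subgoal premises r for s2
        proof -
          have f: "vr s2 3 = H" "ar s2 9 = ar s1 9" using r(2) env_vr[OF env1] by (auto simp: frame_def)
          show ?thesis
            using c p(1) r(1) by (intro wp_Seq wp_Asg) (auto simp: f out_ok_def)
        qed
        done
    qed
    done
qed

theorem wp_MAIN:
  assumes env: "env s" and Zc: "\<And>x y. x < K \<Longrightarrow> y < K \<Longrightarrow> Z x y = code3 (ip (bvec k x) (bvec k y))"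
    and z: "length z = N * L" "\<And>m. m < N * L \<Longrightarrow> ar s 3 m = z ! m \<and> z ! m < H"
  shows "wp (MAIN n d k K (K * t) b N) (\<lambda>s'. \<exists>u v. (\<forall>i<n. u i < K) \<and> (\<forall>j<d. v j < K) \<and> out_ok u v s' \<and>
    ((\<exists>g<N. good_trial q t b (take L (drop (g * L) z))) \<longrightarrow> q * cst u v \<le> (q + 1) * OPT)) s"
  unfolding MAIN_def
  apply (rule wp_Seq, rule wp_conseq[OF wp_TABLES[OF env Zc]], assumption, assumption)
  subgoal premises p for s1
  proof -
    have env1: "env s1" using env_frame[OF p(2) _ _ env] by (simp add: TABLES_def)
    let ?s2 = "setv 49 0 (setv 48 H s1)"
    have env2: "env ?s2" using env1 by (simp add: env_setv)
    have f1: "ar s1 3 = ar s 3" using p(2) by (simp add: frame_def TABLES_def)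
    show ?thesis
      apply (rule wp_Seq, rule wp_Asg_eq[where x = H], simp add: env_vr[OF env1])
      apply (rule wp_Seq, rule wp_Asg_eq[where x = 0], simp)
      apply (rule wp_Seq, rule wp_conseq[OF wp_TRIALS[OF env2 _ _ _ z(1)]])
      subgoal using p(1) by (simp add: ztab_def)
      subgoal by simp
      subgoal by simp
      subgoal using z(2) f1 by simp
      subgoal premises r for s3
      proof -
        from r(1) obtain u v where uv: "vr s3 49 < N" "\<forall>i<n. ar s3 7 (vr s3 49 * n + i) = u i"
          "\<forall>j<d. ar s3 8 (vr s3 49 * d + j) = v j" "\<forall>i<n. u i < K" "\<forall>j<d. v j < K"
          "(\<exists>g<N. good_trial q t b (take L (drop (g * L) z))) \<longrightarrow> q * cst u v \<le> (q + 1) * OPT"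
          by blast
        have env3: "env s3" using env_frame[OF r(2) _ _ env2] by (simp add: writes_TRIAL writes_parts)
        have bt3: "btab s3" using p(1) r(2) by (simp add: btab_def frame_def writes_TRIAL writes_parts)
        have "wp (OUTPUT n d k) (out_ok u v) s3"
          by (rule wp_OUTPUT[OF env3 bt3 refl uv(1)]) (use uv in auto)
        then show ?thesis by (rule wp_conseq) (use uv(4-6) in blast)
      qed
      done
  qed
  done

lemma wp_INIT:
  assumes s: "vr s 0 = n" "vr s 1 = d" "vr s 2 = k" "\<And>i j. i < n \<Longrightarrow> j < d \<Longrightarrow> ar s 0 (i * d + j) = A i j"
  shows "wp (INIT q d k K (K * t)) (\<lambda>s'. env s' \<and> vr s' 90 = 3 * H \<and> vr s' 91 = 3 * H + N * L) s"
proof -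
  let ?m = "LEAST m. 4 * d \<le> 2 ^ m"
  have m: "4 * d \<le> 2 ^ ?m" "?m \<le> 4 * d" "\<And>j. j < ?m \<Longrightarrow> 2 ^ j < 4 * d"
  proof -
    have ex: "4 * d \<le> 2 ^ (4 * d)" using less_exp[of "4 * d"] by simp
    show "4 * d \<le> 2 ^ ?m" by (rule LeastI[of "\<lambda>m. 4 * d \<le> 2 ^ m", OF ex])
    show "?m \<le> 4 * d" by (rule Least_le[of "\<lambda>m. 4 * d \<le> 2 ^ m", OF ex])
    show "2 ^ j < 4 * d" if "j < ?m" for j using not_less_Least[OF that] by simp
  qed
  define M where "M = ?m"
  have b: "b = Suc M" by (simp add: b_eq M_def)
  note m = m[folded M_def]
  let ?base = "1280 * q * (K * K)"
  have base: "1280 * K\<^sup>2 * q = ?base" by (simp add: power2_eq_square)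
  have base_pos: "0 < ?base" using q_pos K_pos by simp
  have KK1: "1 \<le> K * K" "1 \<le> ?base" "1 \<le> b ^ K"
  proof -
    have "0 < K * K" "0 < b ^ K" using K_pos b_pos by auto
    then show "1 \<le> K * K" "1 \<le> ?base" "1 \<le> b ^ K" using base_pos by linarith+
  qed
  have N': "N = ?base ^ (K * t + K) * b ^ K" by (simp only: N_eq base)
  have Nw: "?base ^ j \<le> N" if "j \<le> K * t + K" for j
  proof -
    have "?base ^ j * 1 \<le> ?base ^ (K * t + K) * b ^ K"
      using that KK1 by (intro mult_le_mono power_increasing)
    then show ?thesis unfolding N' by simp
  qed
  have Nw2: "?base ^ (K * t + K) * b ^ j \<le> N" if "j \<le> K" for j
    unfolding N' using that b_pos by (intro mult_le_mono2 power_increasing) auto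
  have NH: "N < H"
  proof -
    have "N * 1 \<le> N * n" using n_pos by (intro mult_le_mono2) simp
    then show ?thesis using Nn_H by linarith
  qed
  have basew: "?base < 2 ^ w" "1280 * q < 2 ^ w" "K * K < 2 ^ w"
  proof -
    have "?base ^ 1 \<le> N" by (rule Nw) (use K_pos in simp)
    then have "?base \<le> N" by (simp only: power_one_right)
    then show "?base < 2 ^ w" using NH H_word by simp
    have "1280 * q * 1 \<le> ?base" using KK1(1) by (rule mult_le_mono2)
    then show "1280 * q < 2 ^ w" using \<open>?base \<le> N\<close> NH H_word(1)[of "1280 * q"] by linarith
    show "K * K < 2 ^ w" using small(8) H_word by simp
  qed
  have t': "t = 3072 * q\<^sup>2 * (K * K)" by (simp add: t_eq power2_eq_square)
  have qt: "3072 * q\<^sup>2 < 2 ^ w"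
  proof -
    have "3072 * q\<^sup>2 * 1 \<le> t" unfolding t' using KK1(1) by (rule mult_le_mono2)
    then show ?thesis using small(4) H_word(1)[of "3072 * q\<^sup>2"] by linarith
  qed
  have K2: "2 ^ Suc j < (2::nat) ^ w" if "j < k" for j
  proof -
    have "(2::nat) ^ Suc j \<le> 2 ^ k" using that by (intro power_increasing) auto
    then show ?thesis using words(3) unfolding K_eq by linarith
  qed
  have d4: "4 * d < 2 ^ w" "8 * d < 2 ^ w" "4 < (2::nat) ^ w"
    using small(2) word H_pos by linarith+
  have KKt: "K * t + K < 2 ^ w" "K + K * t < 2 ^ w" "K + (K + K * t) < 2 ^ w"
  proof -
    have "1 * L \<le> N * L" using N_pos by (intro mult_le_mono1) simp
    then have "L < H" using NL_H by linarith
    then show "K * t + K < 2 ^ w" "K + K * t < 2 ^ w" "K + (K + K * t) < 2 ^ w"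
      using H_word(1)[of L] H_word(1)[of "K * t + K"] unfolding L_eq by linarith+
  qed
  have prods: "d * (t * (K * K)) < 2 ^ w" "t * (K * K) < 2 ^ w" "n * (d * (t * (K * K))) < 2 ^ w"
     "N * (n * (d * (t * (K * K)))) < 2 ^ w" "H < 2 ^ w" "3 < (2::nat) ^ w" "3 * H < 2 ^ w" "3 * H + N * L < 2 ^ w"
  proof -
    have "1 * (1 * (1 * (1 * (t * (K * K))))) \<le> H" "1 * (1 * (1 * (d * (t * (K * K))))) \<le> H"
      "1 * (1 * (n * (d * (t * (K * K))))) \<le> H" "1 * (N * (n * (d * (t * (K * K))))) \<le> H"
      using n_pos d_pos K_pos t_pos N_pos by (intro le_H; simp)+
    note * = this[unfolded mult_1, THEN H_word(2)]
    show "d * (t * (K * K)) < 2 ^ w" "t * (K * K) < 2 ^ w" "n * (d * (t * (K * K))) < 2 ^ w"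
     "N * (n * (d * (t * (K * K)))) < 2 ^ w" by (rule *)+
    show "H < 2 ^ w" "3 < (2::nat) ^ w" "3 * H < 2 ^ w" "3 * H + N * L < 2 ^ w"
      using word H_pos NL_H by linarith+
  qed
  let ?keep = "\<lambda>s'. vr s' 0 = n \<and> vr s' 1 = d \<and> vr s' 2 = k \<and> ar s' 0 = ar s 0"
  let ?I1 = "\<lambda>j s'. vr s' 4 = 2 ^ j"
  \<comment> \<open>\<open>M\<close> is the least exponent with \<open>4 * d \<le> 2 ^ M\<close>:
    from round \<open>M\<close> on the comparison fails and both registers keep their values. The
    count starts at 1, in accordance with \<open>b = Suc M\<close>.\<close>
  let ?I2 = "\<lambda>j s'. vr s' 6 = Suc (min j M) \<and> vr s' 53 = 2 ^ min j M"
  let ?I3 = "\<lambda>j s'. vr s' 7 = ?base ^ j"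
  let ?I4 = "\<lambda>j s'. vr s' 7 = ?base ^ (K * t + K) * b ^ j"
  have one: "1 < (2::nat) ^ w" by (rule one_less)
  show ?thesis unfolding INIT_def
    apply (rule wp_Seq, rule wp_Asg_eq[where x = 1], simp add: one)
    apply (rule wp_Seq, rule wp_For[where m = k and I = ?I1])
    subgoal by simp
    subgoal using s by simp
    subgoal by simp
    subgoal by simp
    subgoal premises p for j s1 using p(2) K2[OF p(1)] by (intro wp_Asg) (auto simp: mult_2)
    subgoal premises p for s1
    proof -
      have f1: "?keep s1" "vr s1 4 = K" using p s by (auto simp: frame_def K_eq)
      show ?thesis
        apply (rule wp_Seq, rule wp_Asg_eq[where x = t])
        subgoal using f1 basew qt words(4) by (simp add: t')
        apply (rule wp_Seq, rule wp_Asg_eq[where x = "K * t"])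
        subgoal using f1 words(5) by simp
        apply (rule wp_Seq, rule wp_Asg_eq[where x = L])
        subgoal using f1 KKt by (simp add: L_eq)
        apply (rule wp_Seq, rule wp_Asg_eq[where x = 1], simp add: one)
        apply (rule wp_Seq, rule wp_Asg_eq[where x = 1], simp add: one)
        apply (rule wp_Seq, rule wp_For[where m = "4 * d" and I = ?I2])
        subgoal using f1 d4 by simp
        subgoal using f1 by simp
        subgoal by simp
        subgoal by simp
        subgoal premises r for j s2
        proof -
          have v: "vr s2 1 = d" using r(3) f1 by (simp add: frame_def)
          have M4: "M \<le> 4 * d" by (rule m)
          show ?thesis
          proof (cases "j < M")
            case True
            then have lt: "2 ^ j < 4 * d" by (rule m)
            have jw: "Suc (Suc j) < 2 ^ w" "Suc j < 2 ^ w" "2 ^ j + 2 ^ j < (2::nat) ^ w"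
              "2 ^ j < (2::nat) ^ w"
              using True M4 d4 lt small(6) b H_word(1)[of "Suc (Suc j)"] by linarith+
            show ?thesis
              using r(2) True lt jw d4 one by (intro wp_Seq wp_Asg) (auto simp: v min_def intro!: safe_lsI)
          next
            case False
            then have "min j M = M" "min (Suc j) M = M" by auto
            moreover have "2 ^ M < 8 * d" using two_pow_b(2) by (simp add: b)
            then have "Suc M < 2 ^ w" "(2::nat) ^ M < 2 ^ w" "\<not> 2 ^ M < 4 * d"
              using words(6) d4(2) b m(1) by linarith+
            ultimately show ?thesis
              using r(2) d4 one by (intro wp_Seq wp_Asg) (auto simp: v intro!: safe_lsI)
          qed
        qed
        subgoal premises r for s2
        proof -
          have b2: "vr s2 6 = b" using r(1) m(2) by (simp add: b min_def)
          have f2: "?keep s2" "vr s2 4 = K" "vr s2 5 = t" "vr s2 9 = K * t" "vr s2 8 = L"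
            using r(2) f1 by (auto simp: frame_def)
          show ?thesis
            apply (rule wp_Seq, rule wp_Asg_eq[where x = 1], simp add: one)
            apply (rule wp_Seq, rule wp_For[where m = "K * t + K" and I = ?I3])
            subgoal using f2 KKt by simp
            subgoal using f2 by simp
            subgoal by simp
            subgoal by simp
            subgoal premises u for j s3
            proof -
              have v: "vr s3 4 = K" using u(3) f2 by (simp add: frame_def)
              have "?base ^ Suc j < 2 ^ w" using Nw[of "Suc j"] u(1) NH H_word(1)[of "?base ^ Suc j"] by linarith
              then show ?thesis
                using u(2) basew by (intro wp_Asg) (simp_all add: v mult_ac)
            qed
            subgoal premises u for s3
            proof -
              have f3: "?keep s3" "vr s3 4 = K" "vr s3 5 = t" "vr s3 9 = K * t" "vr s3 8 = L" "vr s3 6 = b"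
                using u(2) f2 b2 by (auto simp: frame_def)
              show ?thesis
                apply (rule wp_Seq, rule wp_For[where m = K and I = ?I4])
                subgoal by simp
                subgoal using f3 by simp
                subgoal by simp
                subgoal using u(1) by simp
                subgoal premises x for j s4
                proof -
                  have v: "vr s4 6 = b" using x(3) f3 by (simp add: frame_def)
                  have "?base ^ (K * t + K) * b ^ Suc j < 2 ^ w"
                    using Nw2[of "Suc j"] x(1) NH H_word(1)[of "?base ^ (K * t + K) * b ^ Suc j"] by linarith
                  then show ?thesis using x(2) by (intro wp_Asg) (simp_all add: v mult_ac)
                qed
                subgoal premises x for s4
                proof -
                  have f4: "?keep s4" "vr s4 4 = K" "vr s4 5 = t" "vr s4 9 = K * t" "vr s4 8 = L" "vr s4 6 = b" "vr s4 7 = N"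
                    using x f3 by (auto simp: frame_def N')
                  show ?thesis
                    apply (rule wp_Seq, rule wp_Asg_eq[where x = H])
                    subgoal using f4 prods basew d4 by (simp add: H_eq[symmetric])
                    apply (rule wp_Seq, rule wp_Asg_eq[where x = "3 * H"])
                    subgoal using prods by simp
                    apply (rule wp_Asg_eq[where x = "3 * H + N * L"])
                    subgoal using f4 prods NL_H H_word(1)[of "N * L"] by simp
                    subgoal using f4 s(4) by (simp add: env_def)
                    done
                qed
                done
            qed
            done
        qed
        done
    qed
    done
qed

end

section \<open>Running time and success probability\<close>

text \<open>\<open>horner_sum\<close> inverts the binary expansion in \<open>bvec\<close>, so every
  binary vector of length \<open>k\<close> has a code below \<open>2 ^ k\<close>.\<close>

lemma enc_bits:
  fixes f :: "nat \<Rightarrow> bool" and k l :: nat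
  defines "e \<equiv> horner_sum of_bool (2::nat) (map f [0..<k])"
  shows "e < 2 ^ k" "l < k \<Longrightarrow> e div 2 ^ l mod 2 \<noteq> 0 \<longleftrightarrow> f l"
proof -
  show "e < 2 ^ k" using horner_sum_of_bool_2_less[of "map f [0..<k]"] by (simp add: e_def)
  have "bit e l \<longleftrightarrow> l < k \<and> f l"
    unfolding e_def by (auto simp: bit_horner_sum_bit_iff)
  then show "l < k \<Longrightarrow> e div 2 ^ l mod 2 \<noteq> 0 \<longleftrightarrow> f l"
    by (simp add: bit_iff_odd odd_iff_mod_2_eq_one)
qed

section \<open>Time of the commands\<close>

context prog
begin

lemma ones: "1 \<le> n" "1 \<le> d" "1 \<le> K" "1 \<le> t" "1 \<le> b" "1 \<le> N" "1 \<le> k" "1 \<le> \<tau>" "k \<le> K"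
  using n_pos d_pos K_pos t_pos b_pos N_pos k_le tau by linarith+

lemma ctime_SEL: "ctime \<tau> (SEL d) \<le> 100 * d"
  using ones(2) by (simp add: SEL_def)

text \<open>Expanding \<open>ctime\<close> yields a polynomial in the parameters. Each monomial is
  bounded by the leading one, with 1 in place of the missing factors, and the rest is linear
  arithmetic in monomials; the other bounds follow the same pattern.\<close>

lemma ctime_UPD: "ctime \<tau> (UPD n d) \<le> 200 * (n * d)"
proof -
  have f0: "1 * 1 \<le> n * d" "1 * d \<le> n * d" using ones by (intro mult_le_mono; linarith)+
  show ?thesis
    by (simp add: UPD_def algebra_simps) (use f0 in \<open>simp only: mult_ac mult_1 mult_1_right\<close>)
qed

lemma ctime_PHASE1: "ctime \<tau> (PHASE1 n d K) \<le> 1000 * (K * (n * d))"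
proof -
  have f0: "1 * (1 * 1) \<le> K * (n * d)" "1 * (1 * d) \<le> K * (n * d)" "1 * (n * d) \<le> K * (n * d)"
    "K * (1 * 1) \<le> K * (n * d)" "K * (1 * d) \<le> K * (n * d)"
    using ones by (intro mult_le_mono; linarith)+
  have f1: "K * ctime \<tau> (SEL d) \<le> K * (100 * d)" "K * ctime \<tau> (UPD n d) \<le> K * (200 * (n * d))"
    by (intro mult_le_mono2 ctime_SEL ctime_UPD)+
  show ?thesis
    by (simp add: PHASE1_def algebra_simps) (use f0 f1 ctime_UPD in \<open>simp only: mult_ac mult_1 mult_1_right\<close>)
qed

lemma ctime_WEIGHTS: "ctime \<tau> (WEIGHTS K b) \<le> 100 * (K * b)"
proof -
  have f0: "1 * 1 \<le> K * b" "K * 1 \<le> K * b" using ones by (intro mult_le_mono; linarith)+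
  show ?thesis
    by (simp add: WEIGHTS_def algebra_simps) (use f0 in \<open>simp only: mult_ac mult_1 mult_1_right\<close>)
qed

lemma ctime_SLOTS: "ctime \<tau> (SLOTS d Kt) \<le> 10 + 200 * (Kt * d)"
proof -
  have f0: "Kt * 1 \<le> Kt * d" using ones by (intro mult_le_mono; linarith)
  have f1: "Kt * ctime \<tau> (SEL d) \<le> Kt * (100 * d)" by (intro mult_le_mono2 ctime_SEL)
  show ?thesis
    by (simp add: SLOTS_def algebra_simps) (use f0 f1 in \<open>simp only: mult_ac mult_1 mult_1_right\<close>)
qed

lemma ctime_ROWS: "ctime \<tau> (ROWS n K (K * t)) \<le> 1000 * (n * (K * (K * t)))"
proof -
  have f0: "1 * (1 * (1 * 1)) \<le> n * (K * (K * t))" "n * (1 * (1 * 1)) \<le> n * (K * (K * t))"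
    "n * (K * (1 * 1)) \<le> n * (K * (K * t))"
    using ones by (intro mult_le_mono; linarith)+
  show ?thesis
    by (simp add: ROWS_def argmin_def algebra_simps) (use f0 in \<open>simp only: mult_ac mult_1 mult_1_right\<close>)
qed

lemma ctime_COLS: "ctime \<tau> (COLS n d K) \<le> 1000 * (n * (K * d))"
proof -
  have f0: "1 * (1 * 1) \<le> n * (K * d)" "1 * (1 * d) \<le> n * (K * d)"
    "1 * (K * d) \<le> n * (K * d)"
    using ones by (intro mult_le_mono; linarith)+
  show ?thesis
    by (simp add: COLS_def argmin_def algebra_simps) (use f0 in \<open>simp only: mult_ac mult_1 mult_1_right\<close>)
qed

lemma b_le: "b \<le> 8 * d"
  using two_pow_b(2) less_exp[of "b - 1"] by linarith

lemma ctime_TRIAL: "ctime \<tau> (TRIAL n d K (K * t) b) \<le> 5000 * (n * (d * (t * (K * K))))"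
proof -
  let ?X = "n * (d * (t * (K * K)))"
  have f0: "K * b \<le> K * (8 * d)" using b_le by (rule mult_le_mono2)
  have f1: "1 * (1 * (1 * (1 * 1))) \<le> ?X" "n * (d * (1 * (1 * K))) \<le> ?X" "1 * (d * (1 * (1 * K))) \<le> ?X"
    "1 * (d * (t * (1 * K))) \<le> ?X" "n * (1 * (t * (K * K))) \<le> ?X"
    using ones by (intro mult_le_mono; linarith)+
  show ?thesis
    by (simp add: TRIAL_def algebra_simps) (use f0 f1 ctime_PHASE1 ctime_WEIGHTS ctime_SLOTS[of "K * t"] ctime_ROWS ctime_COLS in \<open>simp only: mult_ac mult_1 mult_1_right\<close>)
qed

lemma ctime_MAIN: "ctime \<tau> (MAIN n d k K (K * t) b N) \<le> 10000 * (N * (n * (d * (t * (K * (K * \<tau>))))))"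
proof -
  let ?X = "N * (n * (d * (t * (K * (K * \<tau>)))))"
  have f0: "N * ctime \<tau> (TRIAL n d K (K * t) b) \<le> N * (5000 * (n * (d * (t * (K * K)))))"
    by (rule mult_le_mono2[OF ctime_TRIAL])
  have f1: "K * k \<le> K * K" "n * k \<le> n * K" "d * k \<le> d * K" using ones(9) by (rule mult_le_mono2)+
  have f2: "1 * (1 * (1 * (1 * (1 * (1 * 1))))) \<le> ?X" "N * (1 * (1 * (1 * (1 * (1 * 1))))) \<le> ?X"
    "N * (n * (d * (t * (K * (K * 1))))) \<le> ?X" "1 * (1 * (1 * (1 * (K * (1 * 1))))) \<le> ?X"
    "1 * (1 * (1 * (1 * (K * (K * 1))))) \<le> ?X" "1 * (1 * (1 * (1 * (K * (K * \<tau>))))) \<le> ?X"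
    "1 * (n * (1 * (1 * (1 * (1 * 1))))) \<le> ?X" "1 * (n * (1 * (1 * (1 * (K * 1))))) \<le> ?X"
    "1 * (1 * (d * (1 * (1 * (K * 1))))) \<le> ?X" "1 * (1 * (1 * (1 * (K * (1 * 1))))) \<le> ?X"
    using ones by (intro mult_le_mono; linarith)+
  show ?thesis
    by (simp add: MAIN_def TABLES_def OUTPUT_def argmin_def algebra_simps) (use f0 f1 f2 ones(9) in \<open>simp only: mult_ac mult_1 mult_1_right\<close>)
qed

lemma ctime_INIT: "ctime \<tau> (INIT q d k K (K * t)) \<le> 1000 * (N * (n * (d * (t * (K * (K * \<tau>))))))"
proof -
  let ?X = "N * (n * (d * (t * (K * (K * \<tau>)))))"
  have f0: "1 * (1 * (1 * (1 * (1 * (1 * 1))))) \<le> ?X" "1 * (1 * (d * (1 * (1 * (1 * 1))))) \<le> ?X"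
    "1 * (1 * (1 * (t * (K * (1 * 1))))) \<le> ?X" "1 * (1 * (1 * (1 * (K * (1 * 1))))) \<le> ?X"
    using ones by (intro mult_le_mono; linarith)+
  show ?thesis
    by (simp add: INIT_def algebra_simps) (use f0 ones(9) in \<open>simp only: mult_ac mult_1 mult_1_right\<close>)
qed

lemma total_time: "ctime \<tau> (INIT q d k K (K * t)) + 6 * (N * L) + 2 + ctime \<tau> (MAIN n d k K (K * t) b N) \<le>
  12000 * (N * (n * (d * (t * (K * (K * \<tau>))))))"
proof -
  let ?X = "N * (n * (d * (t * (K * (K * \<tau>)))))"
  have "L \<le> 3 * (t * K)"
  proof -
    have "K * 1 \<le> K * t" using ones by (intro mult_le_mono; linarith)
    then have "K + (K + K * t) \<le> 3 * (K * t)" by linarith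
    then show ?thesis by (simp only: L_eq mult.commute)
  qed
  then have "N * L \<le> N * (3 * (t * K))" by (rule mult_le_mono2)
  moreover have "1 * (1 * (1 * (1 * (1 * (1 * 1))))) \<le> ?X" "N * (1 * (1 * (t * (K * (1 * 1))))) \<le> ?X"
    using ones by (intro mult_le_mono; linarith)+
  ultimately show ?thesis using ctime_INIT ctime_MAIN by (simp only: mult_ac mult_1 mult_1_right)
qed

lemma wf: "wf_com (INIT q d k K (K * t))" "wf_com (MAIN n d k K (K * t) b N)"
  by (auto simp: INIT_def MAIN_def TABLES_def OUTPUT_def argmin_def TRIAL_def PHASE1_def WEIGHTS_def
      SLOTS_def ROWS_def COLS_def SEL_def UPD_def)

theorem runs:
  assumes Zc: "\<And>x y. x < K \<Longrightarrow> y < K \<Longrightarrow> Z x y = code3 (ip (bvec k x) (bvec k y))"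
    and m: "rel s0 m" "pc m = 0" "cost m = 0"
    and s0: "vr s0 0 = n" "vr s0 1 = d" "vr s0 2 = k" "\<And>i j. i < n \<Longrightarrow> j < d \<Longrightarrow> ar s0 0 (i * d + j) = A i j"
    and T: "12000 * (N * (n * (d * (t * (K * (K * \<tau>)))))) \<le> T"
  defines "P \<equiv> whole (INIT q d k K (K * t)) (MAIN n d k K (K * t) b N)"
  shows "\<exists>g. steps P w k ip \<tau> T m = map_pmf g (replicate_pmf (N * L) (pmf_of_set {..<H})) \<and>
    (\<forall>zs. set zs \<subseteq> {..<H} \<and> length zs = N * L \<longrightarrow> halted P (g zs) \<and> cost (g zs) \<le> T \<and>
      (\<exists>s2. (\<exists>u v. (\<forall>i<n. u i < K) \<and> (\<forall>j<d. v j < K) \<and> out_ok u v s2 \<and>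
        ((\<exists>g<N. good_trial q t b (take L (drop (g * L) zs))) \<longrightarrow> q * cst u v \<le> (q + 1) * OPT)) \<and> rel s2 (g zs)))"
proof -
  obtain s1 where s1: "sem (INIT q d k K (K * t)) s0 = Some s1" "env s1" "vr s1 90 = 3 * H" "vr s1 91 = 3 * H + N * L"
    using wp_INIT[OF s0] unfolding wp_def by blast
  have run: "\<exists>s2. sem (MAIN n d k K (K * t) b N) (tape 0 zs s1) = Some s2 \<and>
      (\<exists>u v. (\<forall>i<n. u i < K) \<and> (\<forall>j<d. v j < K) \<and> out_ok u v s2 \<and>
        ((\<exists>g<N. good_trial q t b (take L (drop (g * L) zs))) \<longrightarrow> q * cst u v \<le> (q + 1) * OPT))"
    if zs: "set zs \<subseteq> {..<H}" "length zs = N * L" for zs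
  proof -
    have e: "env (tape 0 zs s1)" using s1(2) by (auto simp: env_def tape_def)
    have "ar (tape 0 zs s1) 3 m = zs ! m \<and> zs ! m < H" if "m < N * L" for m
      using that zs subsetD[OF zs(1) nth_mem, of m] by (auto simp: tape_def)
    from wp_MAIN[OF e Zc zs(2) this] show ?thesis unfolding wp_def by blast
  qed
  have "vr s1 3 = H" using env_vr(4)[OF s1(2)] .
  note W = whole_correct[where G = "\<lambda>zs s2. \<exists>u v. (\<forall>i<n. u i < K) \<and> (\<forall>j<d. v j < K) \<and> out_ok u v s2 \<and>
        ((\<exists>g<N. good_trial q t b (take L (drop (g * L) zs))) \<longrightarrow> q * cst u v \<le> (q + 1) * OPT)",
      OF s1(1) wf this s1(3,4) less_imp_le[OF NL_H] _ m order_trans[OF total_time T]]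
  show ?thesis unfolding P_def by (rule W) (rule run)
qed

text \<open>\<open>N\<close> independent trials, each good with probability at least
  \<open>1 / N\<close>, all fail with probability at most
  \<open>(1 - 1 / N) ^ N \<le> exp (-1) \<le> 1 / 2\<close>.\<close>

lemma success:
  "1 / 2 \<le> measure_pmf.prob (replicate_pmf (N * L) (pmf_of_set {..<H}))
    {zs. \<exists>g<N. good_trial q t b (take L (drop (g * L) zs))}"
proof -
  let ?U = "pmf_of_set {..<H}"
  have B: "(K + 2) * (n * d) \<le> H" "K + 2 \<le> H" "b * 2 ^ (b - 1) \<le> H"
  proof -
    have "2 * (1 * (n * (d * (1 * (K * 1))))) \<le> H" using ones by (intro le_H) linarith+
    moreover have "(K + 2) * (n * d) \<le> (2 * K) * (n * d)" using K_ge2 by (intro mult_le_mono1) simp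
    moreover have "(2 * K) * (n * d) = 2 * (1 * (n * (d * (1 * (K * 1)))))" by simp
    ultimately show "(K + 2) * (n * d) \<le> H" by linarith
    show "K + 2 \<le> H" using small(9) by simp
    have "b * 2 ^ (b - 1) \<le> N * (8 * d)" using N_ge(2) two_pow_b(2) by (intro mult_le_mono) auto
    moreover have "1 * (N * (1 * (d * (t * (1 * 1))))) \<le> H" using ones by (intro le_H) linarith+
    then have "N * (d * t) \<le> H" by simp
    moreover have "N * (8 * d) \<le> N * (d * t)"
      using t_ge K_pos by (intro mult_le_mono2) (simp add: mult.commute)
    ultimately show "b * 2 ^ (b - 1) \<le> H" by linarith
  qed
  have tp: "1 / real N \<le> measure_pmf.prob (replicate_pmf L ?U) {zs. good_trial q t b zs}"
    unfolding L_eq N_eq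
    by (rule trial_prob[OF B q_pos _ b_pos two_pow_b(1)]) (simp add: t_eq)
  have fin: "finite (set_pmf ?U)" using H_pos by (simp add: lessThan_empty_iff)
  have N1: "1 / real N \<le> 1" using N_pos by simp
  have "measure_pmf.prob (replicate_pmf (N * L) ?U) {zs. \<forall>g<N. \<not> good_trial q t b (take L (drop (g * L) zs))} \<le> (1 - 1 / real N) ^ N"
    by (rule prob_all_blocks_bad[OF fin tp N1])
  also have "\<dots> \<le> exp (- (1 / real N)) ^ N"
    using N1 exp_ge_add_one_self[of "- (1 / real N)"] by (intro power_mono) auto
  also have "\<dots> = exp (-1)" using N_pos by (simp add: exp_of_nat_mult[symmetric])
  also have "\<dots> \<le> 1 / 2" using exp_ge_add_one_self[of 1] by (simp add: exp_minus field_simps)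
  finally have "measure_pmf.prob (replicate_pmf (N * L) ?U) {zs. \<forall>g<N. \<not> good_trial q t b (take L (drop (g * L) zs))} \<le> 1 / 2" .
  moreover have "{zs. \<exists>g<N. good_trial q t b (take L (drop (g * L) zs))} =
    UNIV - {zs. \<forall>g<N. \<not> good_trial q t b (take L (drop (g * L) zs))}" by auto
  ultimately show ?thesis
    using measure_pmf.prob_compl[of "{zs. \<forall>g<N. \<not> good_trial q t b (take L (drop (g * L) zs))}" "replicate_pmf (N * L) ?U"]
    by simp
qed

end

section \<open>Comparison with the required time bound\<close>

text \<open>Either \<open>x \<le> k powr 10\<close>, and the first term suffices, or
  \<open>k \<le> x powr (1 / 10)\<close>, and the second does. This separates \<open>k\<close> from
  \<open>d\<close> in the product \<open>k * log (log d)\<close> and is the origin of the exponent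
  1.1.\<close>

lemma mult_le_powr:
  fixes x :: real
  assumes "0 \<le> x" "1 \<le> k"
  shows "k * x \<le> k powr 11 + x powr (11 / 10)"
proof (cases "x \<le> k powr 10")
  case True
  then have "k * x \<le> k * k powr 10" using assms by (intro mult_left_mono) auto
  also have "k * k powr 10 = k powr 11" using assms powr_add[of k 1 10] by simp
  finally show ?thesis using powr_ge_zero[of x "11 / 10"] by linarith
next
  case False
  then have x: "0 < x" using powr_ge_zero[of k 10] by linarith
  have "k = (k powr 10) powr (1 / 10)" unfolding powr_powr using assms by simp
  also have "\<dots> \<le> x powr (1 / 10)" using False by (intro powr_mono2) auto
  finally have "k * x \<le> x powr (1 / 10) * x" using x by (intro mult_right_mono) auto
  also have "\<dots> = x powr (11 / 10)" using x powr_add[of x "1 / 10" 1] by simp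
  finally show ?thesis using powr_ge_zero[of k 11] by linarith
qed

text \<open>For \<open>d \<ge> 2\<close> the base is at most \<open>8 * log 2 d\<close>, so its
  power has an exponent of 2 of at most \<open>3 * K + K * log 2 (log 2 d)\<close>, to which
  \<open>mult_le_powr\<close> applies.\<close>

lemma block_count_le:
  assumes "1 \<le> d" "1 \<le> K"
  shows "real (Suc (LEAST m. 4 * d \<le> 2 ^ m)) ^ K \<le>
    2 powr (3 * real K + real K powr 11 + log 2 (log 2 (real d)) powr (11 / 10))"
proof -
  define m where "m = (LEAST m. 4 * d \<le> 2 ^ m)"
  define l where "l = log 2 (log 2 (real d))"
  have "Suc m \<le> 2 powr (3 + l) \<and> 0 \<le> l"
  proof (cases "d = 1")
    \<comment> \<open>Here \<open>log 2 (log 2 d)\<close> is \<open>log 2 0\<close>, which is 0 by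
      convention.\<close>
    case True
    then have "m \<le> 2" unfolding m_def by (intro Least_le) simp
    moreover have "(2::real) powr 3 = 8" by simp
    ultimately show ?thesis using True by (simp add: l_def log_def)
  next
    case False
    then have L: "1 \<le> log 2 (real d)" using assms by (simp add: le_log_iff)
    have "m \<le> 3 + log 2 (real d)"
    proof (cases m)
      case (Suc m')
      then have "\<not> 4 * d \<le> 2 ^ m'" using not_less_Least[of m' "\<lambda>m. 4 * d \<le> 2 ^ m"] by (simp add: m_def)
      then have "2 ^ m' < real (4 * d)" by (metis linorder_not_le of_nat_less_iff of_nat_numeral of_nat_power)
      then have "2 powr real m' < 4 * real d" by (simp add: powr_realpow)
      then have "real m' < log 2 (4 * real d)" using assms by (simp add: less_log_iff)
      also have "\<dots> = 2 + log 2 (real d)" using assms log_pow_cancel[of 2 2] by (simp add: log_mult)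
      finally show ?thesis using Suc by simp
    qed (use L in simp)
    then have "real (Suc m) \<le> 8 * log 2 (real d)" using L by simp
    also have "\<dots> = 2 powr (3 + l)" using L by (simp add: powr_add l_def)
    finally show ?thesis using L by (simp add: l_def)
  qed
  then have m: "real (Suc m) \<le> 2 powr (3 + l)" "0 \<le> l" by auto
  have "real (Suc m) ^ K \<le> (2 powr (3 + l)) ^ K" using m by (intro power_mono) auto
  also have "\<dots> = 2 powr (3 * real K + real K * l)" by (subst powr_power) (auto simp: algebra_simps)
  also have "\<dots> \<le> 2 powr (3 * real K + real K powr 11 + l powr (11 / 10))"
    using mult_le_powr[OF m(2), of "real K"] assms by simp
  finally show ?thesis unfolding m_def l_def .
qed

text \<open>All factors are written as powers of 2, which reduces the claim to a comparison of
  exponents. The dependence on \<open>d\<close> beyond the linear factor contributes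
  \<open>M\<close> to the exponent, and \<open>2 powr M\<close> is the extra factor of
  \<open>d\<close> in \<open>time_bound\<close>.\<close>

lemma running_time_le_time_bound:
  fixes c \<epsilon> :: real and n d k q t b N K \<tau> :: nat
  assumes \<epsilon>: "0 < \<epsilon>" "\<epsilon> < 1 / 2" and "1 \<le> d" "1 \<le> k" and \<tau>: "real \<tau> \<le> 2 powr (c * real k)"
    and q: "q = nat \<lceil>1 / \<epsilon>\<rceil>" and K: "K = 2 ^ k" and t: "t = 3072 * q\<^sup>2 * K\<^sup>2"
    and b: "b = Suc (LEAST m. 4 * d \<le> 2 ^ m)" and N: "N = (1280 * K\<^sup>2 * q) ^ (K * t + K) * b ^ K"
  shows "real (12000 * (N * (n * (d * (t * (K * (K * \<tau>))))))) \<le> time_bound (11 + log 2 (2 ^ 20 + \<bar>c\<bar>)) \<epsilon> k n d"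
proof -
  define E where "E = 1 / \<epsilon>"
  define \<Lambda> where "\<Lambda> = log 2 E"
  define \<kappa> where "\<kappa> = real K"
  define M where "M = log 2 (log 2 (real d)) powr (11 / 10)"
  have E: "2 < E" using \<epsilon> by (simp add: E_def field_simps)
  \<comment> \<open>From \<open>\<epsilon> < 1 / 2\<close>; thanks to this, additive constants in
    the exponents are absorbed by multiples of \<open>\<Lambda>\<close>.\<close>
  have \<Lambda>: "1 \<le> \<Lambda>" "2 powr \<Lambda> = E" using E by (auto simp: \<Lambda>_def le_log_iff)
  have \<kappa>: "\<kappa> = 2 powr real k" by (simp add: \<kappa>_def K powr_realpow)
  have "2 powr 1 \<le> \<kappa>" unfolding \<kappa> using \<open>1 \<le> k\<close> by (intro powr_mono) auto
  then have \<kappa>2: "2 \<le> \<kappa>" by simp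
  have "k < K" unfolding K by (rule less_exp)
  then have k: "1 \<le> real k" "real k \<le> \<kappa>" "k + 1 \<le> \<kappa>" using \<open>1 \<le> k\<close> by (auto simp: \<kappa>_def)
  have "real q \<le> E + 1" unfolding q E_def[symmetric] using E by linarith
  then have q2: "real q \<le> 2 * E" using E by linarith
  have qq: "(real q)\<^sup>2 \<le> 4 * E\<^sup>2" using power_mono[OF q2, of 2] by (simp add: power_mult_distrib)
  have t_le: "real t \<le> 12288 * (E\<^sup>2 * \<kappa>\<^sup>2)"
    using mult_right_mono[OF qq, of "3072 * \<kappa>\<^sup>2"] by (simp add: t \<kappa>_def algebra_simps)
  have E2: "2 powr (2 * \<Lambda>) = E\<^sup>2" unfolding \<Lambda>(2)[symmetric] by (simp add: power2_eq_square powr_add[symmetric])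
  have \<kappa>p: "2 powr (2 * real k) = \<kappa>\<^sup>2" by (simp add: \<kappa> power2_eq_square powr_add[symmetric])
  have tp: "real t \<le> 2 powr (14 + 2 * \<Lambda> + 2 * real k)"
  proof -
    have "12288 * (E\<^sup>2 * \<kappa>\<^sup>2) \<le> 16384 * (E\<^sup>2 * \<kappa>\<^sup>2)" by simp
    also have "\<dots> = 2 powr (14 + 2 * \<Lambda> + 2 * real k)" by (simp add: powr_add E2 \<kappa>p)
    finally show ?thesis using t_le by linarith
  qed
  have base: "real (1280 * K\<^sup>2 * q) \<le> 2 powr (9 * \<kappa> * \<Lambda>)"
  proof -
    have "real (1280 * K\<^sup>2 * q) = 1280 * \<kappa>\<^sup>2 * real q" by (simp add: \<kappa>_def)
    also have "\<dots> \<le> 1280 * \<kappa>\<^sup>2 * (2 * E)" using q2 by (intro mult_left_mono) auto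
    also have "\<dots> \<le> 4096 * \<kappa>\<^sup>2 * E" using E by simp
    also have "\<dots> = 2 powr (12 + 2 * real k + \<Lambda>)" by (simp add: powr_add \<Lambda> \<kappa>p)
    also have "\<dots> \<le> 2 powr (9 * \<kappa> * \<Lambda>)"
    proof -
      have "12 + 2 * real k + \<Lambda> \<le> 12 * \<Lambda> + 2 * (real k * \<Lambda>) + \<Lambda>"
        using \<Lambda>(1) k mult_left_mono[OF \<Lambda>(1), of "real k"] by linarith
      also have "\<dots> = (13 + 2 * real k) * \<Lambda>" by (simp add: algebra_simps)
      also have "\<dots> \<le> (9 * \<kappa>) * \<Lambda>" using \<Lambda>(1) k \<kappa>2 by (intro mult_right_mono) linarith+
      finally show ?thesis by simp
    qed
    finally show ?thesis .
  qed
  have expo: "real (K * t + K) \<le> 12289 * (E\<^sup>2 * \<kappa> ^ 3)"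
  proof -
    have "real K * real t \<le> \<kappa> * (12288 * (E\<^sup>2 * \<kappa>\<^sup>2))" unfolding \<kappa>_def[symmetric] using t_le \<kappa>2 by (intro mult_left_mono) auto
    moreover have "1 * \<kappa> \<le> E\<^sup>2 * \<kappa> ^ 3" using E \<kappa>2 by (intro mult_mono one_le_power self_le_power) auto
    ultimately show ?thesis by (simp add: \<kappa>_def power3_eq_cube power2_eq_square algebra_simps)
  qed
  \<comment> \<open>The common yardstick for all exponents. The first factor of \<open>N\<close>
    needs only \<open>\<kappa> ^ 4\<close>; the power 11 is dictated by \<open>mult_le_powr\<close>
    in the second.\<close>
  let ?X = "\<Lambda> * E\<^sup>2 * \<kappa> ^ 11"
  have "real (1280 * K\<^sup>2 * q) ^ (K * t + K) \<le> (2 powr (9 * \<kappa> * \<Lambda>)) ^ (K * t + K)"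
    by (rule power_mono[OF base]) simp
  also have "\<dots> = 2 powr (9 * \<kappa> * \<Lambda> * real (K * t + K))" by (subst powr_power) (auto simp: mult_ac)
  also have "\<dots> \<le> 2 powr (9 * \<kappa> * \<Lambda> * (12289 * (E\<^sup>2 * \<kappa> ^ 3)))"
    using expo \<kappa>2 \<Lambda>(1) by (intro powr_mono mult_left_mono) auto
  also have "\<dots> \<le> 2 powr (2 ^ 17 * ?X)"
  proof -
    have "\<Lambda> * E\<^sup>2 * \<kappa> ^ 4 \<le> ?X" using \<kappa>2 \<Lambda>(1) by (intro mult_left_mono power_increasing) auto
    moreover have "9 * \<kappa> * \<Lambda> * (12289 * (E\<^sup>2 * \<kappa> ^ 3)) = 110601 * (\<Lambda> * E\<^sup>2 * \<kappa> ^ 4)"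
      by (simp add: eval_nat_numeral)
    moreover have "0 \<le> ?X" using \<kappa>2 \<Lambda>(1) by simp
    ultimately have "9 * \<kappa> * \<Lambda> * (12289 * (E\<^sup>2 * \<kappa> ^ 3)) \<le> 131072 * ?X" by linarith
    then show ?thesis by simp
  qed
  finally have N1: "real (1280 * K\<^sup>2 * q) ^ (K * t + K) \<le> 2 powr (2 ^ 17 * ?X)" .
  have N2: "real b ^ K \<le> 2 powr (3 * \<kappa> + \<kappa> powr 11 + M)"
    unfolding b M_def \<kappa>_def using \<open>1 \<le> d\<close> by (intro block_count_le) (auto simp: K)
  have \<kappa>11: "\<kappa> powr 11 = \<kappa> ^ 11" using \<kappa>2 by simp
  have "real (12000 * (N * (t * (K * (K * \<tau>))))) =
    12000 * (real (1280 * K\<^sup>2 * q) ^ (K * t + K) * (real b ^ K * (real t * (\<kappa> * (\<kappa> * real \<tau>)))))"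
    by (simp add: N \<kappa>_def mult_ac)
  also have "\<dots> \<le> 2 powr 14 * (2 powr (2 ^ 17 * ?X) * (2 powr (3 * \<kappa> + \<kappa> powr 11 + M) *
      (2 powr (14 + 2 * \<Lambda> + 2 * real k) * (\<kappa> * (\<kappa> * 2 powr (c * real k))))))"
    using \<kappa>2 by (intro mult_mono N1 N2 tp \<tau>) auto
  also have "\<dots> = 2 powr (28 + 2 ^ 17 * ?X + 3 * \<kappa> + \<kappa> ^ 11 + M + 2 * \<Lambda> + 4 * real k + c * real k)"
    unfolding \<kappa>11[symmetric] by (subst (3 4) \<kappa>) (simp only: powr_add[symmetric], simp add: algebra_simps)
  also have "\<dots> \<le> 2 powr ((2 ^ 20 + \<bar>c\<bar>) * ?X + M)"
  proof -
    have 1: "\<kappa> \<le> ?X" "1 \<le> ?X" "\<Lambda> \<le> ?X" "\<kappa> ^ 11 \<le> ?X"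
    proof -
      have e: "1 \<le> E\<^sup>2" using E by (intro one_le_power) simp
      then have "1 * 1 \<le> \<Lambda> * E\<^sup>2" using \<Lambda>(1) by (intro mult_mono) auto
      then have e: "1 \<le> E\<^sup>2" "1 \<le> \<Lambda> * E\<^sup>2" using e by simp_all
      have "1 * \<kappa> ^ 11 \<le> ?X" using e \<kappa>2 by (intro mult_right_mono) auto
      then show *: "\<kappa> ^ 11 \<le> ?X" by simp
      have "\<kappa> \<le> \<kappa> ^ 11" using \<kappa>2 by (intro self_le_power) auto
      then show "\<kappa> \<le> ?X" "1 \<le> ?X" using * \<kappa>2 by linarith+
      have "\<Lambda> * 1 * 1 \<le> ?X" using E \<kappa>2 \<Lambda>(1) by (intro mult_mono one_le_power) auto
      then show "\<Lambda> \<le> ?X" by simp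
    qed
    have "c * real k \<le> \<bar>c\<bar> * real k" by (intro mult_right_mono) auto
    also have "\<dots> \<le> \<bar>c\<bar> * ?X" using k(2) 1(1) by (intro mult_left_mono) auto
    finally have "28 + 2 ^ 17 * ?X + 3 * \<kappa> + \<kappa> ^ 11 + M + 2 * \<Lambda> + 4 * real k + c * real k \<le> (2 ^ 20 + \<bar>c\<bar>) * ?X + M"
      using 1 k(2) by (simp add: distrib_right)
    then show ?thesis by simp
  qed
  also have "\<dots> = E powr ((2 ^ 20 + \<bar>c\<bar>) * (E\<^sup>2 * \<kappa> ^ 11)) * 2 powr M"
    unfolding \<Lambda>(2)[symmetric] powr_powr by (simp add: powr_add \<Lambda>(2) algebra_simps)
  also have "\<dots> \<le> E powr (2 powr ((11 + log 2 (2 ^ 20 + \<bar>c\<bar>)) * real k) / \<epsilon>\<^sup>2) * 2 powr M"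
  proof -
    \<comment> \<open>\<open>\<kappa> ^ 11\<close> equals \<open>2 powr (11 * k)\<close>, and since
      \<open>1 \<le> k\<close>, the remaining constant is at most its own power with exponent
      \<open>k\<close>. This explains the form
      \<open>11 + log 2 (2 ^ 20 + \<bar>c\<bar>)\<close>.\<close>
    have "(2 ^ 20 + \<bar>c\<bar>) * \<kappa> ^ 11 \<le> 2 powr ((11 + log 2 (2 ^ 20 + \<bar>c\<bar>)) * real k)"
    proof -
      have "\<kappa> ^ 11 = 2 powr (11 * real k)" unfolding \<kappa> by (subst powr_power) auto
      moreover have "(2 ^ 20 + \<bar>c\<bar>) \<le> (2 ^ 20 + \<bar>c\<bar>) powr real k"
        using powr_mono[OF k(1), of "2 ^ 20 + \<bar>c\<bar>"] by simp
      moreover have "(2 ^ 20 + \<bar>c\<bar>) powr real k = 2 powr (log 2 (2 ^ 20 + \<bar>c\<bar>) * real k)"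
        unfolding powr_powr[symmetric] by (subst powr_log_cancel) auto
      ultimately show ?thesis using mult_left_mono[of "2 ^ 20 + \<bar>c\<bar>" "2 powr (log 2 (2 ^ 20 + \<bar>c\<bar>) * real k)" "2 powr (11 * real k)"]
        unfolding distrib_right[of 11] powr_add mult.commute[of "2 ^ 20 + \<bar>c\<bar>" "\<kappa> ^ 11"] by (simp only: powr_ge_zero)
    qed
    then have "(2 ^ 20 + \<bar>c\<bar>) * \<kappa> ^ 11 * E\<^sup>2 \<le> 2 powr ((11 + log 2 (2 ^ 20 + \<bar>c\<bar>)) * real k) * E\<^sup>2"
      by (rule mult_right_mono) simp
    then have "(2 ^ 20 + \<bar>c\<bar>) * (E\<^sup>2 * \<kappa> ^ 11) \<le> 2 powr ((11 + log 2 (2 ^ 20 + \<bar>c\<bar>)) * real k) / \<epsilon>\<^sup>2"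
      by (simp add: E_def power_one_over mult_ac)
    then show ?thesis using E by (intro mult_right_mono powr_mono) auto
  qed
  finally have main: "real (12000 * (N * (t * (K * (K * \<tau>))))) \<le>
    E powr (2 powr ((11 + log 2 (2 ^ 20 + \<bar>c\<bar>)) * real k) / \<epsilon>\<^sup>2) * 2 powr M" .
  \<comment> \<open>Division by \<open>log 2 d\<close> turns the power of \<open>d\<close> into the
    power \<open>2 powr M\<close>; for \<open>d = 1\<close> both sides are 1 because
    \<open>M = 0\<close>.\<close>
  have dM: "real d powr (1 + M / log 2 (real d)) = real d * 2 powr M"
  proof (cases "d = 1")
    case False
    then have "1 < real d" using \<open>1 \<le> d\<close> by simp
    then show ?thesis
      by (simp add: powr_def log_def distrib_right exp_add)
  qed (simp add: M_def log_def)
  have "real (12000 * (N * (n * (d * (t * (K * (K * \<tau>))))))) = real (12000 * (N * (t * (K * (K * \<tau>))))) * (real n * real d)"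
    by (simp add: mult_ac)
  also have "\<dots> \<le> (E powr (2 powr ((11 + log 2 (2 ^ 20 + \<bar>c\<bar>)) * real k) / \<epsilon>\<^sup>2) * 2 powr M) * (real n * real d)"
    by (rule mult_right_mono[OF main]) simp
  also have "\<dots> = time_bound (11 + log 2 (2 ^ 20 + \<bar>c\<bar>)) \<epsilon> k n d"
    using dM by (simp add: time_bound_def E_def M_def mult_ac)
  finally show ?thesis .
qed

section \<open>From matrices to codes, and the final assembly\<close>

lemma binary_mats_entry: "M \<in> binary_mats n d \<Longrightarrow> i < n \<Longrightarrow> j < d \<Longrightarrow> M $$ (i, j) = of_bool (M $$ (i, j) \<noteq> 0)"
  by (auto simp: binary_mats_def elements_mat_def dest!: subsetD[of _ _ "M $$ (i, j)"])

lemma mem_mat_binary: "mem_mat n d s a \<in> binary_mats n d"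
  by (auto simp: binary_mats_def mem_mat_def elements_mat_def mem_bit_def)

lemma rows_bvec:
  assumes "U \<in> binary_mats n k"
  shows "\<exists>u. \<forall>i<n. u i < 2 ^ k \<and> row U i = bvec k (u i)"
proof -
  let ?u = "\<lambda>i. horner_sum of_bool (2::nat) (map (\<lambda>l. U $$ (i, l) \<noteq> 0) [0..<k])"
  have "row U i = bvec k (?u i)" if "i < n" for i
    using assms enc_bits(2) binary_mats_entry[OF assms that] that by (auto simp: bvec_def binary_mats_def)
  then show ?thesis using enc_bits(1) by (intro exI[of _ ?u]) blast
qed

lemma cols_bvec:
  assumes "W \<in> binary_mats k d"
  shows "\<exists>v. \<forall>j<d. v j < 2 ^ k \<and> col W j = bvec k (v j)"
proof -
  let ?v = "\<lambda>j. horner_sum of_bool (2::nat) (map (\<lambda>l. W $$ (l, j) \<noteq> 0) [0..<k])"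
  have "col W j = bvec k (?v j)" if "j < d" for j
    using assms enc_bits(2) binary_mats_entry[OF assms _ that] that by (auto simp: bvec_def binary_mats_def)
  then show ?thesis using enc_bits(1) by (intro exI[of _ ?v]) blast
qed

text \<open>An entry of \<open>A\<close> is 0 or 1; \<open>code3\<close> keeps these two values
  apart and sends every other real to 2, so codes differ exactly where the difference is
  nonzero.\<close>

lemma l0_norm_bvec:
  assumes A: "A \<in> binary_mats n d" and U: "U \<in> carrier_mat n k" "\<And>i. i < n \<Longrightarrow> row U i = bvec k (u i)"
    and W: "W \<in> carrier_mat k d" "\<And>j. j < d \<Longrightarrow> col W j = bvec k (v j)"
  shows "l0_norm (A - gen_mult ip U W) =
    (\<Sum>j<d. \<Sum>i<n. of_bool (of_bool (A $$ (i, j) \<noteq> 0) \<noteq> code3 (ip (bvec k (u i)) (bvec k (v j)))))"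
proof -
  let ?P = "\<lambda>i j. of_bool (A $$ (i, j) \<noteq> 0) \<noteq> code3 (ip (bvec k (u i)) (bvec k (v j)))"
  have "{(i, j). i < dim_row (A - gen_mult ip U W) \<and> j < dim_col (A - gen_mult ip U W) \<and> (A - gen_mult ip U W) $$ (i, j) \<noteq> 0} =
    {p \<in> {..<n} \<times> {..<d}. ?P (fst p) (snd p)}"
  proof -
    have *: "(A - gen_mult ip U W) $$ (i, j) \<noteq> 0 \<longleftrightarrow> ?P i j" if "i < n" "j < d" for i j
      using that U W binary_mats_entry[OF A that] by (auto simp: gen_mult_def code3_def split: if_splits)
    have "{(i, j). i < n \<and> j < d \<and> R i j} = {p \<in> {..<n} \<times> {..<d}. P (fst p) (snd p)}"
      if "\<And>i j. i < n \<Longrightarrow> j < d \<Longrightarrow> R i j \<longleftrightarrow> P i j" for R P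
      using that by auto
    from this[OF *] show ?thesis using U(1) W(1) by (simp add: gen_mult_def)
  qed
  then have "l0_norm (A - gen_mult ip U W) = card {p \<in> {..<n} \<times> {..<d}. ?P (fst p) (snd p)}"
    by (simp add: l0_norm_def)
  also have "\<dots> = (\<Sum>p\<in>{..<n} \<times> {..<d}. of_bool (?P (fst p) (snd p)))" by (simp add: Int_def)
  also have "\<dots> = (\<Sum>i<n. \<Sum>j<d. of_bool (?P i j))" by (simp only: sum.cartesian_product split_def)
  also have "\<dots> = (\<Sum>j<d. \<Sum>i<n. of_bool (?P i j))" by (rule sum.swap)
  finally show ?thesis .
qed

lemma l0_opt_attained:
  assumes A: "A \<in> binary_mats n d"
  shows "\<exists>U V. U \<in> binary_mats n k \<and> V \<in> binary_mats k d \<and> l0_opt k ip A = l0_norm (A - gen_mult ip U V)"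
proof -
  have dim: "dim_row A = n" "dim_col A = d" using A by (auto simp: binary_mats_def)
  let ?S = "(\<lambda>(U, V). l0_norm (A - gen_mult ip U V)) ` (binary_mats n k \<times> binary_mats k d)"
  have "l0_norm (A - gen_mult ip U V) \<le> n * d" if "U \<in> binary_mats n k" "V \<in> binary_mats k d" for U V
  proof -
    have "l0_norm (A - gen_mult ip U V) \<le> card ({..<n} \<times> {..<d})"
      unfolding l0_norm_def using that by (intro card_mono) (auto simp: gen_mult_def binary_mats_def)
    then show ?thesis by simp
  qed
  \<comment> \<open>It is enough that the values form a finite set; there is no need to count the
    pairs of matrices.\<close>
  then have "?S \<subseteq> {..n * d}" by auto
  then have "finite ?S" by (rule finite_subset) simp
  moreover have "?S \<noteq> {}" using mem_mat_binary by blast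
  ultimately have "Min ?S \<in> ?S" by (rule Min_in)
  then show ?thesis unfolding l0_opt_def dim by force
qed

text \<open>The program must be fixed before \<open>n\<close>, \<open>d\<close> and \<open>k\<close>
  are known. The compiler drops the ghost bounds of loops, so the code depends on \<open>q\<close>
  only, and 0 may stand for all of them.\<close>

lemma ghost_bounds:
  "whole (INIT q d k K Kt) (MAIN n d k K Kt b N) = whole (INIT q 0 0 0 0) (MAIN 0 0 0 0 0 0 0)"
  by (simp only: whole_def INIT_def MAIN_def TABLES_def OUTPUT_def argmin_def TRIAL_def PHASE1_def WEIGHTS_def
      SLOTS_def ROWS_def COLS_def SEL_def UPD_def ccom.simps clen.simps)

theorem approximation_program:
  fixes c \<epsilon> :: real and n d k \<tau> w q :: nat and A :: "real mat" and ip :: inner_prod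
  assumes \<epsilon>: "0 < \<epsilon>" "\<epsilon> < 1 / 2" and dn: "1 \<le> d" "d \<le> n" and k: "1 \<le> k" and A: "A \<in> binary_mats n d"
    and \<tau>: "1 \<le> \<tau>" "real \<tau> \<le> 2 powr (c * real k)" and q: "q = nat \<lceil>1 / \<epsilon>\<rceil>"
    and T: "T = time_bound (11 + log 2 (2 ^ 20 + \<bar>c\<bar>)) \<epsilon> k n d"
    and w: "2 * log 2 T \<le> real w" and P: "P = whole (INIT q 0 0 0 0) (MAIN 0 0 0 0 0 0 0)"
  shows "runs_in_time P w k ip \<tau> A T \<and> 1 / 2 \<le> success_prob P w k ip \<tau> A T (1 + \<epsilon>)"
proof -
  define K :: nat where "K = 2 ^ k"
  define t where "t = 3072 * q\<^sup>2 * K\<^sup>2"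
  define b where "b = Suc (LEAST m. 4 * d \<le> 2 ^ m)"
  define N where "N = (1280 * K\<^sup>2 * q) ^ (K * t + K) * b ^ K"
  define L where "L = K + (K + K * t)"
  define H where "H = 4 * (N * (n * (d * (t * (K * K)))))"
  define X where "X = 12000 * (N * (n * (d * (t * (K * (K * \<tau>))))))"
  have dim: "dim_row A = n" "dim_col A = d" using A by (auto simp: binary_mats_def)
  have "0 < 1 / \<epsilon>" using \<epsilon> by simp
  then have q_pos: "0 < q" unfolding q by linarith
  have q_ge: "1 / \<epsilon> \<le> real q" unfolding q by linarith
  have K2: "2 \<le> K" using k self_le_power[of "2::nat" k] by (simp add: K_def)
  have X_le: "real X \<le> T"
    unfolding X_def T using running_time_le_time_bound[OF \<epsilon> dn(1) k \<tau>(2) q K_def t_def b_def N_def] .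
  have H_pos: "0 < H" using q_pos K2 dn by (simp add: H_def N_def t_def b_def)
  \<comment> \<open>\<open>X\<close> is exactly \<open>H * 3000 * \<tau>\<close>, since
    \<open>12000 = 4 * 3000\<close>.\<close>
  have "H * 3000 * 1 \<le> X"
  proof -
    have "H * 3000 * 1 \<le> H * 3000 * \<tau>" by (rule mult_le_mono2[OF \<tau>(1)])
    then show ?thesis by (simp add: H_def X_def mult_ac)
  qed
  then have "real (H * 3000) \<le> T" using X_le of_nat_mono[of "H * 3000" X] by linarith
  moreover have "1 \<le> real H" using H_pos by simp
  ultimately have HT: "real H * 3000 \<le> T" "3000 \<le> T" by simp_all
  \<comment> \<open>The assumed word length gives \<open>2 ^ w\<close> at least
    \<open>T\<^sup>2\<close>, which leaves room for the 16 arrays because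
    \<open>T \<ge> 3000 * H\<close>.\<close>
  have "T * T \<le> 2 ^ w"
  proof -
    have "T * T = 2 powr (2 * log 2 T)" unfolding mult_2 powr_add using HT by simp
    also have "\<dots> \<le> 2 powr real w" using w by simp
    finally show ?thesis by (simp add: powr_realpow)
  qed
  moreover have "16 * real H * 1 \<le> T * T" using HT by (intro mult_mono) auto
  ultimately have "real (16 * H) \<le> real (2 ^ w)" by simp
  then have word: "16 * H \<le> 2 ^ w" by (simp only: of_nat_le_iff)
  define Ab :: "nat \<Rightarrow> nat \<Rightarrow> nat" where "Ab = (\<lambda>i j. of_bool (A $$ (i, j) \<noteq> 0))"
  define Z where "Z = (\<lambda>x y. code3 (ip (bvec k x) (bvec k y)))"
  obtain U0 V0 where opt: "U0 \<in> binary_mats n k" "V0 \<in> binary_mats k d" "l0_opt k ip A = l0_norm (A - gen_mult ip U0 V0)"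
    using l0_opt_attained[OF A] by blast
  obtain us where us: "\<And>i. i < n \<Longrightarrow> us i < K" "\<And>i. i < n \<Longrightarrow> row U0 i = bvec k (us i)"
    using rows_bvec[OF opt(1)] unfolding K_def by blast
  obtain vs where vs: "\<And>j. j < d \<Longrightarrow> vs j < K" "\<And>j. j < d \<Longrightarrow> col V0 j = bvec k (vs j)"
    using cols_bvec[OF opt(2)] unfolding K_def by blast
  \<comment> \<open>The reference solution is an optimal one, so that the cost \<open>OPT\<close> of
    the analysis is the optimum \<open>l0_opt\<close>.\<close>
  interpret prog w k ip \<tau> H n d K Ab Z us vs t b N L q
    by unfold_locales
      (rule H_pos word \<tau>(1) K2 K_def q_pos dn(2) t_def b_def N_def L_def H_def | erule us(1) vs(1) |
        use dn(1) in \<open>simp add: Ab_def Z_def code3_def\<close>)+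
  have norm: "l0_norm (A - gen_mult ip U V) = cst u v"
    if "U \<in> binary_mats n k" "V \<in> binary_mats k d" "\<And>i. i < n \<Longrightarrow> row U i = bvec k (u i)" "\<And>j. j < d \<Longrightarrow> col V j = bvec k (v j)"
    for U V u v
  proof -
    have c: "U \<in> carrier_mat n k" "V \<in> carrier_mat k d" using that(1,2) by (auto simp: binary_mats_def)
    show ?thesis using l0_norm_bvec[OF A c(1) that(3) c(2) that(4), of ip] by (simp only: cst_def fun_cong[OF fun_cong[OF Ab_def]] fun_cong[OF fun_cong[OF Z_def]])
  qed
  have OPT: "l0_opt k ip A = OPT" unfolding opt(3) OPT_cst by (rule norm[OF opt(1,2) us(2) vs(2)])
  define m where "m = init_state w k A"
  define s0 :: cfg where "s0 = \<lparr>vr = (\<lambda>_. 0)(0 := n, 1 := d, 2 := k), ar = (\<lambda>a i. mem m (a * H + i))\<rparr>"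
  have less: "n < 2 ^ w" "d < 2 ^ w" "k < 2 ^ w" "(1::nat) < 2 ^ w" using words(1,2) kk_H(2,3) H_word(1)[of k] H_word(1)[of 2] by auto
  have rel: "rel s0 m"
    using less by (auto simp: rel_def s0_def m_def init_state_def Let_def dim take_bit_nat_eq_self)
  have A_in: "ar s0 0 (i * d + j) = Ab i j" if "i < n" "j < d" for i j
    using that A_idx[OF that] by (simp add: s0_def m_def init_state_def Let_def dim Ab_def)
  define T' where "T' = nat \<lfloor>T\<rfloor>"
  have T': "X \<le> T'" "real T' \<le> T" unfolding T'_def using X_le HT by (auto simp: le_nat_floor)
  note R = runs[OF _ rel _ _ _ _ _ A_in T'(1)[unfolded X_def]]
  obtain g where g: "steps P w k ip \<tau> T' m = map_pmf g (replicate_pmf (N * L) (pmf_of_set {..<H}))"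
    "\<And>zs. set zs \<subseteq> {..<H} \<Longrightarrow> length zs = N * L \<Longrightarrow> halted P (g zs) \<and> cost (g zs) \<le> T' \<and>
      (\<exists>s2. (\<exists>u v. (\<forall>i<n. u i < K) \<and> (\<forall>j<d. v j < K) \<and> out_ok u v s2 \<and>
        ((\<exists>g<N. good_trial q t b (take L (drop (g * L) zs))) \<longrightarrow> q * cst u v \<le> (q + 1) * OPT)) \<and> rel s2 (g zs))"
    using R unfolding ghost_bounds[of q d k K "K * t" n b N] P[symmetric] by (auto simp: Z_def m_def init_state_def Let_def s0_def)
  have final: "final_states P w k ip \<tau> A T = map_pmf g (replicate_pmf (N * L) (pmf_of_set {..<H}))"
    using g(1) by (simp add: final_states_def T'_def m_def)
  have supp: "set zs \<subseteq> {..<H} \<and> length zs = N * L" if "zs \<in> set_pmf (replicate_pmf (N * L) (pmf_of_set {..<H}))" for zs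
    using that H_pos by (auto simp: set_replicate_pmf lessThan_empty_iff)
  have "runs_in_time P w k ip \<tau> A T"
    unfolding runs_in_time_def final
  proof
    fix s assume "s \<in> set_pmf (map_pmf g (replicate_pmf (N * L) (pmf_of_set {..<H})))"
    then obtain zs where "zs \<in> set_pmf (replicate_pmf (N * L) (pmf_of_set {..<H}))" "s = g zs" by auto
    then have "halted P s" "cost s \<le> T'" using g(2)[of zs] supp[of zs] by auto
    then show "halted P s \<and> real (cost s) \<le> T" using T'(2) by (auto intro: order_trans[of _ "real T'"])
  qed
  moreover have "approx_solution (1 + \<epsilon>) k ip A (output_left k A (g zs)) (output_right k A (g zs)) \<and> halted P (g zs)"
    if zs: "set zs \<subseteq> {..<H}" "length zs = N * L" and good: "\<exists>g<N. good_trial q t b (take L (drop (g * L) zs))" for zs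
  proof -
    obtain s2 u v where uv: "\<And>i. i < n \<Longrightarrow> u i < K" "\<And>j. j < d \<Longrightarrow> v j < K" "out_ok u v s2" "q * cst u v \<le> (q + 1) * OPT"
      and r: "rel s2 (g zs)" "halted P (g zs)"
      using g(2)[OF zs] good by blast
    let ?U = "output_left k A (g zs)" and ?V = "output_right k A (g zs)"
    have bit: "mem_bit (g zs) (a * H + i) = of_bool (ar s2 a i \<noteq> 0)" if "a < 16" "i < H" for a i
      using rel_mem[OF r(1), of "i + a * H"] address(4,5)[OF that] by (simp add: mem_bit_def add.commute)
    have reg: "reg (g zs) 0 = 9 * H" "reg (g zs) 1 = 10 * H" using uv(3) rel_reg[OF r(1)] by (auto simp: out_ok_def)
    have U: "?U \<in> binary_mats n k" and V: "?V \<in> binary_mats k d"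
      unfolding output_left_def output_right_def dim by (rule mem_mat_binary)+
    have "row ?U i = bvec k (u i)" if i: "i < n" for i
    proof (rule eq_vecI)
      show "row ?U i $ l = bvec k (u i) $ l" if "l < dim_vec (bvec k (u i))" for l
      proof -
        have l: "l < k" using that by (simp add: bvec_def)
        show ?thesis using l i uv(3) bit[of 9 "i * k + l"] out_idx(1)[OF i l]
          by (simp add: output_left_def mem_mat_def dim reg bvec_def out_ok_def add.assoc)
      qed
    qed (simp add: output_left_def mem_mat_def bvec_def)
    moreover have "col ?V j = bvec k (v j)" if j: "j < d" for j
    proof (rule eq_vecI)
      show "col ?V j $ l = bvec k (v j) $ l" if "l < dim_vec (bvec k (v j))" for l
      proof -
        have l: "l < k" using that by (simp add: bvec_def)
        show ?thesis using l j uv(3) bit[of 10 "l * d + j"] out_idx(3)[OF l j]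
          by (simp add: output_right_def mem_mat_def dim reg bvec_def out_ok_def add.assoc)
      qed
    qed (simp add: output_right_def mem_mat_def bvec_def)
    ultimately have "l0_norm (A - gen_mult ip ?U ?V) = cst u v" using norm[OF U V] by blast
    moreover have "real (cst u v) \<le> (1 + \<epsilon>) * real OPT"
    proof -
      \<comment> \<open>The factor \<open>1 + 1 / q\<close> is at most \<open>1 + \<epsilon>\<close>
        because \<open>q\<close> is \<open>1 / \<epsilon>\<close> rounded up.\<close>
      have "real q * real (cst u v) \<le> (real q + 1) * real OPT"
        using of_nat_mono[OF uv(4), where 'a = real] by simp
      also have "\<dots> \<le> (real q + real q * \<epsilon>) * real OPT"
        using q_ge \<epsilon> by (intro mult_right_mono) (auto simp: field_simps)
      also have "\<dots> = real q * ((1 + \<epsilon>) * real OPT)" by (simp add: algebra_simps)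
      finally show ?thesis using q_pos by simp
    qed
    ultimately show ?thesis using U V r(2) by (simp add: approx_solution_def dim OPT)
  qed
  then have "measure_pmf.prob (replicate_pmf (N * L) (pmf_of_set {..<H})) {zs. \<exists>g<N. good_trial q t b (take L (drop (g * L) zs))} \<le>
      success_prob P w k ip \<tau> A T (1 + \<epsilon>)"
    unfolding success_prob_def final measure_map_pmf using supp by (intro measure_pmf.finite_measure_mono_AE) (auto simp: AE_measure_pmf_iff)
  then have "1 / 2 \<le> success_prob P w k ip \<tau> A T (1 + \<epsilon>)" using success by linarith
  ultimately show ?thesis by blast
qed

theorem theorem1p2:
  shows "\<exists>p::real. 0 < p \<and>
    (\<forall>c::real. \<exists>(C::real) (K::real). \<forall>\<epsilon>::real. 0 < \<epsilon> \<and> \<epsilon> < 1/2 \<longrightarrow>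
      (\<exists>P :: instr list.
        \<forall>(n::nat) (d::nat) (k::nat) (A :: real mat) (ip :: inner_prod) (\<tau>::nat) (w::nat).
          1 \<le> d \<and> d \<le> n \<and> 1 \<le> k \<and> A \<in> binary_mats n d \<and>
          1 \<le> \<tau> \<and> real \<tau> \<le> 2 powr (c * real k) \<and>
          K * log 2 (time_bound C \<epsilon> k n d) \<le> real w \<longrightarrow>
            runs_in_time P w k ip \<tau> A (time_bound C \<epsilon> k n d) \<and>
            p \<le> success_prob P w k ip \<tau> A (time_bound C \<epsilon> k n d) (1 + \<epsilon>)))"
  \<comment> \<open>The witnesses are success probability 1/2 and word factor 2. The program is left
    to unification, which finds the one that depends on \<open>\<epsilon>\<close> through
    \<open>q\<close> alone.\<close>
  apply (rule exI[of _ "1 / 2"], rule conjI, simp, rule allI)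
  subgoal for c
    by (rule exI[of _ "11 + log 2 (2 ^ 20 + \<bar>c\<bar>)"], rule exI[of _ 2], intro allI impI, rule exI, intro allI impI)
      (elim conjE, rule approximation_program[OF _ _ _ _ _ _ _ _ refl refl _ refl])
  done

end
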